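(* Let $M,\widehat M$ be oriented connected $n$-dimensional Riemannian manifolds with isometric imbeddings $\iota,\widehat\iota$ into $\mathbb{R}^{n+\nu}$. A curve $(q(t),p(t))$ in $Q\oplus P_{\iota,\widehat\iota}$ is a rolling of $M$ on $\widehat M$ if and only if it is a horizontal curve with respect to the distribution $E$ defined by $$E_{(q,p)}=\{X_0+qX_0+\mathcal V(X_0)(q,p)+\mathcal V^\perp(X_0)(q,p)\ :\ X_0\in T_xM\},\qquad (q,p)\in(Q\oplus P_{\iota,\widehat\iota})_x .$$
   Context: $\mathbb{R}^{n+\nu}$ has its standard metric and orientation; $T_x\mathbb{R}^{n+\nu}=T_xM\oplus T_xM^\perp$ (similarly for $\widehat M$), normal spaces with induced orientation. $\mathrm{Isom}_0^+$ denotes linear orientation preserving isometries. $Q=\{q\in\mathrm{Isom}_0^+(T_xM,T_{\widehat x}\widehat M): x\in M,\widehat x\in\widehat M\}$, $P_{\iota,\widehat\iota}=\{p\in\mathrm{Isom}_0^+(T_xM^\perp,T_{\widehat x}\widehat M^\perp): x\in M,\widehat x\in\widehat M\}$, and $Q\oplus P_{\iota,\widehat\iota}$ is their fibre product over $M\times\widehat M$; subscript $x$ means the points lying over $x\in M$. $\nabla$ is the Levi-Civita connection and $\nabla^\perp$ the normal connection on $M$ or $\widehat M$. Along curves, for (absolutely continuous) tangent fields $Z$ and normal fields $\Psi$, $\frac{D}{dt}Z=(\dot Z)^\top$, $\frac{D^\perp}{dt}\Psi=(\dot\Psi)^\perp$ (tangential and normal projections). A rolling is an absolutely continuous curve $(q,p):[0,\tau]\to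 Q\oplus P_{\iota,\widehat\iota}$ over $(x(t),\widehat x(t))$ such that (I) $\dot{\widehat x}(t)=q(t)\dot x(t)$ for a.e. $t$; (II) $q(t)\frac{D}{dt}Z(t)=\frac{D}{dt}q(t)Z(t)$ for any tangent field $Z$ along $x$ and a.e. $t$; (III) $p(t)\frac{D^\perp}{dt}\Psi(t)=\frac{D^\perp}{dt}p(t)\Psi(t)$ for any normal field $\Psi$ along $x$ and a.e. $t$. A curve is horizontal with respect to a distribution (smooth subbundle of the tangent bundle) if it is absolutely continuous and its derivative lies in the distribution for almost every $t$. Local description: let $U\subset M$, $\widehat U\subset\widehat M$ be open sets with positively oriented orthonormal frames $\{e_j\}$ of $TM|_U$, $\{\epsilon_\lambda\}$ of $TM^\perp|_U$, $\{\hat e_i\}$ of $T\widehat M|_{\widehat U}$, $\{\hat\epsilon_\kappa\}$ of $T\widehat M^\perp|_{\widehat U}$. They give a trivialization $h:(q,p)\mapsto(x,\widehat x,A,B)\in U\times\widehat U\times\mathrm{SO}(n)\times\mathrm{SO}(\nu)$, $A=(a_{ij})=(\langle q e_j,\hat e_i\rangle)$, $B=(b_{\kappa\lambda})=(\langle p\epsilon_\lambda,\hat\epsilon_\kappa\rangle)$, under which the tangent space splits as $TU\times T\widehat U\times T\mathrm{SO}(n)\times T\mathrm{SO}(\nu)$; $X_0$ and $qX_0$ are regarded as elements of $TU$ and $T\widehat U$ in this splitting. With $W_{ij}(A)=\sum_{r}(a_{ri}\frac{\partial}{\partial a_{rj}}-a_{rj}\frac{\partial}{\partial a_{ri}})$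 (left-invariant vector fields on $\mathrm{SO}(n)$; similarly $W_{\kappa\lambda}(B)$ on $\mathrm{SO}(\nu)$), $$\mathcal V(X_0)(q,p)=\sum_{i<j}(\langle\nabla_{X_0}e_j,e_i\rangle-\langle\nabla_{qX_0}qe_j,qe_i\rangle)W_{ij}(A),$$ $$\mathcal V^\perp(X_0)(q,p)=\sum_{\kappa<\lambda}(\langle\nabla^\perp_{X_0}\epsilon_\lambda,\epsilon_\kappa\rangle-\langle\nabla^\perp_{qX_0}p\epsilon_\lambda,p\epsilon_\kappa\rangle)W_{\kappa\lambda}(B),$$ where, for fixed $(q,p)$, $qe_j$ and $p\epsilon_\lambda$ stand for the local fields $\sum_s a_{sj}\hat e_s$ and $\sum_\kappa b_{\kappa\lambda}\hat\epsilon_\kappa$ on $\widehat U$ with constant coefficients. The subspace $E_{(q,p)}$ is given by these formulas in any such trivialization. *)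

theory Defs
  imports "HOL-Analysis.Analysis"
begin

text \<open>
  Conventions. The Euclidean space of dimension n + nu is \<open>real ^ ('n + 'm)\<close> with
  n = \<open>CARD('n)\<close> and nu = \<open>CARD('m)\<close>; the index types are linearly ordered
  only to make sense of sums over i < j. An isometrically imbedded Riemannian manifold is
  identified with its image, a subset of this space with the induced metric.
\<close>

type_synonym ('n, 'm) amb = "real ^ ('n + 'm)"
type_synonym ('n, 'm) mat = "real ^ ('n + 'm) ^ ('n + 'm)"

text \<open>Only meaningful for open S.\<close>
primrec Ck_on :: "nat \<Rightarrow> ('a::real_normed_vector \<Rightarrow> 'b::real_normed_vector) \<Rightarrow> 'a set \<Rightarrow> bool" where
  "Ck_on 0 f S \<longleftrightarrow> continuous_on S f"
| "Ck_on (Suc k) f S \<longleftrightarrow>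
     (\<forall>x\<in>S. f differentiable (at x)) \<and> (\<forall>v. Ck_on k (\<lambda>x. frechet_derivative f (at x) v) S)"

text \<open>Smoothness on an arbitrary subset: local extendability to smooth maps on open sets.\<close>
definition smooth_map_on ::
    "'a::real_normed_vector set \<Rightarrow> ('a \<Rightarrow> 'b::real_normed_vector) \<Rightarrow> bool" where
  "smooth_map_on S f \<longleftrightarrow>
     (\<forall>x\<in>S. \<exists>V g. open V \<and> x \<in> V \<and> (\<forall>k. Ck_on k g V) \<and> (\<forall>y\<in>S \<inter> V. g y = f y))"

definition smooth_submanifold :: "(('n::finite, 'm::finite) amb) set \<Rightarrow> bool" where
  "smooth_submanifold M \<longleftrightarrow>
     (\<forall>x\<in>M. \<exists>U (W :: (real ^ 'n) set) \<phi> \<psi>.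
        openin (top_of_set M) U \<and> x \<in> U \<and> open W \<and> homeomorphism W U \<phi> \<psi> \<and>
        smooth_map_on W \<phi> \<and> smooth_map_on U \<psi>)"

text \<open>
  Velocities of curves in S through x. Differentiability at 0 alone is required, so a curve
  defined near 0 can be extended by a constant; for submanifolds this is the usual tangent space.
\<close>
definition tangent_space :: "'a::real_normed_vector set \<Rightarrow> 'a \<Rightarrow> 'a set" where
  "tangent_space S x =
     {v. \<exists>c :: real \<Rightarrow> 'a. range c \<subseteq> S \<and> c 0 = x \<and> (c has_vector_derivative v) (at 0)}"

definition normal_space :: "'a::euclidean_space set \<Rightarrow> 'a \<Rightarrow> 'a set" where
  "normal_space S x = orthogonal_comp (tangent_space S x)"

definition orth_proj :: "'a::euclidean_space set \<Rightarrow> 'a \<Rightarrow> 'a" where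
  "orth_proj W v = (THE w. w \<in> W \<and> v - w \<in> orthogonal_comp W)"

text \<open>
  The differential at x of a map on the submanifold M. The Frechet derivative within M is
  determined on the tangent space only, and is only used there.
\<close>
definition differential ::
    "'a::real_normed_vector set \<Rightarrow> ('a \<Rightarrow> 'b::real_normed_vector) \<Rightarrow> 'a \<Rightarrow> 'a \<Rightarrow> 'b" where
  "differential M f x v = frechet_derivative f (at x within M) v"

definition ordered_basis :: "'a::real_vector set \<Rightarrow> ('k \<Rightarrow> 'a) \<Rightarrow> bool" where
  "ordered_basis V b \<longleftrightarrow> inj b \<and> independent (range b) \<and> span (range b) = V"

definition orientation_class :: "('k::finite \<Rightarrow> 'a::real_vector) \<Rightarrow> ('k \<Rightarrow> 'a) set" where
  "orientation_class b =
     {b'. \<exists>C :: real ^ 'k ^ 'k. det C > 0 \<and> (\<forall>j. b' j = (\<Sum>i\<in>UNIV. C $ i $ j *\<^sub>R b i))}"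

text \<open>An orientation assigns to each point the set of positively oriented tangent bases.\<close>
definition orientation_on ::
    "(('n::finite, 'm::finite) amb) set \<Rightarrow> (('n, 'm) amb \<Rightarrow> ('n \<Rightarrow> ('n, 'm) amb) set) \<Rightarrow> bool" where
  "orientation_on M ori \<longleftrightarrow>
     (\<forall>x\<in>M. \<exists>U b. openin (top_of_set M) U \<and> x \<in> U \<and> (\<forall>j. continuous_on U (\<lambda>y. b y j)) \<and>
        (\<forall>y\<in>U. ordered_basis (tangent_space M y) (b y) \<and> ori y = orientation_class (b y)))"

text \<open>
  The induced orientation of the normal spaces: a positive tangent basis followed by a positive
  normal basis is positive in the ambient space.
\<close>
definition normal_orientation ::
    "(('n::finite, 'm::finite) amb) set \<Rightarrow> (('n, 'm) amb \<Rightarrow> ('n \<Rightarrow> ('n, 'm) amb) set) \<Rightarrow>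
     ('n, 'm) amb \<Rightarrow> ('m \<Rightarrow> ('n, 'm) amb) set" where
  "normal_orientation M ori x =
     {b. ordered_basis (normal_space M x) b \<and>
         (\<forall>a\<in>ori x. det (\<chi> i k. case_sum a b k $ i) > 0)}"

text \<open>
  A linear map from V to W is represented by the matrix of its extension by zero to the
  orthogonal complement of V. The sets \<open>oV\<close>, \<open>oW\<close> consist of the positive bases.
\<close>
definition Isom0_plus ::
    "(real ^ 'd) set \<Rightarrow> ('k \<Rightarrow> real ^ 'd) set \<Rightarrow> (real ^ 'd) set \<Rightarrow> ('k \<Rightarrow> real ^ 'd) set \<Rightarrow>
     (real ^ 'd::finite ^ 'd) set" where
  "Isom0_plus V oV W oW =
     {L. (\<forall>v\<in>V. L *v v \<in> W \<and> norm (L *v v) = norm v) \<and>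
         (\<forall>v\<in>orthogonal_comp V. L *v v = 0) \<and>
         (\<forall>b\<in>oV. (\<lambda>j. L *v b j) \<in> oW)}"

type_synonym ('n, 'm) pt =
  "('n, 'm) amb \<times> ('n, 'm) amb \<times> ('n, 'm) mat \<times> ('n, 'm) mat"

definition Q_bundle ::
    "(('n::finite, 'm::finite) amb) set \<Rightarrow> (('n, 'm) amb \<Rightarrow> ('n \<Rightarrow> ('n, 'm) amb) set) \<Rightarrow>
     (('n, 'm) amb) set \<Rightarrow> (('n, 'm) amb \<Rightarrow> ('n \<Rightarrow> ('n, 'm) amb) set) \<Rightarrow>
     (('n, 'm) amb \<times> ('n, 'm) amb \<times> ('n, 'm) mat) set" where
  "Q_bundle M ori Mh orih =
     {(x, xh, q). x \<in> M \<and> xh \<in> Mh \<and>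
        q \<in> Isom0_plus (tangent_space M x) (ori x) (tangent_space Mh xh) (orih xh)}"

definition P_bundle ::
    "(('n::finite, 'm::finite) amb) set \<Rightarrow> (('n, 'm) amb \<Rightarrow> ('n \<Rightarrow> ('n, 'm) amb) set) \<Rightarrow>
     (('n, 'm) amb) set \<Rightarrow> (('n, 'm) amb \<Rightarrow> ('n \<Rightarrow> ('n, 'm) amb) set) \<Rightarrow>
     (('n, 'm) amb \<times> ('n, 'm) amb \<times> ('n, 'm) mat) set" where
  "P_bundle M ori Mh orih =
     {(x, xh, p). x \<in> M \<and> xh \<in> Mh \<and>
        p \<in> Isom0_plus (normal_space M x) (normal_orientation M ori x)
              (normal_space Mh xh) (normal_orientation Mh orih xh)}"

definition QP_bundle ::
    "(('n::finite, 'm::finite) amb) set \<Rightarrow> (('n, 'm) amb \<Rightarrow> ('n \<Rightarrow> ('n, 'm) amb) set) \<Rightarrow>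
     (('n, 'm) amb) set \<Rightarrow> (('n, 'm) amb \<Rightarrow> ('n \<Rightarrow> ('n, 'm) amb) set) \<Rightarrow> (('n, 'm) pt) set" where
  "QP_bundle M ori Mh orih =
     {(x, xh, q, p). (x, xh, q) \<in> Q_bundle M ori Mh orih \<and> (x, xh, p) \<in> P_bundle M ori Mh orih}"

definition tangent_field_on ::
    "'a::euclidean_space set \<Rightarrow> 'a set \<Rightarrow> ('a \<Rightarrow> 'a) \<Rightarrow> bool" where
  "tangent_field_on M U X \<longleftrightarrow> smooth_map_on U X \<and> (\<forall>y\<in>U. X y \<in> tangent_space M y)"

definition lie_bracket :: "'a::euclidean_space set \<Rightarrow> ('a \<Rightarrow> 'a) \<Rightarrow> ('a \<Rightarrow> 'a) \<Rightarrow> 'a \<Rightarrow> 'a" where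
  "lie_bracket M X Y x = differential M Y x (X x) - differential M X x (Y x)"

text \<open>
  \<open>nab Y x v\<close> is the covariant derivative of the local field Y in the direction of the tangent
  vector v at x. The conditions say that \<open>nab\<close> is an affine connection on M which is metric and
  torsion free. Sections over relatively open subsets U are represented by total functions whose
  values outside U are irrelevant.
\<close>
definition levi_civita :: "'a::euclidean_space set \<Rightarrow> (('a \<Rightarrow> 'a) \<Rightarrow> 'a \<Rightarrow> 'a \<Rightarrow> 'a) \<Rightarrow> bool" where
  "levi_civita M nab \<longleftrightarrow>
     (\<forall>U. openin (top_of_set M) U \<longrightarrow>
       (\<forall>X Y. tangent_field_on M U X \<longrightarrow> tangent_field_on M U Y \<longrightarrow>
          tangent_field_on M U (\<lambda>x. nab Y x (X x))) \<and>
       (\<forall>Y. tangent_field_on M U Y \<longrightarrow>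
          (\<forall>x\<in>U. \<forall>v\<in>tangent_space M x. \<forall>w\<in>tangent_space M x. \<forall>c d.
             nab Y x (c *\<^sub>R v + d *\<^sub>R w) = c *\<^sub>R nab Y x v + d *\<^sub>R nab Y x w)) \<and>
       (\<forall>Y Z. tangent_field_on M U Y \<longrightarrow> tangent_field_on M U Z \<longrightarrow>
          (\<forall>x\<in>U. \<forall>v\<in>tangent_space M x.
             nab (\<lambda>y. Y y + Z y) x v = nab Y x v + nab Z x v)) \<and>
       (\<forall>f Y. smooth_map_on U f \<longrightarrow> tangent_field_on M U Y \<longrightarrow>
          (\<forall>x\<in>U. \<forall>v\<in>tangent_space M x.
             nab (\<lambda>y. f y *\<^sub>R Y y) x v = differential M f x v *\<^sub>R Y x + f x *\<^sub>R nab Y x v)) \<and>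
       (\<forall>Y Z. tangent_field_on M U Y \<longrightarrow> tangent_field_on M U Z \<longrightarrow>
          (\<forall>x\<in>U. \<forall>v\<in>tangent_space M x.
             differential M (\<lambda>y. Y y \<bullet> Z y) x v = nab Y x v \<bullet> Z x + Y x \<bullet> nab Z x v)) \<and>
       (\<forall>X Y. tangent_field_on M U X \<longrightarrow> tangent_field_on M U Y \<longrightarrow>
          (\<forall>x\<in>U. nab Y x (X x) - nab X x (Y x) = lie_bracket M X Y x)))"

definition normal_connection ::
    "'a::euclidean_space set \<Rightarrow> ('a \<Rightarrow> 'a) \<Rightarrow> 'a \<Rightarrow> 'a \<Rightarrow> 'a" where
  "normal_connection M \<Psi> x v = orth_proj (normal_space M x) (differential M \<Psi> x v)"

definition abs_continuous_on :: "real set \<Rightarrow> (real \<Rightarrow> 'a::real_normed_vector) \<Rightarrow> bool" where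
  "abs_continuous_on I f \<longleftrightarrow>
     (\<forall>\<epsilon>>0. \<exists>\<delta>>0. \<forall>D. finite D \<longrightarrow> (\<forall>(s, t)\<in>D. s \<le> t \<and> {s..t} \<subseteq> I) \<longrightarrow>
        pairwise (\<lambda>(s, t) (s', t'). {s<..<t} \<inter> {s'<..<t'} = {}) D \<longrightarrow>
        (\<Sum>(s, t)\<in>D. t - s) < \<delta> \<longrightarrow> (\<Sum>(s, t)\<in>D. norm (f t - f s)) < \<epsilon>)"

text \<open>
  Velocities of curves on [0, \<open>\<tau>\<close>]. The default value of \<open>vector_derivative\<close> plays no role below,
  since absolutely continuous curves are differentiable almost everywhere.
\<close>
abbreviation velocity :: "real \<Rightarrow> (real \<Rightarrow> 'a::real_normed_vector) \<Rightarrow> real \<Rightarrow> 'a" where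
  "velocity \<tau> c t \<equiv> vector_derivative c (at t within {0..\<tau>})"

definition D_dt ::
    "'a::euclidean_space set \<Rightarrow> real \<Rightarrow> (real \<Rightarrow> 'a) \<Rightarrow> (real \<Rightarrow> 'a) \<Rightarrow> real \<Rightarrow> 'a" where
  "D_dt M \<tau> x Z t = orth_proj (tangent_space M (x t)) (velocity \<tau> Z t)"

definition Dperp_dt ::
    "'a::euclidean_space set \<Rightarrow> real \<Rightarrow> (real \<Rightarrow> 'a) \<Rightarrow> (real \<Rightarrow> 'a) \<Rightarrow> real \<Rightarrow> 'a" where
  "Dperp_dt M \<tau> x \<Psi> t = orth_proj (normal_space M (x t)) (velocity \<tau> \<Psi> t)"

definition rolling ::
    "(('n::finite, 'm::finite) amb) set \<Rightarrow> (('n, 'm) amb \<Rightarrow> ('n \<Rightarrow> ('n, 'm) amb) set) \<Rightarrow>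
     (('n, 'm) amb) set \<Rightarrow> (('n, 'm) amb \<Rightarrow> ('n \<Rightarrow> ('n, 'm) amb) set) \<Rightarrow> real \<Rightarrow>
     (real \<Rightarrow> ('n, 'm) amb) \<Rightarrow> (real \<Rightarrow> ('n, 'm) amb) \<Rightarrow>
     (real \<Rightarrow> ('n, 'm) mat) \<Rightarrow> (real \<Rightarrow> ('n, 'm) mat) \<Rightarrow> bool" where
  "rolling M ori Mh orih \<tau> x xh q p \<longleftrightarrow>
     (\<forall>t\<in>{0..\<tau>}. (x t, xh t, q t, p t) \<in> QP_bundle M ori Mh orih) \<and>
     abs_continuous_on {0..\<tau>} (\<lambda>t. (x t, xh t, q t, p t)) \<and>
     (AE t in lebesgue_on {0..\<tau>}. velocity \<tau> xh t = q t *v velocity \<tau> x t) \<and>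
     (\<forall>Z. abs_continuous_on {0..\<tau>} Z \<longrightarrow> (\<forall>t\<in>{0..\<tau>}. Z t \<in> tangent_space M (x t)) \<longrightarrow>
        (AE t in lebesgue_on {0..\<tau>}.
           q t *v D_dt M \<tau> x Z t = D_dt Mh \<tau> xh (\<lambda>s. q s *v Z s) t)) \<and>
     (\<forall>\<Psi>. abs_continuous_on {0..\<tau>} \<Psi> \<longrightarrow> (\<forall>t\<in>{0..\<tau>}. \<Psi> t \<in> normal_space M (x t)) \<longrightarrow>
        (AE t in lebesgue_on {0..\<tau>}.
           p t *v Dperp_dt M \<tau> x \<Psi> t = Dperp_dt Mh \<tau> xh (\<lambda>s. p s *v \<Psi> s) t))"

definition horizontal ::
    "('a \<Rightarrow> 'a set) \<Rightarrow> real \<Rightarrow> (real \<Rightarrow> 'a::real_normed_vector) \<Rightarrow> bool" where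
  "horizontal E \<tau> c \<longleftrightarrow>
     abs_continuous_on {0..\<tau>} c \<and> (AE t in lebesgue_on {0..\<tau>}. velocity \<tau> c t \<in> E (c t))"

definition pos_orthonormal_frame ::
    "'a::euclidean_space set \<Rightarrow> ('a \<Rightarrow> 'a set) \<Rightarrow> ('a \<Rightarrow> ('k \<Rightarrow> 'a) set) \<Rightarrow> ('k \<Rightarrow> 'a \<Rightarrow> 'a) \<Rightarrow> bool" where
  "pos_orthonormal_frame U V ori e \<longleftrightarrow>
     (\<forall>j. smooth_map_on U (e j)) \<and>
     (\<forall>y\<in>U. (\<forall>j. e j y \<in> V y) \<and> (\<forall>i j. e i y \<bullet> e j y = (if i = j then 1 else 0)) \<and>
            (\<lambda>j. e j y) \<in> ori y)"

definition adapted_frames ::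
    "(('n::finite, 'm::finite) amb) set \<Rightarrow> (('n, 'm) amb \<Rightarrow> ('n \<Rightarrow> ('n, 'm) amb) set) \<Rightarrow>
     (('n, 'm) amb) set \<Rightarrow> ('n \<Rightarrow> ('n, 'm) amb \<Rightarrow> ('n, 'm) amb) \<Rightarrow>
     ('m \<Rightarrow> ('n, 'm) amb \<Rightarrow> ('n, 'm) amb) \<Rightarrow> bool" where
  "adapted_frames M ori U e \<epsilon> \<longleftrightarrow>
     openin (top_of_set M) U \<and>
     pos_orthonormal_frame U (tangent_space M) ori e \<and>
     pos_orthonormal_frame U (normal_space M) (normal_orientation M ori) \<epsilon>"

definition triv ::
    "('n \<Rightarrow> ('n, 'm) amb \<Rightarrow> ('n, 'm) amb) \<Rightarrow> ('m \<Rightarrow> ('n, 'm) amb \<Rightarrow> ('n, 'm) amb) \<Rightarrow>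
     ('n \<Rightarrow> ('n, 'm) amb \<Rightarrow> ('n, 'm) amb) \<Rightarrow> ('m \<Rightarrow> ('n, 'm) amb \<Rightarrow> ('n, 'm) amb) \<Rightarrow>
     ('n::finite, 'm::finite) pt \<Rightarrow>
     ('n, 'm) amb \<times> ('n, 'm) amb \<times> (real ^ 'n ^ 'n) \<times> (real ^ 'm ^ 'm)" where
  "triv e \<epsilon> eh \<epsilon>h = (\<lambda>(x, xh, q, p).
     (x, xh, (\<chi> i j. (q *v e j x) \<bullet> eh i xh), (\<chi> \<kappa> \<mu>. (p *v \<epsilon> \<mu> x) \<bullet> \<epsilon>h \<kappa> xh)))"

text \<open>\<open>axis r (axis j 1)\<close> is the coordinate vector field of the matrix entry (r, j).\<close>
definition W_field :: "'k \<Rightarrow> 'k \<Rightarrow> real ^ 'k ^ 'k \<Rightarrow> real ^ 'k::finite ^ 'k" where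
  "W_field i j A =
     (\<Sum>r\<in>UNIV. A $ r $ i *\<^sub>R axis r (axis j 1) - A $ r $ j *\<^sub>R axis r (axis i 1))"

text \<open>The local field with constant coefficients (column j of A) in the frame \<open>eh\<close>.\<close>
definition const_comb ::
    "('k::finite \<Rightarrow> 'a \<Rightarrow> 'b::real_vector) \<Rightarrow> real ^ 'k ^ 'k \<Rightarrow> 'k \<Rightarrow> 'a \<Rightarrow> 'b" where
  "const_comb eh A j = (\<lambda>y. \<Sum>s\<in>UNIV. A $ s $ j *\<^sub>R eh s y)"

text \<open>
  The common shape of \<open>\<V>\<close> and \<open>\<V>\<^sup>\<bottom>\<close>, for a frame e at x, a frame \<open>eh\<close> at \<open>xh\<close>, the matrix A
  of the isometry in these frames, and tangent vectors X at x and \<open>Xh\<close> at \<open>xh\<close>.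
\<close>
definition V_part ::
    "(('a::euclidean_space \<Rightarrow> 'a) \<Rightarrow> 'a \<Rightarrow> 'a \<Rightarrow> 'a) \<Rightarrow> (('a \<Rightarrow> 'a) \<Rightarrow> 'a \<Rightarrow> 'a \<Rightarrow> 'a) \<Rightarrow>
     ('k \<Rightarrow> 'a \<Rightarrow> 'a) \<Rightarrow> ('k \<Rightarrow> 'a \<Rightarrow> 'a) \<Rightarrow> 'a \<Rightarrow> 'a \<Rightarrow> ((real, 'k) vec, 'k) vec \<Rightarrow> 'a \<Rightarrow> 'a \<Rightarrow>
     ((real, 'k::{finite,linorder}) vec, 'k) vec" where
  "V_part nab nabh e eh x xh A X Xh =
     (\<Sum>(i, j)\<in>{(i, j). i < j}.
        (nab (e j) x X \<bullet> e i x -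
         nabh (const_comb eh A j) xh Xh \<bullet> const_comb eh A i xh) *\<^sub>R W_field i j A)"

text \<open>The subspace E in the coordinates given by a trivialization.\<close>
definition E_local where
  "E_local M nab Mh nabh e \<epsilon> eh \<epsilon>h = (\<lambda>(x, xh, q, p).
     case triv e \<epsilon> eh \<epsilon>h (x, xh, q, p) of (_, _, A, B) \<Rightarrow>
       {(X0, q *v X0,
         V_part nab nabh e eh x xh A X0 (q *v X0),
         V_part (normal_connection M) (normal_connection Mh) \<epsilon> \<epsilon>h x xh B X0 (q *v X0)) | X0.
        X0 \<in> tangent_space M x})"

text \<open>
  A tangent vector of the bundle belongs to E if its coordinates in a trivialization around the
  base point are in \<open>E_local\<close>; the choice of the trivialization does not matter.
\<close>
definition E_distr ::
    "(('n::{finite,linorder}, 'm::{finite,linorder}) amb) set \<Rightarrow>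
     (('n, 'm) amb \<Rightarrow> ('n \<Rightarrow> ('n, 'm) amb) set) \<Rightarrow>
     ((('n, 'm) amb \<Rightarrow> ('n, 'm) amb) \<Rightarrow> ('n, 'm) amb \<Rightarrow> ('n, 'm) amb \<Rightarrow> ('n, 'm) amb) \<Rightarrow>
     (('n, 'm) amb) set \<Rightarrow> (('n, 'm) amb \<Rightarrow> ('n \<Rightarrow> ('n, 'm) amb) set) \<Rightarrow>
     ((('n, 'm) amb \<Rightarrow> ('n, 'm) amb) \<Rightarrow> ('n, 'm) amb \<Rightarrow> ('n, 'm) amb \<Rightarrow> ('n, 'm) amb) \<Rightarrow>
     ('n, 'm) pt \<Rightarrow> (('n, 'm) pt) set" where
  "E_distr M ori nab Mh orih nabh = (\<lambda>(x, xh, q, p).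
     {w \<in> tangent_space (QP_bundle M ori Mh orih) (x, xh, q, p).
        \<exists>U e \<epsilon> Uh eh \<epsilon>h.
          adapted_frames M ori U e \<epsilon> \<and> x \<in> U \<and> adapted_frames Mh orih Uh eh \<epsilon>h \<and> xh \<in> Uh \<and>
          differential (QP_bundle M ori Mh orih) (triv e \<epsilon> eh \<epsilon>h) (x, xh, q, p) w
            \<in> E_local M nab Mh nabh e \<epsilon> eh \<epsilon>h (x, xh, q, p)})"

end

(*
Extended by zero, an isometry q(t) between tangent spaces satisfies q D/dt Z = q Z', so condition (II)
for a field Z says that the tangential part of q'(t) Z(t) vanishes. The fields q(s)^T w with constant w
are admissible and span the tangent spaces; hence (II) for all Z is equivalent to
<q'(t) v, w> = 0 for almost every t and all tangent vectors v at x(t), w at xh(t), and (III) is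
equivalent to the analogous condition on p'(t). In orthonormal frames, once xh' = q x', the numbers
<q' e_j, q e_i> are exactly the difference between the entries of A^T A' and the coefficients of
the vertical field V; this uses that the Levi-Civita connection is the tangential part of the ambient derivative
(Koszul). So E contains the velocity at t if and only if (I) and both conditions hold at t. What
remains is analytic: an absolutely continuous curve is differentiable almost everywhere, proved by
Vitali covering and by comparing f with its total variation, and adapted frames exist locally, by
Gram-Schmidt.
*)

theory Submission
  imports Defs
begin

section \<open>Absolutely continuous functions are differentiable almost everywhere\<close>

text \<open>Condition (II) lets the exceptional null set depend on Z, and there are uncountably many
  Z. With w in a basis of the ambient space, the fields q^T w are finitely many, so their null sets
  unite to a single one; and they live on the whole interval, whereas fields built from local frames
  would have to be patched along the curve. Frames therefore enter at one instant at a time. There,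
  membership in E becomes a condition that mentions no frame, so the choice of a trivialization is
  harmless. M and the bundle are subsets of Euclidean spaces, and derivatives within them need not
  be unique. They are determined on velocities of curves, and every computation with
  \<open>differential\<close> rests on that. In the differentiability theorem the growth of the
  total variation disposes of unbounded difference quotients, but not of bounded oscillating ones.
  For these, a partition almost exhausting the variation makes f close to monotone on each cell,
  where an oscillation around slope 0 costs variation; other slopes are reduced to 0 by subtracting
  a linear function.\<close>

lemma sum_disjoint_increments_le:
  fixes h :: "real \<Rightarrow> real"
  assumes "finite F" "mono_on {s..t} h" "s \<le> t"
    and "\<And>j. j \<in> F \<Longrightarrow> s \<le> l j \<and> l j < r j \<and> r j \<le> t"
    and "pairwise (\<lambda>i j. disjnt {l i..r i} {l j..r j}) F"
  shows "(\<Sum>j\<in>F. h (r j) - h (l j)) \<le> h t - h s"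
  using assms
\<comment> \<open>The interval with the largest left endpoint is split off. By disjointness all
  others end before it starts, so the induction hypothesis is used with \<open>l x\<close> in place
  of \<open>t\<close>; this is why \<open>t\<close> is generalized.\<close>
proof (induction F arbitrary: t rule: finite_ranking_induct[where f = l])
  case empty
  then show ?case by (auto simp: mono_on_def)
next
  case (insert x S t)
  show ?case
  proof (cases "x \<in> S")
    case True
    then show ?thesis using insert by (simp add: insert_absorb)
  next
    case False
    have x: "s \<le> l x" "l x < r x" "r x \<le> t" using insert.prems(3)[of x] by auto
    have lt: "r j \<le> l x" if "j \<in> S" for j
    proof -
      have "disjnt {l j..r j} {l x..r x}" "l j \<le> l x"
        using insert.prems(4) that False insert.hyps(2) by (auto simp: pairwise_def)
      then have "l x \<notin> {l j..r j}" using x by (auto simp: disjnt_iff)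
      with \<open>l j \<le> l x\<close> show ?thesis by auto
    qed
    have "(\<Sum>j\<in>S. h (r j) - h (l j)) \<le> h (l x) - h s"
    proof (rule insert.IH)
      show "mono_on {s..l x} h" using insert.prems(1) x by (auto simp: mono_on_def)
      show "s \<le> l x" using x by simp
      show "pairwise (\<lambda>i j. disjnt {l i..r i} {l j..r j}) S"
        using insert.prems(4) by (simp add: pairwise_insert)
    qed (use insert.prems lt in auto)
    moreover have "h (r x) \<le> h t" using insert.prems(1) x by (auto simp: mono_on_def)
    ultimately show ?thesis using False insert.hyps(1) by simp
  qed
qed

text \<open>Vitali's covering lemma: among the intervals attached to the points of \<open>S\<close>
  there is a countable disjoint subfamily whose fivefold enlargements cover \<open>S\<close>. The
  disjoint intervals have total length at most (h t - h s) / c, because h grows on each by at least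
  c times its length. As \<open>S\<close> may fail to be measurable, its outer measure is expressed
  by a measurable superset.\<close>

lemma outer_measure_le_increment:
  fixes h :: "real \<Rightarrow> real"
  assumes h: "mono_on {s..t} h" "s \<le> t" and c: "0 < c"
    and S: "\<And>x. x \<in> S \<Longrightarrow> \<exists>l r. s \<le> l \<and> l < r \<and> r \<le> t \<and> x \<in> {l..r} \<and> c * (r - l) \<le> h r - h l"
  shows "\<exists>T. S \<subseteq> T \<and> T \<in> lmeasurable \<and> measure lebesgue T \<le> 5 / c * (h t - h s)"
proof -
  define K where "K = {(l, r). s \<le> l \<and> l < r \<and> r \<le> t \<and> c * (r - l) \<le> h r - h l}"
  define a where "a = (\<lambda>(l, r). (l + r) / 2 :: real)"
  define \<rho> where "\<rho> = (\<lambda>(l, r). (r - l) / 2 :: real)"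
  have cb: "cball (a i) (\<rho> i) = {fst i..snd i}" for i
    by (auto simp: a_def \<rho>_def cball_eq_atLeastAtMost split_beta field_simps)
  have "0 < \<rho> i \<and> \<rho> i \<le> (t - s) / 2" if "i \<in> K" for i
    using that by (auto simp: K_def \<rho>_def)
  note K = this
  obtain C where C: "countable C" "C \<subseteq> K"
     "pairwise (\<lambda>i j. disjnt (cball (a i) (\<rho> i)) (cball (a j) (\<rho> j))) C"
     "\<And>i. i \<in> K \<Longrightarrow> \<exists>j. j \<in> C \<and> \<not> disjnt (cball (a i) (\<rho> i)) (cball (a j) (\<rho> j)) \<and>
                        cball (a i) (\<rho> i) \<subseteq> ball (a j) (5 * \<rho> j)"
    by (rule Vitali_covering_lemma_cballs_balls[OF K, where a = a]) (assumption | blast)+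
  define T where "T = (\<Union>j\<in>C. ball (a j) (5 * \<rho> j))"
  \<comment> \<open>The bound is proved for finite subfamilies; being uniform, it passes to the
    countable union \<open>T\<close>.\<close>
  have bound: "measure lebesgue (\<Union>j\<in>F. ball (a j) (5 * \<rho> j)) \<le> 5 / c * (h t - h s)"
    if F: "F \<subseteq> C" "finite F" for F
  proof -
    have FK: "j \<in> K" if "j \<in> F" for j using F C that by auto
    have "measure lebesgue (\<Union>j\<in>F. ball (a j) (5 * \<rho> j))
          \<le> (\<Sum>j\<in>F. measure lebesgue (ball (a j) (5 * \<rho> j)))"
      by (rule measure_UNION_le) (use F in auto)
    also have "\<dots> = (\<Sum>j\<in>F. 5 * (snd j - fst j))"
    proof (rule sum.cong)
      fix j assume "j \<in> F"
      then have "0 < \<rho> j" using K FK by blast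
      then have "measure lebesgue (ball (a j) (5 * \<rho> j)) = 10 * \<rho> j"
        by (simp add: ball_eq_greaterThanLessThan)
      then show "measure lebesgue (ball (a j) (5 * \<rho> j)) = 5 * (snd j - fst j)"
        by (simp add: \<rho>_def split_beta)
    qed simp
    also have "\<dots> \<le> (\<Sum>j\<in>F. 5 / c * (h (snd j) - h (fst j)))"
    proof (rule sum_mono)
      fix j assume "j \<in> F"
      then have "c * (snd j - fst j) \<le> h (snd j) - h (fst j)" using FK by (auto simp: K_def)
      then show "5 * (snd j - fst j) \<le> 5 / c * (h (snd j) - h (fst j))"
        using c by (simp add: field_simps)
    qed
    also have "\<dots> = 5 / c * (\<Sum>j\<in>F. h (snd j) - h (fst j))" by (simp add: sum_distrib_left)
    also have "\<dots> \<le> 5 / c * (h t - h s)"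
    proof (rule mult_left_mono[OF sum_disjoint_increments_le[where h = h and l = fst and r = snd]])
      show "pairwise (\<lambda>i j. disjnt {fst i..snd i} {fst j..snd j}) F"
        using pairwise_subset[OF C(3) F(1)] by (simp add: cb)
    qed (use F h FK c in \<open>auto simp: K_def\<close>)
    finally show ?thesis .
  qed
  have "T \<in> lmeasurable" "measure lebesgue T \<le> 5 / c * (h t - h s)"
    unfolding T_def
    by (rule fmeasurable_UN_bound measure_UN_bound; use C(1) bound in auto)+
  moreover have "S \<subseteq> T"
  proof
    fix x assume "x \<in> S"
    then obtain i where "i \<in> K" "x \<in> cball (a i) (\<rho> i)"
      using S unfolding K_def cb by fastforce
    then show "x \<in> T" using C(4) unfolding T_def by blast
  qed
  ultimately show ?thesis by blast
qed

section \<open>Functions of bounded variation and their difference quotients\<close>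

definition bounded_variation :: "real \<Rightarrow> real \<Rightarrow> (real \<Rightarrow> real) \<Rightarrow> bool" where
  "bounded_variation a b f \<longleftrightarrow>
     (\<exists>V. \<forall>n p. (\<forall>i<n. p i \<le> p (Suc i)) \<longrightarrow> a \<le> p 0 \<longrightarrow> p n \<le> b \<longrightarrow>
        (\<Sum>i<n. \<bar>f (p (Suc i)) - f (p i)\<bar>) \<le> V)"

text \<open>Subtracting the mean slope m = (u + v) / 2 turns an oscillation of the difference
  quotients between u and v into one between -(v - u) / 2 and (v - u) / 2, the case treated by
  \<open>negligible_oscillation_points\<close>.\<close>

lemma bounded_variation_linear_diff:
  assumes "bounded_variation a b f"
  shows "bounded_variation a b (\<lambda>x. f x - m * x)"
proof -
  obtain V where V: "\<And>n p. (\<forall>i<n. p i \<le> p (Suc i)) \<Longrightarrow> a \<le> p 0 \<Longrightarrow> p n \<le> b \<Longrightarrow>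
      (\<Sum>i<n. \<bar>f (p (Suc i)) - f (p i)\<bar>) \<le> V"
    using assms unfolding bounded_variation_def by blast
  have "(\<Sum>i<n. \<bar>(f (p (Suc i)) - m * p (Suc i)) - (f (p i) - m * p i)\<bar>) \<le> V + \<bar>m\<bar> * (b - a)"
    if p: "\<forall>i<n. p i \<le> p (Suc i)" "a \<le> p 0" "p n \<le> b" for n p
  proof -
    have "(\<Sum>i<n. \<bar>(f (p (Suc i)) - m * p (Suc i)) - (f (p i) - m * p i)\<bar>)
        \<le> (\<Sum>i<n. \<bar>f (p (Suc i)) - f (p i)\<bar> + \<bar>m\<bar> * (p (Suc i) - p i))"
    proof (rule sum_mono)
      fix i assume "i \<in> {..<n}"
      then have "\<bar>m\<bar> * (p (Suc i) - p i) = \<bar>m * (p (Suc i) - p i)\<bar>" using p by (simp add: abs_mult)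
      then show "\<bar>(f (p (Suc i)) - m * p (Suc i)) - (f (p i) - m * p i)\<bar>
          \<le> \<bar>f (p (Suc i)) - f (p i)\<bar> + \<bar>m\<bar> * (p (Suc i) - p i)"
        by (simp add: algebra_simps abs_if split: if_splits)
    qed
    also have "\<dots> = (\<Sum>i<n. \<bar>f (p (Suc i)) - f (p i)\<bar>) + \<bar>m\<bar> * (p n - p 0)"
      by (simp add: sum.distrib sum_lessThan_telescope flip: sum_distrib_left)
    also have "\<dots> \<le> V + \<bar>m\<bar> * (b - a)"
      using V[OF p] p by (intro add_mono mult_left_mono) auto
    finally show ?thesis .
  qed
  then show ?thesis unfolding bounded_variation_def by blast
qed

text \<open>The witness T is the total variation of f on [a, x].\<close>
lemma total_variation_approx:
  assumes "bounded_variation a b f" "a \<le> b"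
  obtains T where "\<And>s t. a \<le> s \<Longrightarrow> s \<le> t \<Longrightarrow> t \<le> b \<Longrightarrow> \<bar>f t - f s\<bar> \<le> T t - T s"
    and "\<And>e. 0 < e \<Longrightarrow> \<exists>n p. (\<forall>i<n. p i \<le> p (Suc i)) \<and> p 0 = a \<and> p n = b \<and>
           (\<Sum>i<n. (T (p (Suc i)) - T (p i)) - \<bar>f (p (Suc i)) - f (p i)\<bar>) < e"
proof -
  define A where "A x = {\<Sum>i<n. \<bar>f (p (Suc i)) - f (p i)\<bar> | n p.
     (\<forall>i<n. p i \<le> p (Suc i)) \<and> p 0 = a \<and> p n = x}" for x
  define T where "T x = Sup (A x)" for x
  obtain V where V: "\<And>n p. (\<forall>i<n. p i \<le> p (Suc i)) \<Longrightarrow> a \<le> p 0 \<Longrightarrow> p n \<le> b \<Longrightarrow>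
      (\<Sum>i<n. \<bar>f (p (Suc i)) - f (p i)\<bar>) \<le> V"
    using assms unfolding bounded_variation_def by blast
  have bdd: "bdd_above (A x)" if "x \<le> b" for x
    by (rule bdd_aboveI[of _ V]) (use V that in \<open>auto simp: A_def\<close>)
  \<comment> \<open>A partition of [a, s] is prolonged by the point t; this is what makes increments
    of the total variation dominate those of f.\<close>
  have ext: "v + \<bar>f t - f s\<bar> \<in> A t" if "v \<in> A s" "s \<le> t" for v s t
  proof -
    obtain n p where p: "\<forall>i<n. p i \<le> p (Suc i)" "p 0 = a" "p n = s"
      "v = (\<Sum>i<n. \<bar>f (p (Suc i)) - f (p i)\<bar>)"
      using \<open>v \<in> A s\<close> unfolding A_def by blast
    let ?p = "p(Suc n := t)"
    have "v + \<bar>f t - f s\<bar> = (\<Sum>i<Suc n. \<bar>f (?p (Suc i)) - f (?p i)\<bar>)" using p by simp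
    moreover have "\<forall>i<Suc n. ?p i \<le> ?p (Suc i)" using p \<open>s \<le> t\<close> by (auto simp: less_Suc_eq)
    ultimately show ?thesis
      unfolding A_def using p by (intro CollectI exI[of _ "Suc n"] exI[of _ ?p]) auto
  qed
  have "(\<Sum>i<0. \<bar>f ((\<lambda>_. a) (Suc i)) - f ((\<lambda>_. a) i)\<bar>) \<in> A a"
    unfolding A_def by (intro CollectI exI[of _ 0] exI[of _ "\<lambda>_. a"]) auto
  then have zero: "0 \<in> A a" by simp
  have ne: "A x \<noteq> {}" if "a \<le> x" for x using ext[OF zero that] by blast
  have T: "\<bar>f t - f s\<bar> \<le> T t - T s" if "a \<le> s" "s \<le> t" "t \<le> b" for s t
  proof -
    have "T s \<le> T t - \<bar>f t - f s\<bar>"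
      unfolding T_def
    proof (rule cSup_least[OF ne[OF that(1)]])
      fix v assume "v \<in> A s"
      then have "v + \<bar>f t - f s\<bar> \<le> Sup (A t)" using ext that bdd by (intro cSup_upper) auto
      then show "v \<le> Sup (A t) - \<bar>f t - f s\<bar>" by simp
    qed
    then show ?thesis by simp
  qed
  have "\<exists>n p. (\<forall>i<n. p i \<le> p (Suc i)) \<and> p 0 = a \<and> p n = b \<and>
           (\<Sum>i<n. (T (p (Suc i)) - T (p i)) - \<bar>f (p (Suc i)) - f (p i)\<bar>) < e" if "0 < e" for e
  proof -
    \<comment> \<open>A partition whose sum is within e of the supremum proves the second claim: the
      increments of T telescope to T b - T a, which is at most T b.\<close>
    have "T b - e < Sup (A b)" using that by (simp add: T_def)
    then obtain v where v: "v \<in> A b" "T b - e < v" using less_cSupD[OF ne[OF assms(2)]] by blast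
    then obtain n p where p: "\<forall>i<n. p i \<le> p (Suc i)" "p 0 = a" "p n = b"
      "v = (\<Sum>i<n. \<bar>f (p (Suc i)) - f (p i)\<bar>)"
      unfolding A_def by blast
    have "0 \<le> T a" unfolding T_def using zero bdd assms(2) by (intro cSup_upper) auto
    then have "(\<Sum>i<n. (T (p (Suc i)) - T (p i)) - \<bar>f (p (Suc i)) - f (p i)\<bar>) < e"
      using v(2) p sum_lessThan_telescope[of "\<lambda>i. T (p i)" n] by (simp add: sum_subtractf)
    with p show ?thesis by blast
  qed
  with T that show thesis by blast
qed

lemma partition_cell:
  fixes p :: "nat \<Rightarrow> real"
  assumes "p 0 < x" "x < p n" "x \<notin> p ` {..n}"
  shows "\<exists>i<n. p i < x \<and> x < p (Suc i)"
  using assms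
proof (induction n)
  case (Suc n)
  show ?case
  proof (cases "x < p n")
    case True
    have "x \<notin> p ` {..n}" using Suc.prems(3) by auto
    with Suc True obtain i where "i < n" "p i < x" "x < p (Suc i)" by blast
    then show ?thesis by (intro exI[of _ i]) auto
  next
    case False
    have "x \<noteq> p n" using Suc.prems(3) by auto
    with False Suc.prems show ?thesis by (intro exI[of _ n]) auto
  qed
qed auto

lemma frequently_at_open_ex:
  fixes x :: "'a::topological_space"
  assumes "\<exists>\<^sub>F y in at x. P y" "open U" "x \<in> U"
  shows "\<exists>y. y \<noteq> x \<and> y \<in> U \<and> P y"
proof -
  have "\<forall>\<^sub>F y in at x. y \<noteq> x \<and> y \<in> U"
    using assms(2,3) by (auto simp: eventually_at_filter eventually_nhds)
  then have "\<forall>\<^sub>F y in at x. P y \<longrightarrow> y \<noteq> x \<and> y \<in> U \<and> P y" by (rule eventually_mono) auto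
  with assms(1) have "\<exists>\<^sub>F y in at x. y \<noteq> x \<and> y \<in> U \<and> P y"
    by (rule frequently_rev_mp)
  then show ?thesis by (rule frequently_ex)
qed

text \<open>If the quotients at x are unbounded, some interval with endpoint x satisfies |f y - f x|
  > c |y - x|, so T grows on it at rate at least c. The covering lemma bounds the outer measure of
  such points by 5 (T b - T a) / c, and c is arbitrary.\<close>

lemma negligible_steep_points:
  assumes "bounded_variation a b f" "a \<le> b"
  shows "negligible {x \<in> {a<..<b}. \<forall>c. \<exists>\<^sub>F y in at x. c < \<bar>(f y - f x) / (y - x)\<bar>}" (is "negligible ?E")
  unfolding negligible_outer_le
proof (intro allI impI)
  fix e :: real assume "0 < e"
  obtain T where T: "\<And>s t. a \<le> s \<Longrightarrow> s \<le> t \<Longrightarrow> t \<le> b \<Longrightarrow> \<bar>f t - f s\<bar> \<le> T t - T s"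
    by (rule total_variation_approx[OF assms]) (rule that)
  have "0 \<le> T b - T a" using T[of a b] assms(2) by simp
  \<comment> \<open>Chosen so that 5 (T b - T a) / c is at most e; the summand 1 keeps c positive
    when T b = T a.\<close>
  define c where "c = 5 * (T b - T a) / e + 1"
  have c: "0 < c" using \<open>0 < e\<close> \<open>0 \<le> T b - T a\<close> by (simp add: c_def add_nonneg_pos)
  have "mono_on {a..b} T"
  proof (rule mono_onI)
    fix r s assume "r \<in> {a..b}" "s \<in> {a..b}" "r \<le> s"
    then show "T r \<le> T s" using T[of r s] by auto
  qed
  moreover have "\<exists>l r. a \<le> l \<and> l < r \<and> r \<le> b \<and> x \<in> {l..r} \<and> c * (r - l) \<le> T r - T l" if "x \<in> ?E" for x
  proof -
    have fr: "\<exists>\<^sub>F y in at x. c < \<bar>(f y - f x) / (y - x)\<bar>" using that by blast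
    have "x \<in> {a<..<b}" using that by blast
    then obtain y where y: "y \<noteq> x" "y \<in> {a<..<b}" "c < \<bar>(f y - f x) / (y - x)\<bar>"
      using frequently_at_open_ex[OF fr open_greaterThanLessThan] by blast
    have "c * \<bar>y - x\<bar> < \<bar>f y - f x\<bar>" using y by (simp add: pos_less_divide_eq)
    then show ?thesis
      using T[of x y] T[of y x] y that
      by (intro exI[of _ "min x y"] exI[of _ "max x y"]) (auto simp: min_def max_def abs_if split: if_splits)
  qed
  ultimately have "\<exists>S. ?E \<subseteq> S \<and> S \<in> lmeasurable \<and> measure lebesgue S \<le> 5 / c * (T b - T a)"
    by (intro outer_measure_le_increment assms(2) c)
  then obtain S where S: "?E \<subseteq> S" "S \<in> lmeasurable" "measure lebesgue S \<le> 5 / c * (T b - T a)"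
    by blast
  have "5 * (T b - T a) \<le> e * c" using \<open>0 < e\<close> by (simp add: c_def field_simps)
  then have "5 / c * (T b - T a) \<le> e" using c by (simp add: field_simps)
  with S(3) have "measure lebesgue S \<le> e" by linarith
  with S(1,2) show "\<exists>S. ?E \<subseteq> S \<and> S \<in> lmeasurable \<and> measure lebesgue S \<le> e"
    by (intro exI[of _ S] conjI)
qed

text \<open>On a cell [s, t] of a partition that almost exhausts the variation, the function T - f (if
  f s \<open>\<le>\<close> f t; otherwise T + f) is increasing with a small total increment, but increases at
  rate at least c near every point at which f has slopes below -c (above c).\<close>
lemma negligible_oscillation_points:
  assumes "bounded_variation a b f" "a \<le> b" "0 < c"
  shows "negligible {x \<in> {a<..<b}. (\<exists>\<^sub>F y in at x. c < (f y - f x) / (y - x)) \<and>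
                                   (\<exists>\<^sub>F y in at x. (f y - f x) / (y - x) < - c)}" (is "negligible ?E")
  unfolding negligible_outer_le
proof (intro allI impI)
  fix e :: real assume "0 < e"
  obtain T where T: "\<And>s t. a \<le> s \<Longrightarrow> s \<le> t \<Longrightarrow> t \<le> b \<Longrightarrow> \<bar>f t - f s\<bar> \<le> T t - T s"
    and approx: "\<And>e. 0 < e \<Longrightarrow> \<exists>n p. (\<forall>i<n. p i \<le> p (Suc i)) \<and> p 0 = a \<and> p n = b \<and>
           (\<Sum>i<n. (T (p (Suc i)) - T (p i)) - \<bar>f (p (Suc i)) - f (p i)\<bar>) < e"
    by (rule total_variation_approx[OF assms(1,2)]) (rule that)
  \<comment> \<open>Each cell will contribute 5 / c times its defect, so a total defect below e c /
    5 gives measure at most e.\<close>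
  have "0 < e * c / 5" using \<open>0 < e\<close> assms(3) by simp
  then obtain n p where p: "\<And>i. i < n \<Longrightarrow> p i \<le> p (Suc i)" "p 0 = a" "p n = b"
    and defect: "(\<Sum>i<n. (T (p (Suc i)) - T (p i)) - \<bar>f (p (Suc i)) - f (p i)\<bar>) < e * c / 5"
    using approx by blast
  have "\<exists>S. ?E \<inter> {p i<..<p (Suc i)} \<subseteq> S \<and> S \<in> lmeasurable \<and>
      measure lebesgue S \<le> 5 / c * ((T (p (Suc i)) - T (p i)) - \<bar>f (p (Suc i)) - f (p i)\<bar>)"
    if "i < n" for i
  proof -
    define s t where "s = p i" and "t = p (Suc i)"
    have st: "s \<le> t" using p that by (simp add: s_def t_def)
    have mono: "p j \<le> p k" if "j \<le> k" "k \<le> n" for j k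
      using that by (induction k rule: dec_induct) (use p in \<open>auto intro: order_trans\<close>)
    have ab: "a \<le> s" "t \<le> b" using mono[of 0 i] mono[of "Suc i" n] p that by (auto simp: s_def t_def)
    \<comment> \<open>The sign makes g t - g s equal to |f t - f s|, so the increment of h over the
      cell is exactly the defect of the cell.\<close>
    define g where "g = (if f s \<le> f t then f else (\<lambda>x. - f x))"
    define h where "h = (\<lambda>x. T x - g x)"
    have hmono: "mono_on {s..t} h"
    proof (rule mono_onI)
      fix y z assume "y \<in> {s..t}" "z \<in> {s..t}" "y \<le> z"
      then show "h y \<le> h z" using T[of y z] ab by (auto simp: h_def g_def abs_if split: if_splits)
    qed
    have "\<exists>l r. s \<le> l \<and> l < r \<and> r \<le> t \<and> x \<in> {l..r} \<and> c * (r - l) \<le> h r - h l"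
      if "x \<in> ?E \<inter> {s<..<t}" for x
    proof -
      have "\<exists>\<^sub>F y in at x. (g y - g x) / (y - x) < - c"
      proof (cases "f s \<le> f t")
        case True
        then show ?thesis using that by (simp add: g_def)
      next
        case False
        have "\<exists>\<^sub>F y in at x. c < (f y - f x) / (y - x)" using that by blast
        moreover have "c < (f y - f x) / (y - x) \<Longrightarrow> (g y - g x) / (y - x) < - c" for y
          using False minus_divide_left[of "f y - f x" "y - x"] by (simp add: g_def)
        ultimately show ?thesis by (auto elim: frequently_elim1)
      qed
      note fr = this
      have "x \<in> {s<..<t}" using that by blast
      then obtain y where y: "y \<noteq> x" "y \<in> {s<..<t}" "(g y - g x) / (y - x) < - c"
        using frequently_at_open_ex[OF fr open_greaterThanLessThan] by blast
      define l r where "l = min x y" and "r = max x y"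
      have lr: "s \<le> l" "l < r" "r \<le> t" "x \<in> {l..r}" using y that by (auto simp: l_def r_def)
      have "(g r - g l) / (r - l) < - c"
        using y(3) minus_divide_divide[of "g y - g x" "y - x"] by (auto simp: l_def r_def min_def max_def)
      then have "g r - g l < - (c * (r - l))" using lr by (simp add: pos_divide_less_eq)
      moreover have "0 \<le> T r - T l" using T[of l r] lr ab by auto
      ultimately have "c * (r - l) \<le> h r - h l" by (simp add: h_def)
      with lr show ?thesis by blast
    qed
    then have "\<exists>S. ?E \<inter> {s<..<t} \<subseteq> S \<and> S \<in> lmeasurable \<and> measure lebesgue S \<le> 5 / c * (h t - h s)"
      by (intro outer_measure_le_increment hmono st assms(3))
    moreover have "h t - h s = (T t - T s) - \<bar>f t - f s\<bar>" by (auto simp: h_def g_def)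
    ultimately show ?thesis unfolding s_def t_def by simp
  qed
  then have "\<forall>i. \<exists>S. i < n \<longrightarrow> ?E \<inter> {p i<..<p (Suc i)} \<subseteq> S \<and> S \<in> lmeasurable \<and>
      measure lebesgue S \<le> 5 / c * ((T (p (Suc i)) - T (p i)) - \<bar>f (p (Suc i)) - f (p i)\<bar>)"
    by blast
  from choice[OF this] obtain S where
    S: "\<And>i. i < n \<Longrightarrow> ?E \<inter> {p i<..<p (Suc i)} \<subseteq> S i" "\<And>i. i < n \<Longrightarrow> S i \<in> lmeasurable"
    "\<And>i. i < n \<Longrightarrow> measure lebesgue (S i) \<le> 5 / c * ((T (p (Suc i)) - T (p i)) - \<bar>f (p (Suc i)) - f (p i)\<bar>)"
    by blast
  \<comment> \<open>The partition points lie in none of the open cells; they are added as a finite,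
    hence negligible, set.\<close>
  define S' where "S' = (\<Union>i<n. S i) \<union> p ` {..n}"
  have neg: "negligible (p ` {..n})" by (intro negligible_finite) auto
  have "?E \<subseteq> S'"
  proof
    fix x assume x: "x \<in> ?E"
    show "x \<in> S'"
    proof (cases "x \<in> p ` {..n}")
      case False
      then obtain i where "i < n" "p i < x" "x < p (Suc i)" using partition_cell[of p x n] x p by auto
      then have "x \<in> S i" using S(1)[of i] x by auto
      then show ?thesis using \<open>i < n\<close> by (auto simp: S'_def)
    qed (simp add: S'_def)
  qed
  moreover have "(\<Union>i<n. S i) \<in> lmeasurable" by (intro fmeasurable.finite_UN) (auto intro: S)
  then have "S' \<in> lmeasurable" unfolding S'_def using neg negligible_imp_measurable by blast
  moreover have "measure lebesgue S' \<le> e"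
  proof -
    have "measure lebesgue S' \<le> measure lebesgue (\<Union>i<n. S i) + measure lebesgue (p ` {..n})"
      unfolding S'_def using \<open>(\<Union>i<n. S i) \<in> lmeasurable\<close> neg
      by (intro measure_Un_le) (auto simp: negligible_imp_sets)
    also have "\<dots> = measure lebesgue (\<Union>i<n. S i)" using negligible_imp_measure0[OF neg] by simp
    also have "\<dots> \<le> (\<Sum>i<n. measure lebesgue (S i))"
      using S by (intro measure_UNION_le) auto
    also have "\<dots> \<le> (\<Sum>i<n. 5 / c * ((T (p (Suc i)) - T (p i)) - \<bar>f (p (Suc i)) - f (p i)\<bar>))"
      using S by (intro sum_mono) auto
    also have "\<dots> = 5 / c * (\<Sum>i<n. (T (p (Suc i)) - T (p i)) - \<bar>f (p (Suc i)) - f (p i)\<bar>)"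
      by (simp only: sum_distrib_left)
    also have "\<dots> \<le> 5 / c * (e * c / 5)"
      using defect assms(3) by (intro mult_left_mono) auto
    finally show ?thesis using assms(3) by simp
  qed
  ultimately show "\<exists>S. ?E \<subseteq> S \<and> S \<in> lmeasurable \<and> measure lebesgue S \<le> e"
    by (intro exI[of _ S'] conjI)
qed

text \<open>If the lower limit were smaller than the upper one, two rationals u < v would fit
  strictly between them, and g would be frequently below u and frequently above v. Rational levels
  keep the number of exceptional sets countable later. The limits are taken in \<open>ereal\<close>,
  and the bound c keeps them finite.\<close>

lemma bounded_nonoscillating_tendsto:
  fixes g :: "'a \<Rightarrow> real"
  assumes "F \<noteq> bot" "\<forall>\<^sub>F y in F. \<bar>g y\<bar> \<le> c"
    and osc: "\<And>u v. u \<in> \<rat> \<Longrightarrow> v \<in> \<rat> \<Longrightarrow> u < v \<Longrightarrow> (\<exists>\<^sub>F y in F. g y < u) \<Longrightarrow> (\<exists>\<^sub>F y in F. v < g y) \<Longrightarrow> False"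
  shows "\<exists>L. (g \<longlongrightarrow> L) F"
proof -
  define G where "G = (\<lambda>y. ereal (g y))"
  have le: "Liminf F G \<le> Limsup F G" by (rule Liminf_le_Limsup[OF assms(1)])
  have b: "ereal (-c) \<le> Liminf F G" "Limsup F G \<le> ereal c"
    unfolding G_def by (rule Liminf_bounded Limsup_bounded; use assms(2) in eventually_elim; auto)+
  have eq: "Liminf F G = Limsup F G"
  proof (rule ccontr)
    assume "\<not> ?thesis"
    with le have lt: "Liminf F G < Limsup F G" by auto
    obtain l where l: "Liminf F G = ereal l" using b lt by (cases "Liminf F G") auto
    obtain s where s: "Limsup F G = ereal s" using b lt by (cases "Limsup F G") auto
    have "l < s" using lt l s by simp
    then obtain u where u: "u \<in> \<rat>" "l < u" "u < s" using Rats_dense_in_real by blast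
    then obtain v where v: "v \<in> \<rat>" "u < v" "v < s" using Rats_dense_in_real by blast
    have "\<exists>\<^sub>F y in F. g y < u"
    proof (rule ccontr)
      assume "\<not> ?thesis"
      then have "\<forall>\<^sub>F y in F. ereal u \<le> G y" by (simp add: frequently_def not_less G_def)
      then have "ereal u \<le> Liminf F G" by (rule Liminf_bounded)
      then show False using l u by simp
    qed
    moreover have "\<exists>\<^sub>F y in F. v < g y"
    proof (rule ccontr)
      assume "\<not> ?thesis"
      then have "\<forall>\<^sub>F y in F. G y \<le> ereal v" by (simp add: frequently_def not_less G_def)
      then have "Limsup F G \<le> ereal v" by (rule Limsup_bounded)
      then show False using s v by simp
    qed
    ultimately show False using osc[OF u(1) v(1,2)] by simp
  qed
  obtain L where L: "Liminf F G = ereal L" using b eq by (cases "Limsup F G") auto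
  have "(G \<longlongrightarrow> ereal L) F" by (rule Liminf_eq_Limsup[OF assms(1)]) (use L eq in auto)
  then show ?thesis unfolding G_def by auto
qed

text \<open>At a point without derivative the quotients are either unbounded or bounded without a
  limit. In the second case they oscillate across some rationals u < v, and after subtraction of the
  slope (u + v) / 2 they get above and below by more than (v - u) / 2. So countably many negligible
  sets cover the exceptional points.\<close>

lemma negligible_nondifferentiable_bounded_variation:
  assumes "bounded_variation a b f" "a \<le> b"
  shows "negligible {x \<in> {a<..<b}. \<not> f differentiable (at x)}"
proof -
  define E0 where "E0 = {x \<in> {a<..<b}. \<forall>c. \<exists>\<^sub>F y in at x. c < \<bar>(f y - f x) / (y - x)\<bar>}"
  define E where "E m c = {x \<in> {a<..<b}.
      (\<exists>\<^sub>F y in at x. c < ((f y - m * y) - (f x - m * x)) / (y - x)) \<and>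
      (\<exists>\<^sub>F y in at x. ((f y - m * y) - (f x - m * x)) / (y - x) < - c)}" for m c
  define N where "N = insert E0 ((\<lambda>(u, v). E ((u + v) / 2) ((v - u) / 2)) ` ({(u, v). u < v} \<inter> \<rat> \<times> \<rat>))"
  have "negligible (\<Union>N)"
  proof (rule negligible_countable_Union)
    have "countable (\<rat> \<times> \<rat> :: (real \<times> real) set)" by (simp add: countable_rat)
    then show "countable N" unfolding N_def by (simp add: countable_Int2)
  next
    have "negligible E0" unfolding E0_def by (rule negligible_steep_points[OF assms])
    moreover have "negligible (E m c)" if "0 < c" for m c
      unfolding E_def
      by (rule negligible_oscillation_points[OF bounded_variation_linear_diff[OF assms(1)] assms(2) that])
    ultimately show "negligible S" if "S \<in> N" for S
      using that unfolding N_def by auto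
  qed
  moreover have "{x \<in> {a<..<b}. \<not> f differentiable (at x)} \<subseteq> \<Union>N"
  proof
    fix x assume x: "x \<in> {x \<in> {a<..<b}. \<not> f differentiable (at x)}"
    show "x \<in> \<Union>N"
    proof (rule ccontr)
      assume notN: "x \<notin> \<Union>N"
      then have "x \<notin> E0" by (simp add: N_def)
      then obtain c where "\<not> (\<exists>\<^sub>F y in at x. c < \<bar>(f y - f x) / (y - x)\<bar>)"
        using x unfolding E0_def by auto
      then have c: "\<forall>\<^sub>F y in at x. \<bar>(f y - f x) / (y - x)\<bar> \<le> c"
        by (simp add: frequently_def not_less)
      have "\<exists>L. ((\<lambda>y. (f y - f x) / (y - x)) \<longlongrightarrow> L) (at x)"
      proof (rule bounded_nonoscillating_tendsto[OF _ c])
        fix u v :: real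
        assume uv: "u \<in> \<rat>" "v \<in> \<rat>" "u < v"
          and fr: "\<exists>\<^sub>F y in at x. (f y - f x) / (y - x) < u" "\<exists>\<^sub>F y in at x. v < (f y - f x) / (y - x)"
        define m where "m = (u + v) / 2"
        have slope: "((f y - m * y) - (f x - m * x)) / (y - x) = (f y - f x) / (y - x) - m" if "y \<noteq> x" for y
          using that by (simp add: field_simps)
        have ne: "\<forall>\<^sub>F y in at x. y \<noteq> x" by (simp add: eventually_at_filter)
        have "\<exists>\<^sub>F y in at x. ((f y - m * y) - (f x - m * x)) / (y - x) < - ((v - u) / 2)"
        proof (rule frequently_rev_mp[OF fr(1)])
          have *: "q - m < - ((v - u) / 2)" if "q < u" for q using that by (simp add: m_def field_simps)
          show "\<forall>\<^sub>F y in at x. (f y - f x) / (y - x) < u \<longrightarrow>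
              ((f y - m * y) - (f x - m * x)) / (y - x) < - ((v - u) / 2)"
            using ne
          proof eventually_elim
            case (elim y)
            then show ?case using slope[OF elim] *[of "(f y - f x) / (y - x)"] by presburger
          qed
        qed
        moreover have "\<exists>\<^sub>F y in at x. (v - u) / 2 < ((f y - m * y) - (f x - m * x)) / (y - x)"
        proof (rule frequently_rev_mp[OF fr(2)])
          have *: "(v - u) / 2 < q - m" if "v < q" for q using that by (simp add: m_def field_simps)
          show "\<forall>\<^sub>F y in at x. v < (f y - f x) / (y - x) \<longrightarrow>
              (v - u) / 2 < ((f y - m * y) - (f x - m * x)) / (y - x)"
            using ne
          proof eventually_elim
            case (elim y)
            then show ?case using slope[OF elim] *[of "(f y - f x) / (y - x)"] by presburger
          qed
        qed
        ultimately have "x \<in> E m ((v - u) / 2)" using x unfolding E_def by blast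
        moreover have "E m ((v - u) / 2) \<in> N" unfolding N_def m_def using uv by (intro insertI2 image_eqI[of _ _ "(u, v)"]) auto
        ultimately show False using notN by blast
      qed simp
      then obtain L where "(f has_field_derivative L) (at x)" by (auto simp: has_field_derivative_iff)
      then have "f differentiable (at x)" by (auto simp: real_differentiable_def)
      then show False using x by simp
    qed
  qed
  ultimately show ?thesis by (rule negligible_subset)
qed

section \<open>From bounded variation to absolutely continuous curves\<close>

lemma abs_continuous_on_bounded_variation:
  fixes f :: "real \<Rightarrow> real"
  assumes "abs_continuous_on {a..b} f"
  obtains \<delta> where "0 < \<delta>" "\<And>u v. a \<le> u \<Longrightarrow> v \<le> b \<Longrightarrow> v - u < \<delta> \<Longrightarrow> bounded_variation u v f"
proof -
  \<comment> \<open>Absolute continuity with \<epsilon> = 1 bounds the variation by 1 on every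
    interval shorter than \<delta>. As differentiability is local, bounded variation on short
    intervals is enough.\<close>
  have "\<exists>\<delta>>0. \<forall>D. finite D \<longrightarrow> (\<forall>(s, t)\<in>D. s \<le> t \<and> {s..t} \<subseteq> {a..b}) \<longrightarrow>
        pairwise (\<lambda>(s, t) (s', t'). {s<..<t} \<inter> {s'<..<t'} = {}) D \<longrightarrow>
        (\<Sum>(s, t)\<in>D. t - s) < \<delta> \<longrightarrow> (\<Sum>(s, t)\<in>D. norm (f t - f s)) < 1"
    using assms unfolding abs_continuous_on_def by (rule allE[of _ 1]) simp
  then obtain \<delta> where "0 < \<delta>" and ac: "\<And>D. finite D \<Longrightarrow> (\<forall>(s, t)\<in>D. s \<le> t \<and> {s..t} \<subseteq> {a..b}) \<Longrightarrow>
        pairwise (\<lambda>(s, t) (s', t'). {s<..<t} \<inter> {s'<..<t'} = {}) D \<Longrightarrow>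
        (\<Sum>(s, t)\<in>D. t - s) < \<delta> \<Longrightarrow> (\<Sum>(s, t)\<in>D. norm (f t - f s)) < 1"
    by auto
  have "bounded_variation u v f" if uv: "a \<le> u" "v \<le> b" "v - u < \<delta>" for u v
    unfolding bounded_variation_def
  proof (intro exI[of _ 1] allI impI)
    fix n and p :: "nat \<Rightarrow> real"
    assume p: "\<forall>i<n. p i \<le> p (Suc i)" "u \<le> p 0" "p n \<le> v"
    have mono: "p j \<le> p k" if "j \<le> k" "k \<le> n" for j k
      using that by (induction k rule: dec_induct) (use p in \<open>auto intro: order_trans\<close>)
    \<comment> \<open>\<open>D\<close> is a set of pairs, so a sum over it counts equal pairs once.
      Dropping the degenerate steps, whose terms vanish, makes the map from indices to pairs
      injective.\<close>
    define J where "J = {i \<in> {..<n}. p i < p (Suc i)}"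
    define D where "D = (\<lambda>i. (p i, p (Suc i))) ` J"
    have sep: "p (Suc i) \<le> p j" if "i \<in> J" "j \<in> J" "i < j" for i j
      using that by (intro mono) (auto simp: J_def)
    have "inj_on p J"
    proof (rule linorder_inj_onI)
      fix i j assume "i < j" "i \<in> J" "j \<in> J"
      then show "p i \<noteq> p j" using sep[of i j] by (auto simp: J_def)
    qed auto
    then have inj: "inj_on (\<lambda>i. (p i, p (Suc i))) J" by (auto simp: inj_on_def)
    have restrict: "sum g J = sum g {..<n}" if "\<And>i. i < n \<Longrightarrow> p i = p (Suc i) \<Longrightarrow> g i = 0" for g :: "nat \<Rightarrow> real"
      by (rule sum.mono_neutral_left) (use that p in \<open>auto simp: J_def less_le\<close>)
    have "(\<Sum>(s, t)\<in>D. norm (f t - f s)) < 1"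
    proof (rule ac)
      show "finite D" by (simp add: D_def J_def)
      show "\<forall>(s, t)\<in>D. s \<le> t \<and> {s..t} \<subseteq> {a..b}"
      proof clarify
        fix s t assume "(s, t) \<in> D"
        then obtain i where i: "i < n" "s = p i" "t = p (Suc i)" by (auto simp: D_def J_def)
        show "s \<le> t \<and> {s..t} \<subseteq> {a..b}"
          using i p uv mono[of 0 i] mono[of "Suc i" n] by auto
      qed
      show "pairwise (\<lambda>(s, t) (s', t'). {s<..<t} \<inter> {s'<..<t'} = {}) D"
        unfolding D_def pairwise_image
      proof (rule pairwiseI)
        fix i j assume ij: "i \<in> J" "j \<in> J" "i \<noteq> j"
        then have "p (Suc i) \<le> p j \<or> p (Suc j) \<le> p i" using sep by (meson linorder_neqE_nat)
        then show "(p i, p (Suc i)) \<noteq> (p j, p (Suc j)) \<longrightarrow>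
            (case (p i, p (Suc i)) of (s, t) \<Rightarrow> \<lambda>(s', t'). {s<..<t} \<inter> {s'<..<t'} = {}) (p j, p (Suc j))"
          by auto
      qed
      have "(\<Sum>(s, t)\<in>D. t - s) = (\<Sum>i<n. p (Suc i) - p i)"
        unfolding D_def using restrict[of "\<lambda>i. p (Suc i) - p i"] by (simp add: sum.reindex[OF inj])
      also have "\<dots> = p n - p 0" by (rule sum_lessThan_telescope)
      also have "\<dots> < \<delta>" using p uv by simp
      finally show "(\<Sum>(s, t)\<in>D. t - s) < \<delta>" .
    qed
    moreover have "(\<Sum>(s, t)\<in>D. norm (f t - f s)) = (\<Sum>i<n. \<bar>f (p (Suc i)) - f (p i)\<bar>)"
      unfolding D_def using restrict[of "\<lambda>i. \<bar>f (p (Suc i)) - f (p i)\<bar>"] by (simp add: sum.reindex[OF inj])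
    ultimately show "(\<Sum>i<n. \<bar>f (p (Suc i)) - f (p i)\<bar>) \<le> 1" by simp
  qed
  with \<open>0 < \<delta>\<close> that show thesis by blast
qed

text \<open>Every interior point lies in an interval with rational endpoints and length less than
  \<delta>, on which f has bounded variation, and there are only countably many of these
  intervals.\<close>

lemma negligible_nondifferentiable_real:
  fixes f :: "real \<Rightarrow> real"
  assumes "abs_continuous_on {a..b} f"
  shows "negligible {x \<in> {a<..<b}. \<not> f differentiable (at x)}"
proof -
  obtain \<delta> where \<delta>: "0 < \<delta>" "\<And>u v. a \<le> u \<Longrightarrow> v \<le> b \<Longrightarrow> v - u < \<delta> \<Longrightarrow> bounded_variation u v f"
    using abs_continuous_on_bounded_variation[OF assms] by blast
  define N where "N = (\<lambda>(u, v). {x \<in> {u<..<v}. \<not> f differentiable (at x)}) `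
      ({(u, v). a \<le> u \<and> u \<le> v \<and> v \<le> b \<and> v - u < \<delta>} \<inter> \<rat> \<times> \<rat>)"
  have "negligible (\<Union>N)"
  proof (rule negligible_countable_Union)
    have "countable (\<rat> \<times> \<rat> :: (real \<times> real) set)" by (simp add: countable_rat)
    then show "countable N" unfolding N_def by (simp add: countable_Int2)
  next
    fix S assume "S \<in> N"
    then show "negligible S"
      unfolding N_def using negligible_nondifferentiable_bounded_variation \<delta>(2) by auto
  qed
  moreover have "{x \<in> {a<..<b}. \<not> f differentiable (at x)} \<subseteq> \<Union>N"
  proof
    fix x assume x: "x \<in> {x \<in> {a<..<b}. \<not> f differentiable (at x)}"
    then have "max a (x - \<delta> / 2) < x" "x < min b (x + \<delta> / 2)" using \<delta>(1) by auto
    then obtain u v where u: "u \<in> \<rat>" "max a (x - \<delta> / 2) < u" "u < x"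
      and v: "v \<in> \<rat>" "x < v" "v < min b (x + \<delta> / 2)" using Rats_dense_in_real by meson
    then have "{x \<in> {u<..<v}. \<not> f differentiable (at x)} \<in> N"
      unfolding N_def by (intro image_eqI[of _ _ "(u, v)"]) auto
    moreover have "x \<in> {x \<in> {u<..<v}. \<not> f differentiable (at x)}" using x u v by simp
    ultimately show "x \<in> \<Union>N" by blast
  qed
  ultimately show ?thesis by (rule negligible_subset)
qed

text \<open>Serves for the coordinates of a curve, for the components q and p of a curve in the
  bundle, and for the test fields \<open>transpose (q s) *v b\<close>.\<close>

lemma abs_continuous_on_lipschitz:
  fixes f :: "real \<Rightarrow> 'a::real_normed_vector" and g :: "real \<Rightarrow> 'b::real_normed_vector"
  assumes "abs_continuous_on I f" "\<And>s t. s \<in> I \<Longrightarrow> t \<in> I \<Longrightarrow> norm (g t - g s) \<le> C * norm (f t - f s)"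
  shows "abs_continuous_on I g"
  unfolding abs_continuous_on_def
proof (intro allI impI)
  fix \<epsilon> :: real assume "0 < \<epsilon>"
  \<comment> \<open>A positive constant, so that \<epsilon> can be divided by it.\<close>
  define C' where "C' = max C 1"
  have C': "0 < C'" "\<And>s t. s \<in> I \<Longrightarrow> t \<in> I \<Longrightarrow> norm (g t - g s) \<le> C' * norm (f t - f s)"
    using assms(2) unfolding C'_def
    by (auto intro: order_trans[OF assms(2) mult_right_mono])
  have "0 < \<epsilon> / C'" using \<open>0 < \<epsilon>\<close> C' by simp
  then have "\<exists>\<delta>>0. \<forall>D. finite D \<longrightarrow> (\<forall>(s, t)\<in>D. s \<le> t \<and> {s..t} \<subseteq> I) \<longrightarrow>
        pairwise (\<lambda>(s, t) (s', t'). {s<..<t} \<inter> {s'<..<t'} = {}) D \<longrightarrow>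
        (\<Sum>(s, t)\<in>D. t - s) < \<delta> \<longrightarrow> (\<Sum>(s, t)\<in>D. norm (f t - f s)) < \<epsilon> / C'"
    by (rule assms(1)[unfolded abs_continuous_on_def, rule_format])
  then obtain \<delta> where "0 < \<delta>" and \<delta>: "\<And>D. finite D \<Longrightarrow> (\<forall>(s, t)\<in>D. s \<le> t \<and> {s..t} \<subseteq> I) \<Longrightarrow>
        pairwise (\<lambda>(s, t) (s', t'). {s<..<t} \<inter> {s'<..<t'} = {}) D \<Longrightarrow>
        (\<Sum>(s, t)\<in>D. t - s) < \<delta> \<Longrightarrow> (\<Sum>(s, t)\<in>D. norm (f t - f s)) < \<epsilon> / C'"
    by auto
  show "\<exists>\<delta>>0. \<forall>D. finite D \<longrightarrow> (\<forall>(s, t)\<in>D. s \<le> t \<and> {s..t} \<subseteq> I) \<longrightarrow>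
        pairwise (\<lambda>(s, t) (s', t'). {s<..<t} \<inter> {s'<..<t'} = {}) D \<longrightarrow>
        (\<Sum>(s, t)\<in>D. t - s) < \<delta> \<longrightarrow> (\<Sum>(s, t)\<in>D. norm (g t - g s)) < \<epsilon>"
  proof (intro exI[of _ \<delta>] conjI allI impI)
    fix D :: "(real \<times> real) set"
    assume D: "finite D" "\<forall>(s, t)\<in>D. s \<le> t \<and> {s..t} \<subseteq> I"
      "pairwise (\<lambda>(s, t) (s', t'). {s<..<t} \<inter> {s'<..<t'} = {}) D" "(\<Sum>(s, t)\<in>D. t - s) < \<delta>"
    have "(\<Sum>(s, t)\<in>D. norm (g t - g s)) \<le> (\<Sum>(s, t)\<in>D. C' * norm (f t - f s))"
      using D(2) C'(2) by (intro sum_mono) fastforce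
    also have "\<dots> = C' * (\<Sum>(s, t)\<in>D. norm (f t - f s))" by (simp add: sum_distrib_left split_beta)
    also have "\<dots> < C' * (\<epsilon> / C')" using \<delta>[OF D] C'(1) by (intro mult_strict_left_mono)
    finally show "(\<Sum>(s, t)\<in>D. norm (g t - g s)) < \<epsilon>" using C'(1) by simp
  qed fact
qed

lemma negligible_nondifferentiable_abs_continuous:
  fixes f :: "real \<Rightarrow> 'a::euclidean_space"
  assumes "abs_continuous_on {a..b} f"
  shows "negligible {t \<in> {a..b}. \<not> (t \<in> {a<..<b} \<and> f differentiable (at t))}"
proof -
  \<comment> \<open>The endpoints are put into the exceptional set, so that elsewhere the derivative
    is two-sided.\<close>
  define N where "N = insert {a, b} ((\<lambda>i. {t \<in> {a<..<b}. \<not> (\<lambda>s. f s \<bullet> i) differentiable (at t)}) ` Basis)"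
  have ac: "abs_continuous_on {a..b} (\<lambda>s. f s \<bullet> i)" if "i \<in> Basis" for i
    by (rule abs_continuous_on_lipschitz[OF assms, of _ 1])
      (use that in \<open>simp add: Basis_le_norm flip: inner_diff_left\<close>)
  have "negligible (\<Union>N)"
  proof (rule negligible_Union)
    fix S assume "S \<in> N"
    then consider "S = {a, b}" | i where "i \<in> Basis" "S = {t \<in> {a<..<b}. \<not> (\<lambda>s. f s \<bullet> i) differentiable (at t)}"
      by (auto simp: N_def)
    then show "negligible S"
      by cases (simp_all add: negligible_nondifferentiable_real[OF ac] del: greaterThanLessThan_iff)
  qed (simp add: N_def)
  moreover have "{t \<in> {a..b}. \<not> (t \<in> {a<..<b} \<and> f differentiable (at t))} \<subseteq> \<Union>N"
  proof
    fix t assume t: "t \<in> {t \<in> {a..b}. \<not> (t \<in> {a<..<b} \<and> f differentiable (at t))}"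
    show "t \<in> \<Union>N"
    proof (cases "t \<in> {a, b}")
      case False
      with t have t': "t \<in> {a<..<b}" "\<not> f differentiable (at t)" by auto
      then obtain i where "i \<in> Basis" "\<not> (\<lambda>s. f s \<bullet> i) differentiable (at t)"
        by (subst (asm) differentiable_componentwise_within) blast
      with t'(1) show ?thesis unfolding N_def by blast
    qed (auto simp: N_def)
  qed
  ultimately show ?thesis by (rule negligible_subset)
qed

section \<open>Smooth maps\<close>

lemma Ck_on_cong:
  assumes "open S" "\<And>x. x \<in> S \<Longrightarrow> f x = g x" "Ck_on k f S"
  shows "Ck_on k g S"
  using assms(2,3)
proof (induction k arbitrary: f g)
  case 0
  then show ?case by (simp cong: continuous_on_cong)
next
  case (Suc k)
  have d: "f differentiable (at x)" if "x \<in> S" for x using Suc.prems(2) that by simp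
  have "g differentiable (at x)" if "x \<in> S" for x
    using has_derivative_transform_within_open[OF _ assms(1) that, of f _ UNIV g] d[OF that] Suc.prems(1)
    unfolding differentiable_def by blast
  moreover have "Ck_on k (\<lambda>x. frechet_derivative g (at x) v) S" for v
  proof (rule Suc.IH)
    show "Ck_on k (\<lambda>x. frechet_derivative f (at x) v) S" using Suc.prems(2) by simp
    show "frechet_derivative f (at x) v = frechet_derivative g (at x) v" if "x \<in> S" for x
      by (rule arg_cong[where f = "\<lambda>h. h v"], rule frechet_derivative_transform_within_open[OF d assms(1)])
        (use that Suc.prems in auto)
  qed
  ultimately show ?case by simp
qed

lemma Ck_on_subset: "Ck_on k f S \<Longrightarrow> T \<subseteq> S \<Longrightarrow> Ck_on k f T"
proof (induction k arbitrary: f)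
  case 0
  then show ?case by (simp add: continuous_on_subset)
next
  case (Suc k)
  then show ?case by auto
qed

lemma Ck_on_Suc_D: "Ck_on (Suc k) f S \<Longrightarrow> Ck_on k f S"
proof (induction k arbitrary: f)
  case 0
  then show ?case
    by (auto intro!: continuous_at_imp_continuous_on differentiable_imp_continuous_within)
next
  case (Suc k)
  show ?case
    unfolding Ck_on.simps
  proof (intro conjI allI)
    show "\<forall>x\<in>S. f differentiable (at x)" using Suc.prems by simp
    show "Ck_on k (\<lambda>x. frechet_derivative f (at x) v) S" for v
      by (rule Suc.IH) (use Suc.prems in simp)
  qed
qed

text \<open>The recursion of \<open>Ck_on\<close> refers to \<open>frechet_derivative\<close>, which
  is defined by choice. This rule accepts any explicit formula for the derivative, and the calculus
  rules below are obtained from it.\<close>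

lemma Ck_on_SucI:
  assumes "open S" "\<And>x. x \<in> S \<Longrightarrow> (f has_derivative f' x) (at x)"
    and "\<And>v. Ck_on k (\<lambda>x. f' x v) S"
  shows "Ck_on (Suc k) f S"
  unfolding Ck_on.simps
proof (intro conjI ballI allI)
  show "f differentiable (at x)" if "x \<in> S" for x using assms(2)[OF that] by (auto simp: differentiable_def)
  show "Ck_on k (\<lambda>x. frechet_derivative f (at x) v) S" for v
    by (rule Ck_on_cong[OF assms(1) _ assms(3)[of v]])
      (use assms(2) frechet_derivative_at in fastforce)
qed

lemma Ck_on_has_derivative:
  "Ck_on (Suc k) f S \<Longrightarrow> x \<in> S \<Longrightarrow> (f has_derivative frechet_derivative f (at x)) (at x)"
  by (simp add: frechet_derivative_works[THEN iffD1])

lemma Ck_on_const: "open S \<Longrightarrow> Ck_on k (\<lambda>x. c) S"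
proof (induction k arbitrary: c)
  case (Suc k)
  show ?case by (rule Ck_on_SucI[where f' = "\<lambda>_ _. 0"]) (use Suc in auto)
qed simp

lemma Ck_on_bounded_linear:
  assumes "bounded_linear L" "open S" "Ck_on k f S"
  shows "Ck_on k (\<lambda>x. L (f x)) S"
  using assms(3)
proof (induction k arbitrary: f)
  case 0
  then show ?case using bounded_linear.continuous_on[OF assms(1)] by auto
next
  case (Suc k)
  show ?case
  proof (rule Ck_on_SucI[OF assms(2)])
    show "((\<lambda>x. L (f x)) has_derivative (\<lambda>v. L (frechet_derivative f (at x) v))) (at x)" if "x \<in> S" for x
      by (rule bounded_linear.has_derivative[OF assms(1) Ck_on_has_derivative[OF Suc.prems that]])
    show "Ck_on k (\<lambda>x. L (frechet_derivative f (at x) v)) S" for v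
      by (rule Suc.IH) (use Suc.prems in simp)
  qed
qed

lemma Ck_on_add:
  assumes "open S" "Ck_on k f S" "Ck_on k g S"
  shows "Ck_on k (\<lambda>x. f x + g x) S"
  using assms(2,3)
proof (induction k arbitrary: f g)
  case 0
  then show ?case by (auto intro: continuous_on_add)
next
  case (Suc k)
  show ?case
  proof (rule Ck_on_SucI[OF assms(1)])
    show "((\<lambda>x. f x + g x) has_derivative
        (\<lambda>v. frechet_derivative f (at x) v + frechet_derivative g (at x) v)) (at x)" if "x \<in> S" for x
      by (rule has_derivative_add[OF Ck_on_has_derivative[OF Suc.prems(1) that]
            Ck_on_has_derivative[OF Suc.prems(2) that]])
    show "Ck_on k (\<lambda>x. frechet_derivative f (at x) v + frechet_derivative g (at x) v) S" for v
      by (rule Suc.IH) (use Suc.prems in simp_all)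
  qed
qed

lemma Ck_on_sum:
  "open S \<Longrightarrow> (\<And>i. i \<in> I \<Longrightarrow> Ck_on k (f i) S) \<Longrightarrow> Ck_on k (\<lambda>x. \<Sum>i\<in>I. f i x) S"
  by (induction I rule: infinite_finite_induct) (auto intro: Ck_on_add Ck_on_const)

lemma Ck_on_bounded_bilinear:
  assumes "bounded_bilinear B" "open S" "Ck_on k f S" "Ck_on k g S"
  shows "Ck_on k (\<lambda>x. B (f x) (g x)) S"
  using assms(3,4)
proof (induction k arbitrary: f g)
  case 0
  then show ?case using bounded_bilinear.continuous_on[OF assms(1)] by auto
next
  case (Suc k)
  show ?case
  proof (rule Ck_on_SucI[OF assms(2)])
    show "((\<lambda>x. B (f x) (g x)) has_derivative
        (\<lambda>v. B (f x) (frechet_derivative g (at x) v) + B (frechet_derivative f (at x) v) (g x))) (at x)"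
      if "x \<in> S" for x
      by (rule bounded_bilinear.FDERIV[OF assms(1) Ck_on_has_derivative[OF Suc.prems(1) that]
            Ck_on_has_derivative[OF Suc.prems(2) that]])
    show "Ck_on k (\<lambda>x. B (f x) (frechet_derivative g (at x) v) + B (frechet_derivative f (at x) v) (g x)) S" for v
      by (intro Ck_on_add[OF assms(2)] Suc.IH Ck_on_Suc_D[OF Suc.prems(1)] Ck_on_Suc_D[OF Suc.prems(2)])
        (use Suc.prems in simp_all)
  qed
qed

lemma Ck_on_compose:
  fixes f :: "'a::real_normed_vector \<Rightarrow> 'b::euclidean_space" and g :: "'b \<Rightarrow> 'c::real_normed_vector"
  assumes "open S" "open T" "f ` S \<subseteq> T" "Ck_on k f S" "Ck_on k g T"
  shows "Ck_on k (\<lambda>x. g (f x)) S"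
  using assms(4,5)
proof (induction k arbitrary: g)
  case 0
  then show ?case using continuous_on_compose2[of T g S f] assms(3) by simp
next
  case (Suc k)
  let ?f' = "\<lambda>x. frechet_derivative f (at x)" and ?g' = "\<lambda>y. frechet_derivative g (at y)"
  show ?case
  proof (rule Ck_on_SucI[OF assms(1)])
    fix x assume x: "x \<in> S"
    then have fx: "f x \<in> T" using assms(3) by auto
    have g': "(g has_derivative ?g' (f x)) (at (f x))" by (rule Ck_on_has_derivative[OF Suc.prems(2) fx])
    have "((\<lambda>x. g (f x)) has_derivative (\<lambda>v. ?g' (f x) (?f' x v))) (at x)"
      by (rule has_derivative_compose[OF Ck_on_has_derivative[OF Suc.prems(1) x] g'])
    \<comment> \<open>\<open>Ck_on\<close> controls derivatives in fixed directions, whereas the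
      direction \<open>?f' x v\<close> moves with x. Expanding it in a basis leaves fixed directions
      b and puts the dependence on x into scalar coefficients, to which the induction hypothesis and
      the product rule apply.\<close>
    also have "(\<lambda>v. ?g' (f x) (?f' x v)) = (\<lambda>v. \<Sum>b\<in>Basis. (?f' x v \<bullet> b) *\<^sub>R ?g' (f x) b)"
    proof
      fix v
      have "linear (?g' (f x))" using g' has_derivative_linear by blast
      then show "?g' (f x) (?f' x v) = (\<Sum>b\<in>Basis. (?f' x v \<bullet> b) *\<^sub>R ?g' (f x) b)"
        by (subst euclidean_representation[of "?f' x v", symmetric]) (simp add: linear_sum linear_scale)
    qed
    finally show "((\<lambda>x. g (f x)) has_derivative (\<lambda>v. \<Sum>b\<in>Basis. (?f' x v \<bullet> b) *\<^sub>R ?g' (f x) b)) (at x)" .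
  next
    fix v
    have "Ck_on k (\<lambda>x. ?g' (f x) b) S" for b
      by (rule Suc.IH[OF Ck_on_Suc_D[OF Suc.prems(1)]]) (use Suc.prems(2) in simp)
    moreover have "Ck_on k (\<lambda>x. ?f' x v \<bullet> b) S" for b
      by (rule Ck_on_bounded_linear[OF bounded_linear_inner_left assms(1)]) (use Suc.prems(1) in simp)
    ultimately show "Ck_on k (\<lambda>x. \<Sum>b\<in>Basis. (?f' x v \<bullet> b) *\<^sub>R ?g' (f x) b) S"
      by (intro Ck_on_sum assms(1) Ck_on_bounded_bilinear[OF bounded_bilinear_scaleR])
  qed
qed

text \<open>All exponents are treated at once because differentiation lowers the exponent. The
  exponent -1/2 is the one that serves to normalize a nowhere vanishing map.\<close>

lemma Ck_on_powr: "Ck_on k (\<lambda>t::real. t powr a) {0<..}"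
proof (induction k arbitrary: a)
  case 0
  have "continuous_on {0<..} (\<lambda>t::real. t powr a)"
    by (intro continuous_on_powr continuous_on_id continuous_on_const) auto
  then show ?case by simp
next
  case (Suc k)
  show ?case
  proof (rule Ck_on_SucI)
    show "((\<lambda>t. t powr a) has_derivative (\<lambda>v. (a * t powr (a - 1)) * v)) (at t)" if "t \<in> {0<..}" for t
      using has_real_derivative_powr[of t a] that by (simp add: has_field_derivative_def)
    show "Ck_on k (\<lambda>t. a * t powr (a - 1) * v) {0<..}" for v
      using Ck_on_bounded_linear[OF bounded_linear_mult_right[of "v * a"] open_greaterThan Suc.IH[of "a - 1"]]
      by (simp add: ac_simps)
  qed simp
qed

text \<open>Openness is part of the predicate because \<open>Ck_on\<close> has its meaning on open
  sets only.\<close>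

definition smooth_on_open :: "'a::real_normed_vector set \<Rightarrow> ('a \<Rightarrow> 'b::real_normed_vector) \<Rightarrow> bool" where
  "smooth_on_open S f \<longleftrightarrow> open S \<and> (\<forall>k. Ck_on k f S)"

lemma smooth_on_open_subset: "smooth_on_open S f \<Longrightarrow> open T \<Longrightarrow> T \<subseteq> S \<Longrightarrow> smooth_on_open T f"
  by (auto simp: smooth_on_open_def intro: Ck_on_subset)

lemma smooth_on_open_imp_continuous_on: "smooth_on_open S f \<Longrightarrow> continuous_on S f"
  using Ck_on.simps(1)[of f S] unfolding smooth_on_open_def by blast

lemma smooth_on_open_has_derivative:
  "smooth_on_open S f \<Longrightarrow> x \<in> S \<Longrightarrow> (f has_derivative frechet_derivative f (at x)) (at x)"
  unfolding smooth_on_open_def by (meson Ck_on_has_derivative)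

lemma smooth_on_open_directional:
  "smooth_on_open S f \<Longrightarrow> smooth_on_open S (\<lambda>x. frechet_derivative f (at x) v)"
  unfolding smooth_on_open_def
proof (elim conjE, intro conjI allI)
  fix k assume "\<forall>k. Ck_on k f S"
  then have "Ck_on (Suc k) f S" by (rule spec)
  then show "Ck_on k (\<lambda>x. frechet_derivative f (at x) v) S" by simp
qed

lemma smooth_on_open_cong:
  "smooth_on_open S f \<Longrightarrow> (\<And>x. x \<in> S \<Longrightarrow> f x = g x) \<Longrightarrow> smooth_on_open S g"
  unfolding smooth_on_open_def by (auto intro: Ck_on_cong[of S f g])

lemma smooth_on_open_compose:
  fixes f :: "'a::real_normed_vector \<Rightarrow> 'b::euclidean_space"
  shows "smooth_on_open S f \<Longrightarrow> smooth_on_open T g \<Longrightarrow> f ` S \<subseteq> T \<Longrightarrow> smooth_on_open S (\<lambda>x. g (f x))"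
  unfolding smooth_on_open_def by (auto intro!: Ck_on_compose[of S T f _ g])

lemma smooth_on_open_const: "open S \<Longrightarrow> smooth_on_open S (\<lambda>x. c)"
  by (simp add: smooth_on_open_def Ck_on_const)

lemma smooth_on_open_add:
  "smooth_on_open S f \<Longrightarrow> smooth_on_open S g \<Longrightarrow> smooth_on_open S (\<lambda>x. f x + g x)"
  by (simp add: smooth_on_open_def Ck_on_add)

lemma smooth_on_open_scaleR_const:
  "smooth_on_open S f \<Longrightarrow> smooth_on_open S (\<lambda>x. c *\<^sub>R f x)"
  by (simp add: smooth_on_open_def Ck_on_bounded_linear[OF bounded_linear_scaleR_right])

lemma smooth_on_open_diff:
  "smooth_on_open S f \<Longrightarrow> smooth_on_open S g \<Longrightarrow> smooth_on_open S (\<lambda>x. f x - g x)"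
  using smooth_on_open_add[OF _ smooth_on_open_scaleR_const[of S g "-1"]] by simp

lemma smooth_on_open_sum:
  "open S \<Longrightarrow> (\<And>i. i \<in> I \<Longrightarrow> smooth_on_open S (f i)) \<Longrightarrow> smooth_on_open S (\<lambda>x. \<Sum>i\<in>I. f i x)"
  by (simp add: smooth_on_open_def Ck_on_sum)

lemma smooth_on_open_inner:
  "smooth_on_open S f \<Longrightarrow> smooth_on_open S g \<Longrightarrow> smooth_on_open S (\<lambda>x. f x \<bullet> g x)"
  by (simp add: smooth_on_open_def Ck_on_bounded_bilinear[OF bounded_bilinear_inner])

lemma smooth_on_open_scaleR:
  "smooth_on_open S f \<Longrightarrow> smooth_on_open S g \<Longrightarrow> smooth_on_open S (\<lambda>x. f x *\<^sub>R g x)"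
  by (simp add: smooth_on_open_def Ck_on_bounded_bilinear[OF bounded_bilinear_scaleR])

lemma smooth_on_open_normalize:
  fixes f :: "'a::real_normed_vector \<Rightarrow> 'b::real_inner"
  assumes "smooth_on_open S f" "\<And>x. x \<in> S \<Longrightarrow> f x \<noteq> 0"
  shows "smooth_on_open S (\<lambda>x. f x /\<^sub>R norm (f x))"
proof -
  have "smooth_on_open {0<..} (\<lambda>t::real. t powr (-1/2))"
    unfolding smooth_on_open_def by (simp add: Ck_on_powr)
  then have "smooth_on_open S (\<lambda>x. (f x \<bullet> f x) powr (-1/2))"
    by (rule smooth_on_open_compose[OF smooth_on_open_inner[OF assms(1) assms(1)]]) (use assms(2) in auto)
  then have "smooth_on_open S (\<lambda>x. (f x \<bullet> f x) powr (-1/2) *\<^sub>R f x)"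
    by (rule smooth_on_open_scaleR[OF _ assms(1)])
  then show ?thesis
  proof (rule smooth_on_open_cong)
    fix x assume "x \<in> S"
    have "(f x \<bullet> f x) powr (-1/2) = inverse (sqrt (f x \<bullet> f x))"
      using powr_minus[of "f x \<bullet> f x" "1/2"] by (simp add: powr_half_sqrt)
    then show "(f x \<bullet> f x) powr (-1/2) *\<^sub>R f x = f x /\<^sub>R norm (f x)"
      by (simp add: norm_eq_sqrt_inner)
  qed
qed

lemma smooth_map_onE:
  assumes "smooth_map_on S f" "x \<in> S"
  obtains V g where "smooth_on_open V g" "x \<in> V" "\<And>y. y \<in> S \<Longrightarrow> y \<in> V \<Longrightarrow> g y = f y"
proof -
  obtain V g where "open V" "x \<in> V" "\<forall>k. Ck_on k g V" "\<forall>y\<in>S \<inter> V. g y = f y"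
    using assms unfolding smooth_map_on_def by blast
  then show thesis by (intro that[of V g]) (auto simp: smooth_on_open_def)
qed

lemma smooth_on_open_imp_smooth_map_on: "smooth_on_open V f \<Longrightarrow> S \<subseteq> V \<Longrightarrow> smooth_map_on S f"
  unfolding smooth_map_on_def smooth_on_open_def by blast

lemma smooth_map_on_add:
  assumes "smooth_map_on S f" "smooth_map_on S g"
  shows "smooth_map_on S (\<lambda>x. f x + g x)"
  unfolding smooth_map_on_def
proof
  fix x assume x: "x \<in> S"
  obtain V f' where f: "smooth_on_open V f'" "x \<in> V" "\<And>y. y \<in> S \<Longrightarrow> y \<in> V \<Longrightarrow> f' y = f y"
    by (rule smooth_map_onE[OF assms(1) x]) (rule that)
  obtain W g' where g: "smooth_on_open W g'" "x \<in> W" "\<And>y. y \<in> S \<Longrightarrow> y \<in> W \<Longrightarrow> g' y = g y"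
    by (rule smooth_map_onE[OF assms(2) x]) (rule that)
  have "open (V \<inter> W)" using f(1) g(1) by (auto simp: smooth_on_open_def)
  then have "smooth_on_open (V \<inter> W) (\<lambda>x. f' x + g' x)"
    using f(1) g(1) by (intro smooth_on_open_add) (auto elim: smooth_on_open_subset)
  then show "\<exists>V h. open V \<and> x \<in> V \<and> (\<forall>k. Ck_on k h V) \<and> (\<forall>y\<in>S \<inter> V. h y = f y + g y)"
    using f g by (intro exI[of _ "V \<inter> W"] exI[of _ "\<lambda>x. f' x + g' x"]) (auto simp: smooth_on_open_def)
qed

lemma smooth_map_on_scaleR_const:
  assumes "smooth_map_on S f"
  shows "smooth_map_on S (\<lambda>x. c *\<^sub>R f x)"
  unfolding smooth_map_on_def
proof
  fix x assume x: "x \<in> S"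
  obtain V f' where f: "smooth_on_open V f'" "x \<in> V" "\<And>y. y \<in> S \<Longrightarrow> y \<in> V \<Longrightarrow> f' y = f y"
    by (rule smooth_map_onE[OF assms x]) (rule that)
  then show "\<exists>V h. open V \<and> x \<in> V \<and> (\<forall>k. Ck_on k h V) \<and> (\<forall>y\<in>S \<inter> V. h y = c *\<^sub>R f y)"
    using smooth_on_open_scaleR_const[OF f(1), of c]
    by (intro exI[of _ V] exI[of _ "\<lambda>x. c *\<^sub>R f' x"]) (auto simp: smooth_on_open_def)
qed

lemma smooth_map_on_sum:
  assumes "finite I" "\<And>i. i \<in> I \<Longrightarrow> smooth_map_on S (f i)"
  shows "smooth_map_on S (\<lambda>x. \<Sum>i\<in>I. f i x)"
  using assms
proof (induction I rule: finite_induct)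
  case empty
  have "smooth_on_open UNIV (\<lambda>x. 0)" by (rule smooth_on_open_const) simp
  then show ?case using smooth_on_open_imp_smooth_map_on[of UNIV _ S] by simp
next
  case (insert i I)
  then show ?case by (simp add: smooth_map_on_add)
qed

text \<open>Near x the map coincides on M with a smooth extension, whose derivative is also one
  within M. Such derivatives may differ off the tangent space; the one asserted here is the one that
  \<open>frechet_derivative\<close> selects.\<close>

lemma smooth_map_on_has_derivative:
  assumes "smooth_map_on U f" "openin (top_of_set M) U" "x \<in> U"
  shows "(f has_derivative frechet_derivative f (at x within M)) (at x within M)"
proof -
  obtain V g where g: "smooth_on_open V g" "x \<in> V" "\<And>y. y \<in> U \<Longrightarrow> y \<in> V \<Longrightarrow> g y = f y"
    by (rule smooth_map_onE[OF assms(1,3)]) (rule that)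
  obtain W where W: "open W" "U = M \<inter> W" using assms(2) by (auto simp: openin_open)
  have gd: "(g has_derivative frechet_derivative g (at x)) (at x within M)"
    by (rule has_derivative_at_withinI[OF smooth_on_open_has_derivative[OF g(1,2)]])
  have "open (V \<inter> W)" "x \<in> V \<inter> W" using g(1,2) W assms(3) by (auto simp: smooth_on_open_def)
  then obtain d where d: "0 < d" "ball x d \<subseteq> V \<inter> W" using openE by blast
  have "(f has_derivative frechet_derivative g (at x)) (at x within M)"
    by (rule has_derivative_transform_within[OF gd d(1)]) (use d(2) g(3) W assms(3) in \<open>auto simp: subset_iff dist_commute\<close>)
  then have "f differentiable (at x within M)" by (auto simp: differentiable_def)
  then show ?thesis by (rule frechet_derivative_works[THEN iffD1])
qed

section \<open>Local orthonormal frames\<close>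

lemma has_derivative_along_curve:
  assumes "(F has_derivative F') (at (c t) within S)" "(c has_vector_derivative v) (at t within I)" "c ` I \<subseteq> S"
  shows "((\<lambda>s. F (c s)) has_vector_derivative F' v) (at t within I)"
proof -
  have "(c has_derivative (\<lambda>s. s *\<^sub>R v)) (at t within I)" using assms(2) by (simp add: has_vector_derivative_def)
  moreover have "(F has_derivative F') (at (c t) within c ` I)" by (rule has_derivative_subset[OF assms(1,3)])
  ultimately have "((\<lambda>s. F (c s)) has_derivative (\<lambda>s. F' (s *\<^sub>R v))) (at t within I)"
    by (rule has_derivative_in_compose)
  moreover have "linear F'" using assms(1) has_derivative_linear by blast
  ultimately show ?thesis by (simp add: has_vector_derivative_def linear_scale)
qed

lemma tangent_spaceI:
  fixes c :: "real \<Rightarrow> 'a::real_normed_vector"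
  assumes "t \<in> {a<..<b}" "\<And>s. s \<in> {a<..<b} \<Longrightarrow> c s \<in> S" "(c has_vector_derivative v) (at t)"
  shows "v \<in> tangent_space S (c t)"
proof -
  define d where "d = (\<lambda>s. if t + s \<in> {a<..<b} then c (t + s) else c t)"
  have "(c has_vector_derivative v) (at (t + 0))" using assms(3) by simp
  then have "((\<lambda>s. c (t + s)) has_vector_derivative v) (at 0)"
    by (simp add: has_vector_derivative_def has_derivative_at add.assoc [symmetric])
  then have "(d has_vector_derivative v) (at 0)"
  proof (rule has_vector_derivative_transform_within_open[where S = "{a - t<..<b - t}"])
  qed (use assms(1) in \<open>auto simp: d_def\<close>)
  moreover have "range d \<subseteq> S" "d 0 = c t" using assms(1,2) by (auto simp: d_def)
  ultimately show ?thesis unfolding tangent_space_def by blast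
qed

lemma independent_axes:
  "inj (\<lambda>j::'n::finite. axis j (1::real))" "independent (range (\<lambda>j::'n::finite. axis j (1::real)))"
proof -
  show "inj (\<lambda>j::'n. axis j (1::real))" by (auto simp: inj_on_def axis_eq_axis)
  have "range (\<lambda>j::'n. axis j (1::real)) = Basis" by (auto simp: Basis_vec_def)
  then show "independent (range (\<lambda>j::'n. axis j (1::real)))" using independent_Basis by simp
qed

text \<open>These are the coordinate fields of a chart. \<open>g\<close> and \<open>h\<close> extend
  the parametrization and its inverse smoothly, and the derivative of \<open>g\<close> at
  \<open>h y\<close> is applied to the axes, which makes sense off M too. As \<open>h\<close> after
  \<open>g\<close> is the identity near the base point, the derivative of \<open>g\<close> there is
  injective, whence independence at x.\<close>

lemma smooth_local_tangent_basis:
  fixes M :: "(('n::finite, 'm::finite) amb) set"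
  assumes "smooth_submanifold M" "x \<in> M"
  obtains N and b :: "'n \<Rightarrow> ('n, 'm) amb \<Rightarrow> ('n, 'm) amb" where
    "x \<in> N" "\<And>j. smooth_on_open N (b j)" "\<And>y j. y \<in> M \<Longrightarrow> y \<in> N \<Longrightarrow> b j y \<in> tangent_space M y"
    "inj (\<lambda>j. b j x)" "independent (range (\<lambda>j. b j x))"
proof -
  obtain U and W :: "(real ^ 'n) set" and \<phi> \<psi> where U: "openin (top_of_set M) U" "x \<in> U"
    and W: "open W" "homeomorphism W U \<phi> \<psi>" and smooth: "smooth_map_on W \<phi>" "smooth_map_on U \<psi>"
    using assms unfolding smooth_submanifold_def by blast
  have \<phi>\<psi>: "\<And>y. y \<in> U \<Longrightarrow> \<psi> y \<in> W \<and> \<phi> (\<psi> y) = y" "\<And>w. w \<in> W \<Longrightarrow> \<phi> w \<in> U \<and> \<psi> (\<phi> w) = w"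
    using W(2) unfolding homeomorphism_def by auto
  have w0: "\<psi> x \<in> W" using \<phi>\<psi> U(2) by blast
  obtain V g where g: "smooth_on_open V g" "\<psi> x \<in> V" "\<And>w. w \<in> W \<Longrightarrow> w \<in> V \<Longrightarrow> g w = \<phi> w"
    by (rule smooth_map_onE[OF smooth(1) w0]) (rule that)
  obtain V2 h where h: "smooth_on_open V2 h" "x \<in> V2" "\<And>y. y \<in> U \<Longrightarrow> y \<in> V2 \<Longrightarrow> h y = \<psi> y"
    by (rule smooth_map_onE[OF smooth(2) U(2)]) (rule that)
  obtain N1 where N1: "open N1" "U = M \<inter> N1" using U(1) by (auto simp: openin_open)
  define V' where "V' = W \<inter> V"
  have V': "open V'" "\<psi> x \<in> V'" "V' \<subseteq> V" using W(1) g(1,2) w0 by (auto simp: V'_def smooth_on_open_def)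
  have g': "smooth_on_open V' g" by (rule smooth_on_open_subset[OF g(1) V'(1,3)])
  have gV': "g w = \<phi> w" "g w \<in> U" "\<psi> (g w) = w" if "w \<in> V'" for w
    using that g(3) \<phi>\<psi>(2) by (auto simp: V'_def)
  \<comment> \<open>On \<open>N\<close> the point \<open>h y\<close> stays where \<open>g\<close> is
    smooth and parametrizes, and M meets \<open>N\<close> only inside the chart domain
    \<open>U\<close>.\<close>
  define N where "N = N1 \<inter> {y \<in> V2. h y \<in> V'}"
  have "open {y \<in> V2. h y \<in> V'}"
    using continuous_open_preimage[OF smooth_on_open_imp_continuous_on[OF h(1)] _ V'(1)] h(1)
    by (simp add: smooth_on_open_def vimage_def Int_def)
  then have N: "open N" using N1(1) by (auto simp: N_def)
  define b where "b j y = frechet_derivative g (at (h y)) (axis j 1)" for j :: 'n and y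
  have hx: "h x = \<psi> x" using h U(2) by blast
  show thesis
  proof (rule that[of N b])
    show "x \<in> N" using h(2) hx V' U(2) N1 by (auto simp: N_def)
    have hN: "smooth_on_open N h" by (rule smooth_on_open_subset[OF h(1) N]) (auto simp: N_def)
    show "smooth_on_open N (b j)" for j
      unfolding b_def
      by (rule smooth_on_open_compose[OF hN smooth_on_open_directional[OF g']]) (auto simp: N_def)
    show "b j y \<in> tangent_space M y" if "y \<in> M" "y \<in> N" for y j
    proof -
      have y: "y \<in> U" "h y \<in> V'" "h y = \<psi> y" using that h(3) N1 by (auto simp: N_def)
      then have gy: "g (h y) = y" using gV' \<phi>\<psi> by simp
      obtain r where r: "0 < r" "ball (h y) r \<subseteq> V'" using V'(1) y(2) openE by blast
      define c where "c = (\<lambda>s. g (h y + s *\<^sub>R axis j 1))"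
      have line: "((\<lambda>s. h y + s *\<^sub>R axis j 1) has_vector_derivative axis j 1) (at 0)"
        by (auto intro!: derivative_eq_intros)
      have "(g has_derivative frechet_derivative g (at (h y))) (at (h y + 0 *\<^sub>R axis j 1))"
        using smooth_on_open_has_derivative[OF g' y(2)] by simp
      from has_derivative_along_curve[OF this line] have "(c has_vector_derivative b j y) (at 0)"
        unfolding c_def b_def by simp
      moreover have "c s \<in> M" if "s \<in> {-r<..<r}" for s
      proof -
        have "dist (h y) (h y + s *\<^sub>R axis j 1) = \<bar>s\<bar>"
          by (simp add: dist_norm)
        then have "h y + s *\<^sub>R axis j 1 \<in> V'" using that r(2) by (auto simp: subset_iff)
        then show ?thesis using gV'(2) N1 by (auto simp: c_def)
      qed
      ultimately have "b j y \<in> tangent_space M (c 0)"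
        by (intro tangent_spaceI[of 0 "-r" r]) (use r(1) in auto)
      then show ?thesis by (simp add: c_def gy)
    qed
    let ?g' = "frechet_derivative g (at (\<psi> x))"
    have gx: "g (\<psi> x) = x" using gV'(1)[OF V'(2)] \<phi>\<psi> U(2) by simp
    have g'': "(g has_derivative ?g') (at (\<psi> x))" by (rule smooth_on_open_has_derivative[OF g' V'(2)])
    have "(h has_derivative frechet_derivative h (at x)) (at (g (\<psi> x)))"
      unfolding gx by (rule smooth_on_open_has_derivative[OF h(1,2)])
    then have "((\<lambda>w. h (g w)) has_derivative (\<lambda>v. frechet_derivative h (at x) (?g' v))) (at (\<psi> x))"
      by (rule has_derivative_compose[OF g''])
    moreover have "((\<lambda>w. h (g w)) has_derivative (\<lambda>v. v)) (at (\<psi> x))"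
    proof (rule has_derivative_transform_within_open[OF has_derivative_ident])
      have "open {w \<in> V'. g w \<in> V2}"
        using continuous_open_preimage[OF smooth_on_open_imp_continuous_on[OF g'] V'(1), of V2] h(1)
        by (simp add: smooth_on_open_def vimage_def Int_def)
      then show "open {w \<in> V'. g w \<in> V2}" .
      show "\<psi> x \<in> {w \<in> V'. g w \<in> V2}" using V'(2) gx h(2) by simp
      show "w = h (g w)" if "w \<in> {w \<in> V'. g w \<in> V2}" for w
        using that h(3)[of "g w"] gV'(2,3)[of w] by simp
    qed
    ultimately have "(\<lambda>v. frechet_derivative h (at x) (?g' v)) = (\<lambda>v. v)"
      by (rule has_derivative_unique)
    then have inj: "inj ?g'" by (metis injI)
    have lin: "linear ?g'" using g'' has_derivative_linear by blast
    have bx: "(\<lambda>j. b j x) = ?g' \<circ> (\<lambda>j. axis j 1)" by (auto simp: b_def hx)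
    show "inj (\<lambda>j. b j x)" unfolding bx by (rule inj_compose[OF inj independent_axes(1)])
    show "independent (range (\<lambda>j. b j x))"
      unfolding bx image_comp[symmetric]
      by (rule linear_independent_injective_image[OF lin independent_axes(2)]) (rule inj_on_subset[OF inj subset_UNIV])
  qed
qed

text \<open>Independence is assumed at x alone: at each step the orthogonalized field
  \<open>v\<close> is nonzero at x, and the neighbourhood shrinks to the open set where it is
  nonzero. The fields indexed by \<open>S0\<close>, already orthonormal, are left unchanged, so that
  a tangent frame can be completed by normal fields.\<close>

lemma smooth_gram_schmidt:
  fixes b :: "'k \<Rightarrow> 'a::real_normed_vector \<Rightarrow> 'b::euclidean_space"
  assumes "finite S" "finite S0" "S0 \<inter> S = {}" "x \<in> N"
    and "\<And>i. i \<in> S0 \<union> S \<Longrightarrow> smooth_on_open N (b i)"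
    and "\<And>y i j. y \<in> N \<Longrightarrow> i \<in> S0 \<Longrightarrow> j \<in> S0 \<Longrightarrow> b i y \<bullet> b j y = (if i = j then 1 else 0)"
    and "inj_on (\<lambda>i. b i x) (S0 \<union> S)" "independent ((\<lambda>i. b i x) ` (S0 \<union> S))"
    and "open N"
  shows "\<exists>N' e. open N' \<and> x \<in> N' \<and> N' \<subseteq> N \<and> (\<forall>i\<in>S0 \<union> S. smooth_on_open N' (e i)) \<and> (\<forall>i\<in>S0. e i = b i) \<and>
     (\<forall>y\<in>N'. \<forall>i\<in>S0 \<union> S. e i y \<in> span ((\<lambda>i. b i y) ` (S0 \<union> S)) \<and>
        (\<forall>j\<in>S0 \<union> S. e i y \<bullet> e j y = (if i = j then 1 else 0)))"
  using assms
proof (induction S rule: finite_induct)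
  case empty
  show ?case
    by (rule exI[of _ N], rule exI[of _ b]) (use empty in \<open>auto intro: span_base\<close>)
next
  case (insert k S)
  define T where "T = S0 \<union> S"
  have T: "finite T" "k \<notin> T" "S0 \<union> insert k S = insert k T"
    using insert.hyps insert.prems(1,2) by (auto simp: T_def)
  have inj: "inj_on (\<lambda>i. b i x) (insert k T)" using insert.prems(6) unfolding T(3) .
  have ind: "independent ((\<lambda>i. b i x) ` insert k T)" using insert.prems(7) unfolding T(3) .
  have "\<exists>N' e. open N' \<and> x \<in> N' \<and> N' \<subseteq> N \<and> (\<forall>i\<in>S0 \<union> S. smooth_on_open N' (e i)) \<and> (\<forall>i\<in>S0. e i = b i) \<and>
     (\<forall>y\<in>N'. \<forall>i\<in>S0 \<union> S. e i y \<in> span ((\<lambda>i. b i y) ` (S0 \<union> S)) \<and>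
        (\<forall>j\<in>S0 \<union> S. e i y \<bullet> e j y = (if i = j then 1 else 0)))"
  proof (rule insert.IH)
    show "inj_on (\<lambda>i. b i x) (S0 \<union> S)" using inj by (auto simp: T_def inj_on_def)
    show "independent ((\<lambda>i. b i x) ` (S0 \<union> S))" by (rule independent_mono[OF ind]) (auto simp: T_def)
    show "S0 \<inter> S = {}" "finite S0" "x \<in> N" "open N" using insert.prems by auto
    show "smooth_on_open N (b i)" if "i \<in> S0 \<union> S" for i using insert.prems(4) that by auto
    show "b i y \<bullet> b j y = (if i = j then 1 else 0)" if "y \<in> N" "i \<in> S0" "j \<in> S0" for y i j
      by (rule insert.prems(5)[OF that])
  qed
  then obtain N' e where N': "open N'" "x \<in> N'" "N' \<subseteq> N"
    and sm': "\<forall>i\<in>S0 \<union> S. smooth_on_open N' (e i)" and eb': "\<forall>i\<in>S0. e i = b i"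
    and spon: "\<forall>y\<in>N'. \<forall>i\<in>S0 \<union> S. e i y \<in> span ((\<lambda>i. b i y) ` (S0 \<union> S)) \<and>
        (\<forall>j\<in>S0 \<union> S. e i y \<bullet> e j y = (if i = j then 1 else 0))"
    by (elim exE conjE)
  have sm: "\<And>i. i \<in> T \<Longrightarrow> smooth_on_open N' (e i)" and eb: "\<And>i. i \<in> S0 \<Longrightarrow> e i = b i"
    and sp: "\<And>y i. y \<in> N' \<Longrightarrow> i \<in> T \<Longrightarrow> e i y \<in> span ((\<lambda>i. b i y) ` T)"
    and on: "\<And>y i j. y \<in> N' \<Longrightarrow> i \<in> T \<Longrightarrow> j \<in> T \<Longrightarrow> e i y \<bullet> e j y = (if i = j then 1 else 0)"
    using sm' eb' spon unfolding T_def by blast+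
  define v where "v y = b k y - (\<Sum>i\<in>T. (b k y \<bullet> e i y) *\<^sub>R e i y)" for y
  have bk: "smooth_on_open N' (b k)" by (rule smooth_on_open_subset[OF insert.prems(4) N'(1,3)]) simp
  have v_smooth: "smooth_on_open N' v"
    unfolding v_def by (intro smooth_on_open_diff smooth_on_open_sum smooth_on_open_scaleR smooth_on_open_inner bk sm N'(1))
  have v_orth: "v y \<bullet> e j y = 0" if "y \<in> N'" "j \<in> T" for y j
  proof -
    have "(\<Sum>i\<in>T. (b k y \<bullet> e i y) *\<^sub>R e i y) \<bullet> e j y = (\<Sum>i\<in>T. if i = j then b k y \<bullet> e i y else 0)"
      unfolding inner_sum_left by (rule sum.cong) (use on that in auto)
    then show ?thesis using T(1) that by (simp add: v_def inner_diff_left)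
  qed
  have v_span: "v y \<in> span ((\<lambda>i. b i y) ` insert k T)" if "y \<in> N'" for y
    unfolding v_def
  proof (intro span_diff span_sum span_scale)
    show "b k y \<in> span ((\<lambda>i. b i y) ` insert k T)" by (auto intro: span_base)
    show "e i y \<in> span ((\<lambda>i. b i y) ` insert k T)" if "i \<in> T" for i
      by (rule subsetD[OF span_mono sp[OF \<open>y \<in> N'\<close> that]]) auto
  qed
  have "v x \<noteq> 0"
  proof
    assume "v x = 0"
    then have "b k x = (\<Sum>i\<in>T. (b k x \<bullet> e i x) *\<^sub>R e i x)" by (simp add: v_def)
    moreover have "(\<Sum>i\<in>T. (b k x \<bullet> e i x) *\<^sub>R e i x) \<in> span ((\<lambda>i. b i x) ` T)"
      by (intro span_sum span_scale sp N'(2))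
    ultimately have "b k x \<in> span ((\<lambda>i. b i x) ` T)" by simp
    moreover have "(\<lambda>i. b i x) ` T = (\<lambda>i. b i x) ` insert k T - {b k x}"
      using inj T(2) by (auto simp: inj_on_def)
    moreover have "b k x \<in> (\<lambda>i. b i x) ` insert k T" by simp
    ultimately show False using ind unfolding dependent_def by metis
  qed
  define N'' where "N'' = {y \<in> N'. v y \<noteq> 0}"
  have N'': "open N''"
    using continuous_open_preimage[OF smooth_on_open_imp_continuous_on[OF v_smooth] N'(1)
        open_Compl[OF closed_singleton[of 0]]]
    by (simp add: N''_def vimage_def Int_def)
  have sub: "N'' \<subseteq> N'" by (auto simp: N''_def)
  define e' where "e' = e(k := (\<lambda>y. v y /\<^sub>R norm (v y)))"
  show ?case
    unfolding T(3)
  proof (intro exI[of _ N''] exI[of _ e'] conjI ballI)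
    show "open N''" by (rule N'')
    show "x \<in> N''" using N'(2) \<open>v x \<noteq> 0\<close> by (simp add: N''_def)
    show "N'' \<subseteq> N" using sub N'(3) by blast
    show "smooth_on_open N'' (e' i)" if "i \<in> insert k T" for i
    proof (cases "i = k")
      case True
      have "smooth_on_open N'' (\<lambda>y. v y /\<^sub>R norm (v y))"
        by (rule smooth_on_open_normalize[OF smooth_on_open_subset[OF v_smooth N'' sub]]) (auto simp: N''_def)
      then show ?thesis by (simp add: e'_def True)
    next
      case False
      then show ?thesis using that smooth_on_open_subset[OF sm N'' sub] by (simp add: e'_def)
    qed
    show "e' i = b i" if "i \<in> S0" for i using that eb T(2) by (auto simp: e'_def T_def)
    show "e' i y \<in> span ((\<lambda>i. b i y) ` insert k T)" if "y \<in> N''" "i \<in> insert k T" for y i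
    proof (cases "i = k")
      case True
      then show ?thesis using v_span sub that by (auto simp: e'_def intro: span_scale)
    next
      case False
      then have "e i y \<in> span ((\<lambda>i. b i y) ` T)" using sp sub that by auto
      then have "e i y \<in> span ((\<lambda>i. b i y) ` insert k T)" by (rule subsetD[OF span_mono, rotated]) auto
      then show ?thesis using False by (simp add: e'_def)
    qed
    show "e' i y \<bullet> e' j y = (if i = j then 1 else 0)"
      if "y \<in> N''" "i \<in> insert k T" "j \<in> insert k T" for y i j
    proof -
      have y: "y \<in> N'" "v y \<noteq> 0" using that by (auto simp: N''_def)
      have "norm (v y /\<^sub>R norm (v y)) = 1" using y(2) by simp
      then have vv: "(v y /\<^sub>R norm (v y)) \<bullet> (v y /\<^sub>R norm (v y)) = 1" by (simp only: norm_eq_1)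
      have ve: "(v y /\<^sub>R norm (v y)) \<bullet> e l y = 0" "e l y \<bullet> (v y /\<^sub>R norm (v y)) = 0" if "l \<in> T" for l
        using v_orth[OF y(1) that] by (simp_all add: inner_commute)
      show ?thesis
        using that(2,3) on[OF y(1), of i j] ve vv T(2) by (cases "i = k"; cases "j = k") (simp_all add: e'_def)
    qed
  qed
qed

section \<open>Determinants, transition matrices and orientations\<close>

definition block_id :: "real ^ 'n ^ 'n \<Rightarrow> real ^ ('n::finite + 'm::finite) ^ ('n + 'm)" where
  "block_id K = (\<chi> r c. case r of
     Inl l \<Rightarrow> (case c of Inl j \<Rightarrow> K $ l $ j | Inr k \<Rightarrow> 0)
   | Inr a \<Rightarrow> (case c of Inl j \<Rightarrow> 0 | Inr k \<Rightarrow> if a = k then 1 else 0))"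

lemma sum_UNIV_Plus:
  fixes f :: "'n::finite + 'm::finite \<Rightarrow> 'a::comm_monoid_add"
  shows "sum f UNIV = (\<Sum>j\<in>UNIV. f (Inl j)) + (\<Sum>k\<in>UNIV. f (Inr k))"
  by (simp add: UNIV_Plus_UNIV[symmetric] sum.Plus comp_def del: UNIV_Plus_UNIV)

lemma prod_UNIV_Plus:
  fixes f :: "'n::finite + 'm::finite \<Rightarrow> 'a::comm_monoid_mult"
  shows "prod f UNIV = (\<Prod>j\<in>UNIV. f (Inl j)) * (\<Prod>k\<in>UNIV. f (Inr k))"
  by (simp add: UNIV_Plus_UNIV[symmetric] prod.Plus comp_def del: UNIV_Plus_UNIV)

text \<open>\<open>block_id K\<close> is block diagonal with blocks K and 1, and it is
  multiplicative in K. So it suffices to treat matrices with a zero row, diagonal matrices,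
  transpositions and shears.\<close>

lemma det_block_id: "det (block_id K :: real ^ ('n::finite + 'm::finite) ^ ('n + 'm)) = det K"
proof (rule induct_matrix_elementary[of "\<lambda>K. det (block_id K :: real ^ ('n + 'm) ^ ('n + 'm)) = det K"])
  fix A B :: "real ^ 'n ^ 'n"
  assume mult: "det (block_id A :: real ^ ('n + 'm) ^ ('n + 'm)) = det A"
    "det (block_id B :: real ^ ('n + 'm) ^ ('n + 'm)) = det B"
  have "block_id (A ** B) = (block_id A ** block_id B :: real ^ ('n + 'm) ^ ('n + 'm))"
    by (simp add: vec_eq_iff block_id_def matrix_matrix_mult_def sum_UNIV_Plus
        if_distrib[of "\<lambda>x. x * _"] cong: if_cong split: sum.split)
  then show "det (block_id (A ** B) :: real ^ ('n + 'm) ^ ('n + 'm)) = det (A ** B)"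
    using mult by (simp add: det_mul)
next
  fix A :: "real ^ 'n ^ 'n" and i assume zero_row: "row i A = 0"
  then have "row (Inl i) (block_id A :: real ^ ('n + 'm) ^ ('n + 'm)) = 0"
    by (auto simp: row_def vec_eq_iff block_id_def split: sum.split)
  then show "det (block_id A :: real ^ ('n + 'm) ^ ('n + 'm)) = det A"
    using zero_row det_zero_row(2) by metis
next
  fix A :: "real ^ 'n ^ 'n" assume diagonal: "\<And>i j. i \<noteq> j \<Longrightarrow> A $ i $ j = 0"
  have "det (block_id A :: real ^ ('n + 'm) ^ ('n + 'm)) =
      (\<Prod>i\<in>UNIV. (block_id A :: real ^ ('n + 'm) ^ ('n + 'm)) $ i $ i)"
    by (rule det_diagonal) (use diagonal in \<open>auto simp: block_id_def split: sum.split\<close>)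
  then show "det (block_id A :: real ^ ('n + 'm) ^ ('n + 'm)) = det A"
    using det_diagonal[of A] diagonal by (simp add: prod_UNIV_Plus block_id_def)
next
  fix m n :: 'n assume swap1: "m \<noteq> n"
  have "block_id (\<chi> i j. mat 1 $ i $ Transposition.transpose m n j) =
     (\<chi> i j. (mat 1 :: real ^ ('n + 'm) ^ ('n + 'm)) $ i $ Transposition.transpose (Inl m) (Inl n) j)"
    by (auto simp: vec_eq_iff block_id_def mat_def Transposition.transpose_def split: sum.split)
  then show "det (block_id (\<chi> i j. mat 1 $ i $ Transposition.transpose m n j) :: real ^ ('n + 'm) ^ ('n + 'm)) =
      det (\<chi> i j. mat 1 $ i $ Transposition.transpose m n j :: real ^ 'n ^ 'n)" using swap1
    by (simp add: det_permute_columns[of "Transposition.transpose m n"]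
        det_permute_columns[of "Transposition.transpose (Inl m) (Inl n)"] permutes_swap_id sign_swap_id)
next
  fix m n :: 'n and c :: real assume idplus: "m \<noteq> n"
  let ?A = "\<chi> i j. if i = m \<and> j = n then c else of_bool (i = j) :: real ^ 'n ^ 'n"
  have 1: "?A = (\<chi> k. if k = m then row m (mat 1) + c *s row n (mat 1) else row k (mat 1))"
    using idplus by (auto simp: vec_eq_iff row_def mat_def)
  have 2: "block_id ?A = (\<chi> k. if k = Inl m then row (Inl m) (mat 1 :: real ^ ('n + 'm) ^ ('n + 'm))
      + c *s row (Inl n) (mat 1) else row k (mat 1))"
    using idplus by (auto simp: vec_eq_iff row_def mat_def block_id_def split: sum.split)
  show "det (block_id ?A :: real ^ ('n + 'm) ^ ('n + 'm)) = det ?A"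
    using det_row_operation[OF idplus, of "mat 1 :: real ^ 'n ^ 'n" c]
      det_row_operation[of "Inl m" "Inl n" "mat 1 :: real ^ ('n + 'm) ^ ('n + 'm)" c] idplus
    unfolding 2 unfolding 1 by simp
qed

text \<open>The condition in \<open>normal_orientation\<close> ranges over all positive tangent
  bases. By this factorization it has to be checked for a single one, since the others arise from it
  by some K of positive determinant.\<close>

lemma det_case_sum_combination:
  fixes e :: "'n::finite \<Rightarrow> real ^ ('n + 'm::finite)" and \<epsilon> :: "'m \<Rightarrow> real ^ ('n + 'm)" and K :: "real ^ 'n ^ 'n"
  shows "det (\<chi> i k. case_sum (\<lambda>j. \<Sum>l\<in>UNIV. K $ l $ j *\<^sub>R e l) \<epsilon> k $ i) =
     det K * det (\<chi> i k. case_sum e \<epsilon> k $ i)"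
proof -
  have "(\<chi> i k. case_sum (\<lambda>j. \<Sum>l\<in>UNIV. K $ l $ j *\<^sub>R e l) \<epsilon> k $ i) =
      (\<chi> i k. case_sum e \<epsilon> k $ i) ** block_id K"
    by (auto simp: vec_eq_iff matrix_matrix_mult_def sum_UNIV_Plus block_id_def mult.commute
        if_distrib[of "\<lambda>x. x * _"] if_distrib[of "\<lambda>x. _ * x"] cong: if_cong split: sum.split)
  then show ?thesis by (simp add: det_mul det_block_id)
qed

lemma orthonormal_expansion:
  fixes e :: "'k::finite \<Rightarrow> 'a::euclidean_space"
  assumes on: "\<And>i j. e i \<bullet> e j = (if i = j then 1 else 0)" and v: "v \<in> span (range e)"
  shows "v = (\<Sum>j\<in>UNIV. (v \<bullet> e j) *\<^sub>R e j)"
proof -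
  show ?thesis
    using v
  proof (rule span_induct)
    show "subspace {v. v = (\<Sum>j\<in>UNIV. (v \<bullet> e j) *\<^sub>R e j)}"
    proof (rule subspaceI; clarify)
      fix v w assume v: "v = (\<Sum>j\<in>UNIV. (v \<bullet> e j) *\<^sub>R e j)" and w: "w = (\<Sum>j\<in>UNIV. (w \<bullet> e j) *\<^sub>R e j)"
      have "v + w = (\<Sum>j\<in>UNIV. (v \<bullet> e j) *\<^sub>R e j) + (\<Sum>j\<in>UNIV. (w \<bullet> e j) *\<^sub>R e j)"
        using v w by metis
      also have "\<dots> = (\<Sum>j\<in>UNIV. ((v + w) \<bullet> e j) *\<^sub>R e j)"
        by (simp add: inner_add_left scaleR_add_left sum.distrib)
      finally show "v + w = (\<Sum>j\<in>UNIV. ((v + w) \<bullet> e j) *\<^sub>R e j)" .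
    next
      fix c v assume "v = (\<Sum>j\<in>UNIV. (v \<bullet> e j) *\<^sub>R e j)"
      then have "c *\<^sub>R v = c *\<^sub>R (\<Sum>j\<in>UNIV. (v \<bullet> e j) *\<^sub>R e j)" by metis
      also have "\<dots> = (\<Sum>j\<in>UNIV. (c *\<^sub>R v \<bullet> e j) *\<^sub>R e j)" by (simp add: scaleR_sum_right)
      finally show "c *\<^sub>R v = (\<Sum>j\<in>UNIV. (c *\<^sub>R v \<bullet> e j) *\<^sub>R e j)" .
    qed simp
    show "w = (\<Sum>j\<in>UNIV. (w \<bullet> e j) *\<^sub>R e j)" if "w \<in> range e" for w
      using that by (auto simp: on if_distrib[of "\<lambda>x. x *\<^sub>R _"] cong: if_cong)
  qed
qed

lemma orthonormal_family:
  fixes e :: "'k::finite \<Rightarrow> 'a::euclidean_space"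
  assumes on: "\<And>i j. e i \<bullet> e j = (if i = j then 1 else 0)"
  shows "inj e" "independent (range e)"
proof -
  show "inj e"
  proof (rule injI)
    fix i j assume "e i = e j"
    then show "i = j" using on[of i i] on[of i j] by (auto split: if_splits)
  qed
  have "pairwise orthogonal (range e)"
    by (auto simp: pairwise_def orthogonal_def on)
  moreover have "0 \<notin> range e"
  proof
    assume "0 \<in> range e"
    then obtain i where "e i = 0" by (metis imageE)
    then show False using on[of i i] by simp
  qed
  ultimately show "independent (range e)" by (rule pairwise_orthogonal_independent)
qed

text \<open>Orthonormal vectors are independent, and their number is the dimension of V.\<close>

lemma orthonormal_ordered_basis:
  fixes e b :: "'k::finite \<Rightarrow> 'a::euclidean_space"
  assumes "\<And>i j. e i \<bullet> e j = (if i = j then 1 else 0)" "ordered_basis V b" "\<And>i. e i \<in> V"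
  shows "ordered_basis V e"
proof -
  have e: "inj e" "independent (range e)" using orthonormal_family[of e] assms(1) by auto
  have b: "inj b" "independent (range b)" "span (range b) = V" using assms(2) by (auto simp: ordered_basis_def)
  have "dim V = card (range b)" using b(2,3) dim_span_eq_card_independent by metis
  also have "\<dots> = card (range e)" using b(1) e(1) by (simp add: card_image)
  finally have "dim V = card (range e)" .
  moreover have "range e \<subseteq> V" using assms(3) by auto
  ultimately have "V \<subseteq> span (range e)" using e(2) by (intro card_ge_dim_independent) auto
  moreover have "span (range e) \<subseteq> V" using \<open>range e \<subseteq> V\<close> b(3) by (metis span_mono span_span)
  ultimately show ?thesis using e by (auto simp: ordered_basis_def)
qed

text \<open>\<open>D\<close> expresses b in terms of e, while membership in
  \<open>orientation_class b\<close> asks for the inverse matrix; the two determinants have the same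
  sign. The entries of \<open>D\<close> are inner products, so they vary continuously with the base
  point. A kernel vector of \<open>D\<close> would be a linear relation between the vectors b
  i.\<close>

lemma orthonormal_transition_det:
  fixes e b :: "'k::finite \<Rightarrow> 'a::euclidean_space"
  assumes on: "\<And>i j. e i \<bullet> e j = (if i = j then 1 else 0)" and b: "ordered_basis V b" and e: "ordered_basis V e"
  defines "D \<equiv> (\<chi> j i. b i \<bullet> e j) :: real ^ 'k ^ 'k"
  shows "det D \<noteq> 0" "0 < det D \<Longrightarrow> e \<in> orientation_class b" "b i = (\<Sum>l\<in>UNIV. D $ l $ i *\<^sub>R e l)"
proof -
  have bD: "b i = (\<Sum>l\<in>UNIV. D $ l $ i *\<^sub>R e l)" for i
  proof -
    have "b i \<in> span (range e)" using b e span_base[of "b i" "range b"] by (auto simp: ordered_basis_def)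
    then show ?thesis using orthonormal_expansion[OF on] by (simp add: D_def)
  qed
  then show "b i = (\<Sum>l\<in>UNIV. D $ l $ i *\<^sub>R e l)" .
  have "x = 0" if "D *v x = 0" for x
  proof -
    have "(\<Sum>i\<in>UNIV. x $ i *\<^sub>R b i) = (\<Sum>i\<in>UNIV. \<Sum>l\<in>UNIV. (D $ l $ i * x $ i) *\<^sub>R e l)"
      by (subst bD) (simp add: scaleR_sum_right mult.commute)
    also have "\<dots> = (\<Sum>l\<in>UNIV. (D *v x) $ l *\<^sub>R e l)"
      by (subst sum.swap) (simp add: matrix_vector_mult_def scaleR_sum_left)
    also have "\<dots> = 0" using that by simp
    finally have "(\<Sum>v\<in>range b. x $ (inv b v) *\<^sub>R v) = 0"
      using b by (subst sum.reindex) (auto simp: ordered_basis_def)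
    moreover have "independent (range b)" using b by (simp add: ordered_basis_def)
    ultimately have "x $ (inv b v) = 0" if "v \<in> range b" for v
      using independentD[of "range b" "range b" "\<lambda>v. x $ (inv b v)" v] that by simp
    then have "x $ i = 0" for i using b by (metis inv_f_f ordered_basis_def rangeI)
    then show "x = 0" by (simp add: vec_eq_iff)
  qed
  then obtain C where C: "C ** D = mat 1" using matrix_left_invertible_ker by blast
  then have DC: "D ** C = mat 1" using matrix_left_right_inverse by blast
  have detCD: "det C * det D = 1" using C det_mul[of C D] by simp
  then show "det D \<noteq> 0" by auto
  assume "0 < det D"
  then have "0 < det C" using detCD by (metis zero_less_mult_pos2 zero_less_one)
  moreover have "e j = (\<Sum>i\<in>UNIV. C $ i $ j *\<^sub>R b i)" for j
  proof -
    have "(\<Sum>i\<in>UNIV. C $ i $ j *\<^sub>R b i) = (\<Sum>i\<in>UNIV. \<Sum>l\<in>UNIV. (D $ l $ i * C $ i $ j) *\<^sub>R e l)"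
      by (subst bD) (simp add: scaleR_sum_right mult.commute)
    also have "\<dots> = (\<Sum>l\<in>UNIV. (D ** C) $ l $ j *\<^sub>R e l)"
      by (subst sum.swap) (simp add: matrix_matrix_mult_def scaleR_sum_left)
    also have "\<dots> = e j" by (simp add: DC mat_def if_distrib[of "\<lambda>x. x *\<^sub>R _"] cong: if_cong)
    finally show ?thesis by simp
  qed
  ultimately show "e \<in> orientation_class b" unfolding orientation_class_def by blast
qed

lemma det_rows_scale: "det (\<chi> i k. t i * A $ i $ k) = prod t UNIV * det (A :: real ^ 'k::finite ^ 'k)"
proof -
  have "(\<chi> i k. t i * A $ i $ k) = (\<chi> i. t i *s A $ i)" by (simp add: vec_eq_iff)
  then show ?thesis using det_rows_mul[of t "\<lambda>i. A $ i"] by (simp add: vec_lambda_eta)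
qed

lemma det_columns_scale: "det (\<chi> i k. t k * A $ i $ k) = prod t UNIV * det (A :: real ^ 'k::finite ^ 'k)"
proof -
  have "(\<chi> i k. t k * A $ i $ k) = transpose (\<chi> i k. t i * transpose A $ i $ k)"
    by (simp add: transpose_def vec_eq_iff)
  then show ?thesis by (simp add: det_transpose det_rows_scale)
qed

lemma continuous_on_det_entries:
  assumes "\<And>i j. continuous_on S (\<lambda>y. A y $ i $ j)"
  shows "continuous_on S (\<lambda>y. det (A y :: real ^ 'k::finite ^ 'k))"
  unfolding det_def by (intro continuous_intros assms)

lemma orientation_class_transfer:
  fixes a b e :: "'k::finite \<Rightarrow> 'a::real_vector"
  assumes "e \<in> orientation_class b" "a \<in> orientation_class b"
  obtains K :: "real ^ 'k ^ 'k" where "0 < det K" "a = (\<lambda>j. \<Sum>l\<in>UNIV. K $ l $ j *\<^sub>R e l)"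
proof -
  obtain C :: "real ^ 'k ^ 'k" where C: "0 < det C" "\<And>j. e j = (\<Sum>i\<in>UNIV. C $ i $ j *\<^sub>R b i)"
    using assms(1) unfolding orientation_class_def by blast
  obtain A :: "real ^ 'k ^ 'k" where A: "0 < det A" "\<And>j. a j = (\<Sum>i\<in>UNIV. A $ i $ j *\<^sub>R b i)"
    using assms(2) unfolding orientation_class_def by blast
  have "invertible C" using C(1) by (simp add: invertible_det_nz)
  then obtain D where D: "C ** D = mat 1" by (auto simp: invertible_def)
  have mult: "(\<Sum>j\<in>UNIV. X $ j $ k *\<^sub>R e j) = (\<Sum>i\<in>UNIV. (C ** X) $ i $ k *\<^sub>R b i)" for X :: "real ^ 'k ^ 'k" and k
  proof -
    have "(\<Sum>j\<in>UNIV. X $ j $ k *\<^sub>R e j) = (\<Sum>j\<in>UNIV. \<Sum>i\<in>UNIV. (C $ i $ j * X $ j $ k) *\<^sub>R b i)"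
      unfolding C(2) by (simp add: scaleR_sum_right mult.commute)
    also have "\<dots> = (\<Sum>i\<in>UNIV. (C ** X) $ i $ k *\<^sub>R b i)"
      by (subst sum.swap) (simp add: matrix_matrix_mult_def scaleR_sum_left)
    finally show ?thesis .
  qed
  have CDA: "C ** (D ** A) = A" by (simp add: matrix_mul_assoc D)
  show thesis
  proof (rule that)
    have "det C * det (D ** A) = det A" using det_mul[of C "D ** A"] CDA by simp
    then show "0 < det (D ** A)" using A(1) C(1) by (metis zero_less_mult_pos)
    show "a = (\<lambda>j. \<Sum>l\<in>UNIV. (D ** A) $ l $ j *\<^sub>R e l)"
      by (simp add: fun_eq_iff A(2) mult CDA)
  qed
qed

lemma subspace_orthonormal_basis:
  fixes V :: "'a::euclidean_space set"
  assumes "subspace V" "dim V = CARD('k::finite)"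
  obtains u :: "'k::finite \<Rightarrow> 'a" where "\<And>i j. u i \<bullet> u j = (if i = j then 1 else 0)" "ordered_basis V u"
proof -
  obtain B where B: "B \<subseteq> V" "pairwise orthogonal B" "\<And>x. x \<in> B \<Longrightarrow> norm x = 1" "independent B"
    "card B = dim V" "span B = V"
    using orthonormal_basis_subspace[OF assms(1)] by metis
  have "finite B" using B(4) by (rule independent_imp_finite)
  then obtain u :: "'k \<Rightarrow> 'a" where u: "bij_betw u UNIV B"
    using finite_same_card_bij[of "UNIV :: 'k set" B] B(5) assms(2) by auto
  then have uB: "range u = B" "inj u" by (auto simp: bij_betw_def)
  show thesis
  proof (rule that)
    show "u i \<bullet> u j = (if i = j then 1 else 0)" for i j
    proof (cases "i = j")
      case True
      have "norm (u i) = 1" using B(3) uB by auto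
      then show ?thesis using True by (simp add: norm_eq_1)
    next
      case False
      then have "u i \<noteq> u j" using uB(2) by (auto simp: inj_def)
      then show ?thesis using B(2) uB(1) False by (auto simp: pairwise_def orthogonal_def)
    qed
    show "ordered_basis V u" using uB B by (simp add: ordered_basis_def)
  qed
qed

section \<open>Positively oriented adapted frames\<close>

lemma orientation_onE:
  fixes M :: "(('n::finite, 'm::finite) amb) set"
  assumes "orientation_on M ori" "x \<in> M"
  obtains U b where "openin (top_of_set M) U" "x \<in> U" "\<And>j. continuous_on U (\<lambda>y. b y j)"
    "\<And>y. y \<in> U \<Longrightarrow> ordered_basis (tangent_space M y) (b y)" "\<And>y. y \<in> U \<Longrightarrow> ori y = orientation_class (b y)"
proof -
  from bspec[OF assms(1)[unfolded orientation_on_def] assms(2)]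
  obtain U b where U: "openin (top_of_set M) U" "x \<in> U" "\<forall>j. continuous_on U (\<lambda>y. b y j)"
    and b: "\<forall>y\<in>U. ordered_basis (tangent_space M y) (b y) \<and> ori y = orientation_class (b y)"
    by (elim exE conjE)
  show thesis
    by (rule that[of U b, OF U(1,2) spec[OF U(3)]]) (use b in blast)+
qed

text \<open>\<open>tangent_space\<close> is defined as a set of velocities; that it is a linear
  space of dimension n is read off from the bases supplied by the orientation.\<close>

lemma tangent_space_oriented:
  fixes M :: "(('n::finite, 'm::finite) amb) set"
  assumes "orientation_on M ori" "x \<in> M"
  shows "subspace (tangent_space M x)" "dim (tangent_space M x) = CARD('n)"
    "subspace (normal_space M x)" "dim (normal_space M x) = CARD('m)"
proof -
  obtain U and b :: "('n, 'm) amb \<Rightarrow> 'n \<Rightarrow> ('n, 'm) amb" where "x \<in> U" "\<And>y. y \<in> U \<Longrightarrow> ordered_basis (tangent_space M y) (b y)"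
    by (rule orientation_onE[OF assms]) (rule that)
  then have b: "ordered_basis (tangent_space M x) (b x)" by blast
  then show T: "subspace (tangent_space M x)" unfolding ordered_basis_def by (metis subspace_span)
  show dimT: "dim (tangent_space M x) = CARD('n)"
    using b dim_span_eq_card_independent[of "range (b x)"] by (simp add: ordered_basis_def card_image)
  show "subspace (normal_space M x)" unfolding normal_space_def by (rule subspace_orthogonal_comp)
  have "dim {y \<in> UNIV. \<forall>x'\<in>tangent_space M x. orthogonal x' y} + dim (tangent_space M x) =
      dim (UNIV :: ('n, 'm) amb set)"
    by (rule dim_subspace_orthogonal_to_vectors[OF T subspace_UNIV subset_UNIV])
  then show "dim (normal_space M x) = CARD('m)"
    by (simp add: normal_space_def orthogonal_comp_def dimT)
qed

text \<open>Gram-Schmidt turns the coordinate fields into an orthonormal frame of unknown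
  orientation. Reversing one vector if necessary makes it positive at x, and continuity of its
  transition determinant against the continuous positive basis \<open>b\<close> makes it positive
  nearby.\<close>

lemma smooth_tangent_frame:
  fixes M :: "(('n::finite, 'm::finite) amb) set"
  assumes "smooth_submanifold M" "orientation_on M ori" "x \<in> M"
  obtains N and e :: "'n \<Rightarrow> ('n, 'm) amb \<Rightarrow> ('n, 'm) amb" where
    "open N" "x \<in> N" "\<And>j. smooth_on_open N (e j)"
    "\<And>y i j. y \<in> N \<Longrightarrow> e i y \<bullet> e j y = (if i = j then 1 else 0)"
    "\<And>y j. y \<in> M \<Longrightarrow> y \<in> N \<Longrightarrow> e j y \<in> tangent_space M y"
    "\<And>y. y \<in> M \<Longrightarrow> y \<in> N \<Longrightarrow> (\<lambda>j. e j y) \<in> ori y"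
proof -
  obtain N0 b0 where N0: "x \<in> N0" and b0: "\<And>j::'n. smooth_on_open N0 (b0 j)"
    "\<And>y j. y \<in> M \<Longrightarrow> y \<in> N0 \<Longrightarrow> b0 j y \<in> tangent_space M y"
    "inj (\<lambda>j. b0 j x)" "independent (range (\<lambda>j. b0 j x))"
    by (rule smooth_local_tangent_basis[OF assms(1,3)]) (rule that)
  have "open N0" using b0(1) by (auto simp: smooth_on_open_def)
  have "\<exists>N' e. open N' \<and> x \<in> N' \<and> N' \<subseteq> N0 \<and> (\<forall>i\<in>{} \<union> UNIV. smooth_on_open N' (e i)) \<and> (\<forall>i\<in>{}. e i = b0 i) \<and>
     (\<forall>y\<in>N'. \<forall>i\<in>{} \<union> UNIV. e i y \<in> span ((\<lambda>i. b0 i y) ` ({} \<union> UNIV)) \<and>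
        (\<forall>j\<in>{} \<union> UNIV. e i y \<bullet> e j y = (if i = j then 1 else 0)))"
    by (rule smooth_gram_schmidt) (use N0 b0 \<open>open N0\<close> in auto)
  then obtain N1 and e :: "'n \<Rightarrow> ('n, 'm) amb \<Rightarrow> ('n, 'm) amb" where
    N1: "open N1" "x \<in> N1" "N1 \<subseteq> N0" and sm': "\<forall>i\<in>{} \<union> UNIV. smooth_on_open N1 (e i)"
    and "\<forall>i\<in>{}. e i = b0 i"
    and spon: "\<forall>y\<in>N1. \<forall>i\<in>{} \<union> UNIV. e i y \<in> span ((\<lambda>i. b0 i y) ` ({} \<union> UNIV)) \<and>
        (\<forall>j\<in>{} \<union> UNIV. e i y \<bullet> e j y = (if i = j then 1 else 0))"
    by (elim exE conjE)
  have sm: "smooth_on_open N1 (e i)" for i using sm' by simp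
  have sp: "e i y \<in> span (range (\<lambda>i. b0 i y))" if "y \<in> N1" for i y using spon that by simp
  have on: "e i y \<bullet> e j y = (if i = j then 1 else 0)" if "y \<in> N1" for i j y using spon that by simp
  obtain U1 b where U1: "openin (top_of_set M) U1" "x \<in> U1" and b: "\<And>j. continuous_on U1 (\<lambda>y. b y j)"
    "\<And>y. y \<in> U1 \<Longrightarrow> ordered_basis (tangent_space M y) (b y)" "\<And>y. y \<in> U1 \<Longrightarrow> ori y = orientation_class (b y)"
    by (rule orientation_onE[OF assms(2,3)]) (rule that)
  define S where "S = U1 \<inter> N1"
  have SM: "y \<in> M" if "y \<in> S" for y using that U1(1) openin_imp_subset by (auto simp: S_def)
  have e_tan: "e i y \<in> tangent_space M y" if "y \<in> M" "y \<in> N1" for i y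
  proof -
    have "range (\<lambda>i. b0 i y) \<subseteq> tangent_space M y" using b0(2) that N1(3) by auto
    then have "span (range (\<lambda>i. b0 i y)) \<subseteq> tangent_space M y"
      using span_minimal tangent_space_oriented(1)[OF assms(2) that(1)] by blast
    then show ?thesis using sp[OF that(2)] by blast
  qed
  define D where "D y = (\<chi> j i. b y i \<bullet> e j y)" for y
  define \<sigma> where "\<sigma> = sgn (det (D x))"
  \<comment> \<open>\<open>undefined\<close> is merely some fixed index, the one whose vector
    receives the sign.\<close>
  define s where "s = (\<lambda>j::'n. if j = undefined then \<sigma> else 1)"
  define e' where "e' j y = s j *\<^sub>R e j y" for j y
  have ob: "ordered_basis (tangent_space M y) (\<lambda>i. e i y)" if "y \<in> S" for y
    by (rule orthonormal_ordered_basis[of "\<lambda>i. e i y" _ "b y"]) (use that on b(2) e_tan SM in \<open>auto simp: S_def\<close>)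
  have xS: "x \<in> S" using U1 N1 by (simp add: S_def)
  have "det (D x) \<noteq> 0"
    unfolding D_def using orthonormal_transition_det(1)[of "\<lambda>i. e i x" _ "b x"] on ob[OF xS] b(2)[OF U1(2)] N1(2) by metis
  then have \<sigma>: "\<sigma> = 1 \<or> \<sigma> = -1" "0 < \<sigma> * det (D x)" by (auto simp: \<sigma>_def sgn_if)
  have s: "s j * s j = 1" for j using \<sigma>(1) by (auto simp: s_def)
  have prod_s: "prod s UNIV = \<sigma>" by (simp add: s_def)
  have "continuous_on S (\<lambda>y. D y $ j $ i)" for i j
    using continuous_on_subset[OF b(1)] continuous_on_subset[OF smooth_on_open_imp_continuous_on[OF sm]]
    by (auto simp: D_def S_def intro!: continuous_on_inner)
  then have "continuous_on S (\<lambda>y. det (D y))" by (rule continuous_on_det_entries)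
  then have "continuous_on S (\<lambda>y. \<sigma> * det (D y))" by (intro continuous_intros)
  then have "openin (top_of_set S) (S \<inter> (\<lambda>y. \<sigma> * det (D y)) -` {0<..})"
    by (rule continuous_openin_preimage_gen) simp
  moreover have "openin (top_of_set M) S"
    unfolding S_def using U1(1) N1(1) by (rule openin_Int_open)
  ultimately have "openin (top_of_set M) (S \<inter> (\<lambda>y. \<sigma> * det (D y)) -` {0<..})" by (rule openin_trans)
  then obtain N2 where N2: "open N2" "S \<inter> (\<lambda>y. \<sigma> * det (D y)) -` {0<..} = M \<inter> N2"
    by (auto simp: openin_open)
  define N where "N = N1 \<inter> N2"
  show thesis
  proof (rule that[of N e'])
    show "open N" using N1(1) N2(1) by (auto simp: N_def)
    have "x \<in> M \<inter> N2" unfolding N2(2)[symmetric] using xS \<sigma>(2) by simp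
    then show "x \<in> N" using N1 by (simp add: N_def)
    show "smooth_on_open N (e' j)" for j
      unfolding e'_def
      by (rule smooth_on_open_scaleR_const, rule smooth_on_open_subset[OF sm \<open>open N\<close>]) (simp add: N_def)
    show on': "e' i y \<bullet> e' j y = (if i = j then 1 else 0)" if "y \<in> N" for y i j
      using on[of y i j] s[of j] that by (simp add: e'_def N_def)
    show tan': "e' j y \<in> tangent_space M y" if "y \<in> M" "y \<in> N" for y j
      using e_tan tangent_space_oriented(1)[OF assms(2) that(1)] that by (auto simp: e'_def N_def intro: subspace_scale)
    show "(\<lambda>j. e' j y) \<in> ori y" if "y \<in> M" "y \<in> N" for y
    proof -
      have y: "y \<in> S" "0 < \<sigma> * det (D y)" using that N2(2) by (auto simp: N_def)
      then have by': "ordered_basis (tangent_space M y) (b y)" using b(2) by (simp add: S_def)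
      have ob': "ordered_basis (tangent_space M y) (\<lambda>i. e' i y)"
        by (rule orthonormal_ordered_basis[of "\<lambda>i. e' i y" _ "b y"]) (use that on' by' tan' in auto)
      have "(\<chi> j i. b y i \<bullet> e' j y) = (\<chi> j i. s j * D y $ j $ i)" by (simp add: vec_eq_iff D_def e'_def)
      then have "det (\<chi> j i. b y i \<bullet> e' j y) = \<sigma> * det (D y)"
        by (simp add: det_rows_scale prod_s)
      with y(2) have "0 < det (\<chi> j i. b y i \<bullet> e' j y)" by simp
      from orthonormal_transition_det(2)[OF _ by' ob' this] have "(\<lambda>i. e' i y) \<in> orientation_class (b y)"
        using on'[OF that(2)] by simp
      then show ?thesis using b(3) y(1) by (simp add: S_def)
    qed
  qed
qed

text \<open>A positive tangent frame and a normal basis at x, extended by constants, are together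
  orthonormal at x. Gram-Schmidt keeps the tangent part and makes the other fields orthogonal to it,
  hence normal along M. The orientation is again corrected by the sign of one vector.\<close>

lemma adapted_frames_exist:
  fixes M :: "(('n::finite, 'm::finite) amb) set"
  assumes "smooth_submanifold M" "orientation_on M ori" "x \<in> M"
  obtains U e \<epsilon> where "adapted_frames M ori U e \<epsilon>" "x \<in> U"
proof -
  obtain N e where N: "open N" "x \<in> N" and sm: "\<And>j. smooth_on_open N (e j)"
    and on: "\<And>y i j. y \<in> N \<Longrightarrow> e i y \<bullet> e j y = (if i = j then 1 else 0)"
    and tan: "\<And>y j. y \<in> M \<Longrightarrow> y \<in> N \<Longrightarrow> e j y \<in> tangent_space M y"
    and pos: "\<And>y. y \<in> M \<Longrightarrow> y \<in> N \<Longrightarrow> (\<lambda>j. e j y) \<in> ori y"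
    by (rule smooth_tangent_frame[OF assms]) (rule that)
  obtain u :: "'m \<Rightarrow> ('n, 'm) amb" where u: "\<And>i j. u i \<bullet> u j = (if i = j then 1 else 0)" "ordered_basis (normal_space M x) u"
    by (rule subspace_orthonormal_basis[OF tangent_space_oriented(3,4)[OF assms(2,3)]]) (rule that)
  have u_normal: "u k \<in> normal_space M x" for k
    using u(2) span_base[of "u k" "range u"] by (auto simp: ordered_basis_def)
  define B where "B = (\<lambda>k. case k of Inl j \<Rightarrow> e j | Inr k \<Rightarrow> (\<lambda>_. u k))"
  have "e j x \<bullet> u k = 0" for j k
    using tan[OF assms(3) N(2)] u_normal by (auto simp: normal_space_def orthogonal_comp_def orthogonal_def)
  then have "B i x \<bullet> B j x = (if i = j then 1 else 0)" for i j
    using on[OF N(2)] u(1) by (auto simp: B_def inner_commute[of "u _" "e _ x"] split: sum.splits)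
  then have Bx: "inj (\<lambda>i. B i x)" "independent (range (\<lambda>i. B i x))"
    by (rule orthonormal_family)+
  have UN: "range Inl \<union> range Inr = (UNIV :: ('n + 'm) set)" using UNIV_sum by blast
  have "\<exists>N' f. open N' \<and> x \<in> N' \<and> N' \<subseteq> N \<and> (\<forall>i\<in>range Inl \<union> range Inr. smooth_on_open N' (f i)) \<and>
     (\<forall>i\<in>range Inl. f i = B i) \<and>
     (\<forall>y\<in>N'. \<forall>i\<in>range Inl \<union> range Inr. f i y \<in> span ((\<lambda>i. B i y) ` (range Inl \<union> range Inr)) \<and>
        (\<forall>j\<in>range Inl \<union> range Inr. f i y \<bullet> f j y = (if i = j then 1 else 0)))"
  proof (rule smooth_gram_schmidt)
    show "smooth_on_open N (B i)" if "i \<in> range Inl \<union> range Inr" for i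
      using sm smooth_on_open_const[OF N(1)] by (auto simp: B_def split: sum.split)
    show "B i y \<bullet> B j y = (if i = j then 1 else 0)" if "y \<in> N" "i \<in> range Inl" "j \<in> range Inl" for y i j
      using that on by (auto simp: B_def split: if_splits)
  qed (use N Bx in \<open>auto simp: UN\<close>)
  then obtain N' f where N': "open N'" "x \<in> N'" "N' \<subseteq> N"
    and smf': "\<forall>i\<in>range Inl \<union> range Inr. smooth_on_open N' (f i)" and fB: "\<forall>i\<in>range Inl. f i = B i"
    and spon: "\<forall>y\<in>N'. \<forall>i\<in>range Inl \<union> range Inr. f i y \<in> span ((\<lambda>i. B i y) ` (range Inl \<union> range Inr)) \<and>
        (\<forall>j\<in>range Inl \<union> range Inr. f i y \<bullet> f j y = (if i = j then 1 else 0))"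
    by (elim exE conjE)
  have smf: "smooth_on_open N' (f i)" for i using smf' UN by auto
  have onf: "f i y \<bullet> f j y = (if i = j then 1 else 0)" if "y \<in> N'" for i j y using spon that UN by auto
  have fe: "f (Inl j) = e j" for j using fB by (simp add: B_def)
  define A where "A y = (\<chi> i k. f k y $ i)" for y
  \<comment> \<open>The matrix of the combined frame is orthogonal, so \<sigma> can be its
    determinant at x itself; by continuity \<sigma> times the determinant stays positive near
    x.\<close>
  have detA: "det (A y) = 1 \<or> det (A y) = -1" if "y \<in> N'" for y
  proof (rule det_orthogonal_matrix)
    have "transpose (A y) ** A y = mat 1"
      using onf[OF that] by (simp add: A_def vec_eq_iff matrix_matrix_mult_def transpose_def mat_def inner_vec_def)
    then show "orthogonal_matrix (A y)" by (simp add: orthogonal_matrix)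
  qed
  define \<sigma> where "\<sigma> = det (A x)"
  have \<sigma>: "\<sigma> = 1 \<or> \<sigma> = -1" using detA[OF N'(2)] by (simp add: \<sigma>_def)
  define s where "s = (\<lambda>k::'m. if k = undefined then \<sigma> else 1)"
  have s: "s j * s j = 1" for j using \<sigma> by (auto simp: s_def)
  define \<epsilon> where "\<epsilon> k y = s k *\<^sub>R f (Inr k) y" for k y
  have "continuous_on N' (\<lambda>y. A y $ i $ k)" for i k
    using smooth_on_open_imp_continuous_on[OF smf[of k]] by (auto simp: A_def intro!: continuous_intros)
  then have "continuous_on N' (\<lambda>y. \<sigma> * det (A y))" by (intro continuous_on_mult continuous_on_const continuous_on_det_entries)
  then have "open (N' \<inter> (\<lambda>y. \<sigma> * det (A y)) -` {0<..})" by (rule continuous_open_preimage) (use N'(1) in auto)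
  moreover define N2 where "N2 = N' \<inter> (\<lambda>y. \<sigma> * det (A y)) -` {0<..}"
  ultimately have N2: "open N2" "x \<in> N2" "N2 \<subseteq> N'" using \<sigma> N'(2) by (auto simp: \<sigma>_def[symmetric])
  have on_\<epsilon>: "\<epsilon> i y \<bullet> \<epsilon> j y = (if i = j then 1 else 0)" if "y \<in> N2" for i j y
    using onf[of y "Inr i" "Inr j"] s[of j] that N2(3) by (auto simp: \<epsilon>_def)
  have \<epsilon>_normal: "\<epsilon> k y \<in> normal_space M y" if yM: "y \<in> M" "y \<in> N2" for k y
    unfolding normal_space_def orthogonal_comp_def orthogonal_def
  proof (clarify)
    fix v assume v: "v \<in> tangent_space M y"
    have yN: "y \<in> N" "y \<in> N'" using that N2(3) N'(3) by auto
    obtain U1 and b :: "('n, 'm) amb \<Rightarrow> 'n \<Rightarrow> ('n, 'm) amb" where "y \<in> U1" "\<And>z. z \<in> U1 \<Longrightarrow> ordered_basis (tangent_space M z) (b z)"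
      by (rule orientation_onE[OF assms(2) yM(1)]) (rule that)
    then have "ordered_basis (tangent_space M y) (\<lambda>j. e j y)"
      by (intro orthonormal_ordered_basis[of "\<lambda>j. e j y" _ "b y"]) (use on yN tan that in auto)
    then have "v \<in> span (range (\<lambda>j. e j y))" using v by (simp add: ordered_basis_def)
    then have expand: "v = (\<Sum>j\<in>UNIV. (v \<bullet> e j y) *\<^sub>R e j y)"
      by (rule orthonormal_expansion[rotated]) (use on yN in auto)
    have orth: "e j y \<bullet> \<epsilon> k y = 0" for j
      using onf[OF yN(2), of "Inl j" "Inr k"] by (simp add: fe \<epsilon>_def)
    have "v \<bullet> \<epsilon> k y = (\<Sum>j\<in>UNIV. (v \<bullet> e j y) *\<^sub>R e j y) \<bullet> \<epsilon> k y"
      by (rule arg_cong[where f = "\<lambda>w. w \<bullet> \<epsilon> k y", OF expand])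
    then show "v \<bullet> \<epsilon> k y = 0" by (simp add: inner_sum_left orth)
  qed
  have \<epsilon>_pos: "(\<lambda>k. \<epsilon> k y) \<in> normal_orientation M ori y" if yM: "y \<in> M" "y \<in> N2" for y
    unfolding normal_orientation_def
  proof (intro CollectI conjI ballI)
    obtain u' :: "'m \<Rightarrow> ('n, 'm) amb" where "ordered_basis (normal_space M y) u'"
      by (rule subspace_orthonormal_basis[OF tangent_space_oriented(3,4)[OF assms(2) yM(1)]]) (rule that)
    then show "ordered_basis (normal_space M y) (\<lambda>k. \<epsilon> k y)"
      by (rule orthonormal_ordered_basis[rotated]) (use that on_\<epsilon> \<epsilon>_normal in auto)
    fix a assume a: "a \<in> ori y"
    have yN: "y \<in> N" "y \<in> N'" using that N2(3) N'(3) by auto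
    obtain U1 and b :: "('n, 'm) amb \<Rightarrow> 'n \<Rightarrow> ('n, 'm) amb" where "y \<in> U1" "\<And>z. z \<in> U1 \<Longrightarrow> ori z = orientation_class (b z)"
      by (rule orientation_onE[OF assms(2) yM(1)]) (rule that)
    then have "ori y = orientation_class (b y)" by blast
    then have "(\<lambda>j. e j y) \<in> orientation_class (b y)" "a \<in> orientation_class (b y)"
      using pos[OF yM(1) yN(1)] a by simp_all
    then obtain K where K: "0 < det K" "a = (\<lambda>j. \<Sum>l\<in>UNIV. K $ l $ j *\<^sub>R e l y)"
      by (rule orientation_class_transfer) (rule that)
    define t where "t = (\<lambda>k::'n + 'm. case k of Inl _ \<Rightarrow> 1 | Inr k \<Rightarrow> s k)"
    have "(\<chi> i k. case_sum (\<lambda>j. e j y) (\<lambda>k. \<epsilon> k y) k $ i) = (\<chi> i k. t k * A y $ i $ k)"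
      by (auto simp: vec_eq_iff t_def A_def \<epsilon>_def fe split: sum.split)
    then have "det (\<chi> i k. case_sum (\<lambda>j. e j y) (\<lambda>k. \<epsilon> k y) k $ i) = \<sigma> * det (A y)"
      by (simp add: det_columns_scale t_def prod_UNIV_Plus s_def)
    moreover have "0 < \<sigma> * det (A y)" using that by (simp add: N2_def)
    ultimately show "0 < det (\<chi> i k. case_sum a (\<lambda>k. \<epsilon> k y) k $ i)"
      unfolding K(2) det_case_sum_combination using K(1) by simp
  qed
  show thesis
  proof (rule that[of "M \<inter> N2" e \<epsilon>])
    show "x \<in> M \<inter> N2" using assms(3) N2(2) by simp
    have sub: "M \<inter> N2 \<subseteq> N" using N2(3) N'(3) by auto
    have sm\<epsilon>: "smooth_map_on (M \<inter> N2) (\<epsilon> k)" for k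
      unfolding \<epsilon>_def
      by (rule smooth_on_open_imp_smooth_map_on[OF smooth_on_open_scaleR_const[OF smf]]) (use N2(3) in auto)
    show "adapted_frames M ori (M \<inter> N2) e \<epsilon>"
      unfolding adapted_frames_def pos_orthonormal_frame_def
      using N2(1) sub sm\<epsilon> smooth_on_open_imp_smooth_map_on[OF sm sub] on tan pos on_\<epsilon> \<epsilon>_normal \<epsilon>_pos
      by (auto simp: openin_open_Int subset_iff)
  qed
qed

section \<open>The Levi-Civita connection of a submanifold\<close>

text \<open>Composing F with a curve of velocity v reduces this to uniqueness of derivatives on the
  real line. It makes \<open>differential\<close> independent, on tangent vectors, of the choice in
  its definition.\<close>

lemma tangent_derivative_unique:
  assumes "(F has_derivative F1) (at x within S)" "(F has_derivative F2) (at x within S)" "v \<in> tangent_space S x"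
  shows "F1 v = F2 v"
proof -
  obtain c where c: "range c \<subseteq> S" "c 0 = x" "(c has_vector_derivative v) (at (0::real))"
    using assms(3) unfolding tangent_space_def by auto
  have "((\<lambda>s. F (c s)) has_vector_derivative F1 v) (at 0)" "((\<lambda>s. F (c s)) has_vector_derivative F2 v) (at 0)"
    using has_derivative_along_curve[OF _ c(3) c(1)] assms(1,2) by (simp_all add: c(2))
  then show ?thesis by (rule vector_derivative_unique_at)
qed

lemma differential_eq:
  assumes "(F has_derivative F') (at x within S)" "v \<in> tangent_space S x"
  shows "differential S F x v = F' v"
proof -
  have "F differentiable (at x within S)" using assms(1) by (auto simp: differentiable_def)
  then have "(F has_derivative frechet_derivative F (at x within S)) (at x within S)"
    by (rule frechet_derivative_works[THEN iffD1])
  then show ?thesis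
    unfolding differential_def using assms by (rule tangent_derivative_unique)
qed

lemma smooth_map_on_differential:
  assumes "smooth_map_on U f" "openin (top_of_set M) U" "x \<in> U"
  shows "(f has_derivative differential M f x) (at x within M)"
  using smooth_map_on_has_derivative[OF assms] unfolding differential_def[abs_def] .

text \<open>Koszul's argument: the defect nab - d is symmetric in its two field arguments because both
  connections are torsion free, and it is skew because both are metric.\<close>
lemma levi_civita_inner:
  assumes "levi_civita M nab" "openin (top_of_set M) U" "x \<in> U"
    and X: "tangent_field_on M U X" and Y: "tangent_field_on M U Y" and Z: "tangent_field_on M U Z"
  shows "nab Y x (X x) \<bullet> Z x = differential M Y x (X x) \<bullet> Z x"
proof -
  note L = mp[OF spec[OF assms(1)[unfolded levi_civita_def], of U] assms(2)]
  \<comment> \<open>The fifth and sixth clauses of \<open>levi_civita\<close> are extracted: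
    compatibility with the metric and vanishing torsion.\<close>
  note metric = L[THEN conjunct2, THEN conjunct2, THEN conjunct2, THEN conjunct2, THEN conjunct1, rule_format]
  note torsion = L[THEN conjunct2, THEN conjunct2, THEN conjunct2, THEN conjunct2, THEN conjunct2, rule_format]
  define S where "S X Y = nab Y x (X x) - differential M Y x (X x)" for X Y
  have tan: "X x \<in> tangent_space M x" if "tangent_field_on M U X" for X
    using that assms(3) by (simp add: tangent_field_on_def)
  have der: "(X has_derivative differential M X x) (at x within M)" if "tangent_field_on M U X" for X
    by (rule smooth_map_on_differential[OF conjunct1[OF that[unfolded tangent_field_on_def]] assms(2,3)])
  have sym: "S X Y = S Y X" if "tangent_field_on M U X" "tangent_field_on M U Y" for X Y
  proof -
    have "nab Y x (X x) - nab X x (Y x) = lie_bracket M X Y x" by (rule torsion[OF that assms(3)])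
    then show ?thesis by (simp add: S_def lie_bracket_def algebra_simps)
  qed
  have skew: "S X Y \<bullet> Z x = - (S X Z \<bullet> Y x)"
    if XYZ: "tangent_field_on M U X" "tangent_field_on M U Y" "tangent_field_on M U Z" for X Y Z
  proof -
    have "differential M (\<lambda>y. Y y \<bullet> Z y) x (X x) = nab Y x (X x) \<bullet> Z x + Y x \<bullet> nab Z x (X x)"
      by (rule metric[OF XYZ(2,3) assms(3) tan[OF XYZ(1)]])
    moreover have "differential M (\<lambda>y. Y y \<bullet> Z y) x (X x) =
        Y x \<bullet> differential M Z x (X x) + differential M Y x (X x) \<bullet> Z x"
      by (rule differential_eq[OF has_derivative_inner[OF der[OF XYZ(2)] der[OF XYZ(3)]] tan[OF XYZ(1)]])
    ultimately show ?thesis by (simp add: S_def inner_diff_left inner_diff_right inner_commute)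
  qed
  \<comment> \<open>Three uses each of symmetry and skewness bring the fields back to their places
    with the opposite sign: (X,Y,Z) -> -(Y,Z,X) -> (Z,X,Y) -> -(X,Y,Z), where (X,Y,Z) is
    \<open>S X Y \<bullet> Z x\<close>.\<close>
  have "S X Y \<bullet> Z x = - (S X Y \<bullet> Z x)"
    using sym[OF X Y] skew[OF Y X Z] sym[OF Y Z] skew[OF Z Y X] sym[OF Z X] skew[OF X Z Y] by simp
  then show ?thesis by (simp add: S_def inner_diff_left)
qed

section \<open>Vertical vectors in frame coordinates\<close>

lemma W_field_nth:
  fixes A :: "real ^ 'k::finite ^ 'k"
  shows "W_field i j A $ r $ c = (if c = j then A $ r $ i else 0) - (if c = i then A $ r $ j else 0)"
  by (simp add: W_field_def axis_def sum_subtractf if_distrib[of "\<lambda>x. _ * x"] if_distrib[of "\<lambda>x. x $ _"] cong: if_cong)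

text \<open>\<open>W_field i j A\<close> is A (E_ij - E_ji) with the matrix units E_ij, and for skew
  coefficients the sum over i < j of \<omega> i j (E_ij - E_ji) is the whole matrix of
  \<omega>.\<close>

lemma sum_W_field:
  fixes A :: "((real, 'k) vec, 'k::{finite,linorder}) vec"
  assumes skew: "\<And>i j. \<omega> j i = - \<omega> i j"
  shows "(\<Sum>(i, j)\<in>{(i, j). i < j}. \<omega> i j *\<^sub>R W_field i j A) = A ** (\<chi> i j. \<omega> i j)"
proof -
  have "(\<Sum>(i, j)\<in>{(i, j). i < j}. \<omega> i j *\<^sub>R W_field i j A) $ r $ c = (A ** (\<chi> i j. \<omega> i j)) $ r $ c" for r c
  proof -
    have diag: "\<omega> c c = 0" using skew[of c c] by simp
    have "(\<Sum>(i, j)\<in>{(i, j). i < j}. \<omega> i j *\<^sub>R W_field i j A) $ r $ c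
        = (\<Sum>(i, j)\<in>{(i, j). i < j}. \<omega> i j * W_field i j A $ r $ c)"
      by (simp add: split_beta)
    also have "\<dots> = (\<Sum>(i, j)\<in>UNIV. if i < j then \<omega> i j * W_field i j A $ r $ c else 0)"
      by (rule sum.mono_neutral_cong_left) (auto split: if_splits)
    also have "\<dots> = (\<Sum>i\<in>UNIV. \<Sum>j\<in>UNIV. if i < j then \<omega> i j * W_field i j A $ r $ c else 0)"
      by (simp add: sum.cartesian_product UNIV_Times_UNIV[symmetric] del: UNIV_Times_UNIV)
    also have "\<dots> = (\<Sum>i\<in>UNIV. \<Sum>j\<in>UNIV. (if j = c then if i < c then \<omega> i c * A $ r $ i else 0 else 0)
        + (if i = c then if c < j then \<omega> j c * A $ r $ j else 0 else 0))"
    proof (intro sum.cong refl)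
      fix i j
      show "(if i < j then \<omega> i j * W_field i j A $ r $ c else 0) =
          (if j = c then if i < c then \<omega> i c * A $ r $ i else 0 else 0)
          + (if i = c then if c < j then \<omega> j c * A $ r $ j else 0 else 0)"
      proof (cases "i = c")
        case True
        then show ?thesis using skew[of j c] by (simp add: W_field_nth)
      qed (simp add: W_field_nth)
    qed
    also have "\<dots> = (\<Sum>i\<in>UNIV. if i < c then \<omega> i c * A $ r $ i else 0)
        + (\<Sum>i\<in>UNIV. \<Sum>j\<in>UNIV. if i = c then if c < j then \<omega> j c * A $ r $ j else 0 else 0)"
      by (simp add: sum.distrib)
    also have "(\<Sum>i\<in>UNIV. \<Sum>j\<in>UNIV. if i = c then if c < j then \<omega> j c * A $ r $ j else 0 else 0)
        = (\<Sum>j\<in>UNIV. if c < j then \<omega> j c * A $ r $ j else 0)"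
      by (subst sum.swap) simp
    also have "(\<Sum>i\<in>UNIV. if i < c then \<omega> i c * A $ r $ i else 0) + \<dots> = (\<Sum>i\<in>UNIV. A $ r $ i * \<omega> i c)"
      unfolding sum.distrib[symmetric] by (intro sum.cong refl) (auto simp: diag not_less_iff_gr_or_eq)
    finally show ?thesis by (simp add: matrix_matrix_mult_def)
  qed
  then show ?thesis by (simp add: vec_eq_iff)
qed

text \<open>With \<open>\<omega> i j\<close> the coefficients of \<open>V_part\<close> and A, dA the frame matrix of q and its derivative,
  the matrix \<open>transpose A ** dA - \<omega>\<close> has the entries \<open>(qd *v E j) \<bullet> (q *v E i)\<close>.\<close>
lemma frame_matrix_derivative_iff:
  fixes E Ed Eh Ehd :: "'k::{finite,linorder} \<Rightarrow> real ^ 'd::finite" and q qd :: "real ^ 'd ^ 'd"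
  assumes onE: "\<And>i j. E i \<bullet> E j = (if i = j then 1 else 0)"
    and onEh: "\<And>i j. Eh i \<bullet> Eh j = (if i = j then 1 else 0)"
    and skE: "\<And>i j. Ed i \<bullet> E j + E i \<bullet> Ed j = 0" and skEh: "\<And>i j. Ehd i \<bullet> Eh j + Eh i \<bullet> Ehd j = 0"
    and qE: "\<And>j. q *v E j \<in> span (range Eh)" and iso: "\<And>u j. (q *v u) \<bullet> (q *v E j) = u \<bullet> E j"
  defines "A \<equiv> (\<chi> i j. (q *v E j) \<bullet> Eh i)"
    and "dA \<equiv> (\<chi> i j. (qd *v E j + q *v Ed j) \<bullet> Eh i + (q *v E j) \<bullet> Ehd i)"
  defines "\<omega> \<equiv> (\<lambda>i j. Ed j \<bullet> E i - (\<Sum>s\<in>UNIV. A $ s $ j *\<^sub>R Ehd s) \<bullet> (\<Sum>s\<in>UNIV. A $ s $ i *\<^sub>R Eh s))"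
  shows "dA = (\<Sum>(i, j)\<in>{(i, j). i < j}. \<omega> i j *\<^sub>R W_field i j A) \<longleftrightarrow> (\<forall>i j. (qd *v E j) \<bullet> (q *v E i) = 0)"
proof -
  have exp: "q *v E j = (\<Sum>s\<in>UNIV. A $ s $ j *\<^sub>R Eh s)" for j
    using orthonormal_expansion[OF onEh qE] by (simp add: A_def)
  have inner_exp: "u \<bullet> (q *v E j) = (\<Sum>s\<in>UNIV. A $ s $ j * (u \<bullet> Eh s))" for u j
    unfolding exp by (simp add: inner_sum_right)
  have ATA: "transpose A ** A = mat 1"
  proof -
    have "(\<Sum>s\<in>UNIV. A $ s $ i * A $ s $ j) = (if i = j then 1 else 0)" for i j
      using inner_exp[of "q *v E j" i] iso[of "E j" i] onE[of j i] by (auto simp: A_def split: if_splits)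
    then show ?thesis by (simp add: vec_eq_iff matrix_matrix_mult_def transpose_def mat_def)
  qed
  then have AAT: "A ** transpose A = mat 1" using matrix_left_right_inverse by blast
  define H where "H i j = (\<Sum>s\<in>UNIV. A $ s $ j *\<^sub>R Ehd s) \<bullet> (\<Sum>s\<in>UNIV. A $ s $ i *\<^sub>R Eh s)" for i j
  have H: "H i j = (\<Sum>s\<in>UNIV. \<Sum>r\<in>UNIV. A $ s $ i * (A $ r $ j * (Ehd r \<bullet> Eh s)))" for i j
    unfolding H_def by (simp add: inner_sum_left inner_sum_right sum_distrib_left)
  \<comment> \<open>The derivative of the frame \<open>Eh\<close> enters \<open>dA\<close> as the
    second factor of an inner product; skewness moves it to the first factor with a minus sign. This
    is where the minus sign in \<omega> comes from.\<close>
  have H': "H i j = - (\<Sum>s\<in>UNIV. A $ s $ i * ((q *v E j) \<bullet> Ehd s))" for i j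
  proof -
    have "(q *v E j) \<bullet> Ehd s = (\<Sum>r\<in>UNIV. A $ r $ j * (Eh r \<bullet> Ehd s))" for s
      unfolding exp by (simp add: inner_sum_left)
    moreover have "Ehd r \<bullet> Eh s = - (Eh r \<bullet> Ehd s)" for r s using skEh[of r s] by simp
    ultimately show ?thesis unfolding H by (simp add: sum_distrib_left sum_negf ac_simps)
  qed
  have skewH: "H j i = - H i j" for i j
  proof -
    have flip: "Ehd r \<bullet> Eh s = - (Ehd s \<bullet> Eh r)" for r s
      using skEh[of r s] inner_commute[of "Eh r" "Ehd s"] by simp
    have "H j i = (\<Sum>s\<in>UNIV. \<Sum>r\<in>UNIV. - (A $ r $ i * (A $ s $ j * (Ehd s \<bullet> Eh r))))"
      unfolding H[of j i]
    proof (intro sum.cong refl)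
      fix s r
      show "A $ s $ j * (A $ r $ i * (Ehd r \<bullet> Eh s)) = - (A $ r $ i * (A $ s $ j * (Ehd s \<bullet> Eh r)))"
        by (subst flip) simp
    qed
    also have "\<dots> = - H i j" unfolding H[of i j] by (subst sum.swap) (simp add: sum_negf)
    finally show ?thesis .
  qed
  have \<omega>: "\<omega> i j = Ed j \<bullet> E i - H i j" for i j by (simp add: \<omega>_def H_def)
  have skew: "\<omega> j i = - \<omega> i j" for i j using skE[of i j] skewH[of i j] by (simp add: \<omega> inner_commute)
  have entry: "(transpose A ** dA) $ i $ j = (qd *v E j) \<bullet> (q *v E i) + \<omega> i j" for i j
  proof -
    have "(transpose A ** dA) $ i $ j = (\<Sum>s\<in>UNIV. A $ s $ i * ((qd *v E j + q *v Ed j) \<bullet> Eh s)) +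
        (\<Sum>s\<in>UNIV. A $ s $ i * ((q *v E j) \<bullet> Ehd s))"
      by (simp add: matrix_matrix_mult_def transpose_def dA_def distrib_left sum.distrib)
    also have "\<dots> = (qd *v E j + q *v Ed j) \<bullet> (q *v E i) - H i j" by (simp add: inner_exp H')
    also have "\<dots> = (qd *v E j) \<bullet> (q *v E i) + \<omega> i j" by (simp add: inner_add_left iso \<omega>)
    finally show ?thesis .
  qed
  \<comment> \<open>A is orthogonal, so multiplication by \<open>transpose A\<close> is
    reversible.\<close>
  have "dA = A ** (\<chi> i j. \<omega> i j) \<longleftrightarrow> transpose A ** dA = (\<chi> i j. \<omega> i j)"
    using ATA AAT by (metis matrix_mul_assoc matrix_mul_lid)
  also have "\<dots> \<longleftrightarrow> (\<forall>i j. (qd *v E j) \<bullet> (q *v E i) = 0)" by (simp add: vec_eq_iff entry)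
  finally show ?thesis unfolding sum_W_field[of \<omega> A, OF skew] .
qed

section \<open>Parallel fields along a curve\<close>

lemma orth_proj_eqI:
  fixes V :: "'a::euclidean_space set"
  assumes "subspace V" "w \<in> V" "v - w \<in> orthogonal_comp V"
  shows "orth_proj V v = w"
  unfolding orth_proj_def
proof (rule the_equality)
  fix w' assume w': "w' \<in> V \<and> v - w' \<in> orthogonal_comp V"
  have "w - w' \<in> V" using assms w' by (simp add: subspace_diff)
  moreover have "(v - w') - (v - w) \<in> orthogonal_comp V"
    using subspace_diff[OF subspace_orthogonal_comp _ assms(3), of "v - w'"] w' by simp
  then have "w - w' \<in> orthogonal_comp V" by simp
  ultimately have "w - w' = 0" by (auto simp: orthogonal_comp_def orthogonal_def)
  then show "w' = w" by simp
qed (use assms in simp)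

lemma orth_proj:
  fixes V :: "'a::euclidean_space set"
  assumes "subspace V"
  shows "orth_proj V v \<in> V" "v - orth_proj V v \<in> orthogonal_comp V"
proof -
  obtain y z where "y \<in> V" "z \<in> orthogonal_comp V" "v = y + z"
    using subspace_sum_orthogonal_comp[OF assms] by (metis UNIV_I set_plus_elim)
  then have "orth_proj V v = y" "y \<in> V" "v - y \<in> orthogonal_comp V"
    using orth_proj_eqI[OF assms, of y v] by auto
  then show "orth_proj V v \<in> V" "v - orth_proj V v \<in> orthogonal_comp V" by auto
qed

lemma orth_proj_inner:
  fixes V :: "'a::euclidean_space set"
  assumes "subspace V" "w \<in> V"
  shows "orth_proj V v \<bullet> w = v \<bullet> w"
proof -
  have "w \<bullet> (v - orth_proj V v) = 0"
    using orth_proj(2)[OF assms(1), of v] assms(2) by (simp add: orthogonal_comp_def orthogonal_def)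
  then show ?thesis by (simp add: inner_diff_right inner_commute)
qed

lemma orth_proj_eq_iff:
  fixes V :: "'a::euclidean_space set"
  assumes "subspace V" "w \<in> V"
  shows "orth_proj V v = w \<longleftrightarrow> (\<forall>u\<in>V. v \<bullet> u = w \<bullet> u)"
proof
  assume "\<forall>u\<in>V. v \<bullet> u = w \<bullet> u"
  then have "v - w \<in> orthogonal_comp V"
    by (simp add: orthogonal_comp_def orthogonal_def inner_diff_right inner_commute)
  then show "orth_proj V v = w" using orth_proj_eqI assms by blast
qed (use orth_proj_inner assms in metis)

text \<open>Extension by zero makes L insensitive to the normal part of its argument, so inner
  products are preserved even when only one of the two vectors lies in V. The transpose maps into V
  and inverts L on V.\<close>

lemma Isom0_plusD:
  assumes "L \<in> Isom0_plus V oV W oW" "subspace V"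
  shows "v \<in> V \<Longrightarrow> L *v v \<in> W" "L *v orth_proj V u = L *v u" "L *v u \<in> W"
    "v \<in> V \<Longrightarrow> (L *v u) \<bullet> (L *v v) = u \<bullet> v" "transpose L *v w \<in> V"
    "v \<in> V \<Longrightarrow> transpose L *v (L *v v) = v"
proof -
  have L: "\<And>v. v \<in> V \<Longrightarrow> L *v v \<in> W \<and> norm (L *v v) = norm v" "\<And>v. v \<in> orthogonal_comp V \<Longrightarrow> L *v v = 0"
    using assms(1) by (auto simp: Isom0_plus_def)
  then show "v \<in> V \<Longrightarrow> L *v v \<in> W" by blast
  show proj: "L *v orth_proj V u = L *v u" for u
    using L(2)[OF orth_proj(2)[OF assms(2), of u]] by (simp add: matrix_vector_mult_diff_distrib)
  then show "L *v u \<in> W" using L(1)[OF orth_proj(1)[OF assms(2), of u]] by simp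
  show iso: "(L *v u) \<bullet> (L *v v) = u \<bullet> v" if "v \<in> V" for u v
  proof -
    define u' where "u' = orth_proj V u"
    have u': "u' \<in> V" unfolding u'_def by (rule orth_proj(1)[OF assms(2)])
    have "norm (L *v u' + L *v v) = norm (u' + v)"
      using L(1)[OF subspace_add[OF assms(2) u' that]] by (simp add: matrix_vector_right_distrib)
    \<comment> \<open>Polarization: L preserves the norms of u', v and u' + v.\<close>
    then have "(L *v u') \<bullet> (L *v v) = u' \<bullet> v"
      using L(1)[OF u'] L(1)[OF that] by (simp add: dot_norm)
    then show ?thesis using proj[of u] orth_proj_inner[OF assms(2) that, of u] by (simp add: u'_def)
  qed
  \<comment> \<open>The range of the transpose is orthogonal to the kernel of L, which contains the
    orthogonal complement of V; so it lies in V.\<close>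
  show tr: "transpose L *v w \<in> V" for w
    using L(2) orthogonal_comp_self[OF assms(2)] by (auto simp: orthogonal_comp_def[of "orthogonal_comp V"] orthogonal_def dot_lmul_matrix
        transpose_matrix_vector inner_commute[of _ "_ v* _"])
  show "transpose L *v (L *v v) = v" if "v \<in> V"
  proof -
    have d: "transpose L *v (L *v v) - v \<in> V" by (rule subspace_diff[OF assms(2) tr that])
    have "(transpose L *v (L *v v)) \<bullet> u = v \<bullet> u" for u
    proof -
      have "(transpose L *v (L *v v)) \<bullet> u = (L *v v) \<bullet> (L *v u)"
        by (simp add: transpose_matrix_vector dot_lmul_matrix)
      also have "\<dots> = v \<bullet> u" using iso[OF that, of u] by (simp add: inner_commute)
      finally show ?thesis .
    qed
    then have "\<forall>u. (transpose L *v (L *v v)) \<bullet> u = v \<bullet> u" by (rule allI)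
    then show ?thesis by (rule vector_eq_rdot[THEN iffD1])
  qed
qed

lemma negligible_imp_AE_lebesgue_on:
  assumes "negligible {t \<in> S. \<not> P t}" "S \<in> sets lebesgue"
  shows "AE t in lebesgue_on S. P t"
proof -
  have "AE t in lebesgue. t \<notin> {t \<in> S. \<not> P t}"
    using assms(1) by (intro AE_not_in) (simp add: negligible_iff_null_sets)
  then have "AE t in lebesgue. t \<in> S \<longrightarrow> P t" by eventually_elim simp
  then show ?thesis using assms(2) by (simp add: AE_restrict_space_iff)
qed

text \<open>At interior points \<open>at t within {0..\<tau>}\<close> is \<open>at t\<close>, so
  \<open>velocity\<close> is an ordinary derivative there; the endpoints belong to the null
  set.\<close>

lemma abs_continuous_on_AE_derivative:
  fixes f :: "real \<Rightarrow> 'a::euclidean_space"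
  assumes "abs_continuous_on {0..\<tau>} f"
  shows "AE t in lebesgue_on {0..\<tau>}. t \<in> {0<..<\<tau>} \<and> (f has_vector_derivative velocity \<tau> f t) (at t)"
proof (rule negligible_imp_AE_lebesgue_on)
  have "{t \<in> {0..\<tau>}. \<not> (t \<in> {0<..<\<tau>} \<and> (f has_vector_derivative velocity \<tau> f t) (at t))}
      \<subseteq> {t \<in> {0..\<tau>}. \<not> (t \<in> {0<..<\<tau>} \<and> f differentiable (at t))}"
    by (auto simp: at_within_Icc_at dest!: vector_derivative_works[THEN iffD1])
  then show "negligible {t \<in> {0..\<tau>}. \<not> (t \<in> {0<..<\<tau>} \<and> (f has_vector_derivative velocity \<tau> f t) (at t))}"
    using negligible_nondifferentiable_abs_continuous[OF assms] negligible_subset by blast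
qed simp

lemma velocity_eq: "t \<in> {0<..<\<tau>} \<Longrightarrow> (f has_vector_derivative v) (at t) \<Longrightarrow> velocity \<tau> f t = v"
  by (simp add: at_within_Icc_at vector_derivative_at)

lemma bounded_linear_transpose_mult:
  "bounded_linear (\<lambda>A :: real ^ 'd::finite ^ 'd. transpose A *v w)"
  by (intro linear_conv_bounded_linear[THEN iffD1] linearI)
    (simp_all add: vec_eq_iff matrix_vector_mult_def transpose_def distrib_right sum.distrib
      mult.assoc flip: sum_distrib_left)

lemma bounded_bilinear_matrix_vector_mult:
  "bounded_bilinear ((*v) :: real ^ 'd::finite ^ 'e::finite \<Rightarrow> real ^ 'd \<Rightarrow> real ^ 'e)"
proof -
  have "bilinear ((*v) :: real ^ 'd ^ 'e \<Rightarrow> real ^ 'd \<Rightarrow> real ^ 'e)"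
    unfolding bilinear_def
    by (auto intro!: linearI simp: matrix_vector_right_distrib matrix_vector_mult_add_rdistrib
        matrix_vector_mult_scaleR scaleR_matrix_vector_assoc)
  then show ?thesis by (simp add: bilinear_conv_bounded_bilinear)
qed

text \<open>An isometry extended by zero kills the normal part of Z', so the parallelism condition at t says
  that the derivative of q maps Z(t) into the orthogonal complement of \<open>W t\<close>; the fields
  \<open>transpose (q s) *v w\<close> with constant w are admissible and span \<open>V t\<close>.\<close>
lemma parallel_fields_iff:
  fixes q :: "real \<Rightarrow> real ^ 'd::finite ^ 'd" and V W :: "real \<Rightarrow> (real ^ 'd) set"
  assumes ac: "abs_continuous_on {0..\<tau>} q"
    and VW: "\<And>t. t \<in> {0..\<tau>} \<Longrightarrow> subspace (V t)" "\<And>t. t \<in> {0..\<tau>} \<Longrightarrow> subspace (W t)"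
    and q: "\<And>t. t \<in> {0..\<tau>} \<Longrightarrow> q t \<in> Isom0_plus (V t) (oV t) (W t) (oW t)"
  shows "(\<forall>Z. abs_continuous_on {0..\<tau>} Z \<longrightarrow> (\<forall>t\<in>{0..\<tau>}. Z t \<in> V t) \<longrightarrow>
        (AE t in lebesgue_on {0..\<tau>}. q t *v orth_proj (V t) (velocity \<tau> Z t) =
           orth_proj (W t) (velocity \<tau> (\<lambda>s. q s *v Z s) t))) \<longleftrightarrow>
      (AE t in lebesgue_on {0..\<tau>}. \<forall>v\<in>V t. \<forall>w\<in>W t. (velocity \<tau> q t *v v) \<bullet> w = 0)" (is "?L \<longleftrightarrow> ?R")
proof -
  have deriv: "AE t in lebesgue_on {0..\<tau>}. t \<in> {0<..<\<tau>} \<and> (\<forall>u\<in>W t.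
      velocity \<tau> (\<lambda>s. q s *v Z s) t \<bullet> u = (velocity \<tau> q t *v Z t) \<bullet> u + (q t *v velocity \<tau> Z t) \<bullet> u)"
    if "abs_continuous_on {0..\<tau>} Z" for Z
    using abs_continuous_on_AE_derivative[OF ac] abs_continuous_on_AE_derivative[OF that]
  proof eventually_elim
    case (elim t)
    then have "((\<lambda>s. q s *v Z s) has_vector_derivative
        (q t *v velocity \<tau> Z t + velocity \<tau> q t *v Z t)) (at t)"
      by (intro bounded_bilinear.has_vector_derivative[OF bounded_bilinear_matrix_vector_mult]) auto
    from velocity_eq[OF _ this] elim show ?case by (simp add: inner_add_left)
  qed
  \<comment> \<open>The matrix q t ignores the projection onto V t and maps into W t, so the
    equation of projections can be tested by inner products with W t.\<close>
  have parallel: "q t *v orth_proj (V t) z = orth_proj (W t) y \<longleftrightarrow> (\<forall>u\<in>W t. y \<bullet> u = (q t *v z) \<bullet> u)"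
    if "t \<in> {0..\<tau>}" for t y z
    using orth_proj_eq_iff[OF VW(2)[OF that] Isom0_plusD(3)[OF q[OF that] VW(1)[OF that]], of y z]
    by (simp add: Isom0_plusD(2)[OF q[OF that] VW(1)[OF that]] eq_commute)
  show ?thesis
  proof (intro iffI allI impI)
    fix Z assume R: ?R and Z: "abs_continuous_on {0..\<tau>} Z" "\<forall>t\<in>{0..\<tau>}. Z t \<in> V t"
    show "AE t in lebesgue_on {0..\<tau>}. q t *v orth_proj (V t) (velocity \<tau> Z t) =
           orth_proj (W t) (velocity \<tau> (\<lambda>s. q s *v Z s) t)"
      using R deriv[OF Z(1)]
    proof eventually_elim
      case (elim t)
      then have t: "t \<in> {0..\<tau>}" by simp
      with elim Z(2) show ?case unfolding parallel[OF t] by simp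
    qed
  next
    assume L: ?L
    define Z where "Z b s = transpose (q s) *v b" for b s
    have acZ: "abs_continuous_on {0..\<tau>} (Z b)" for b
    proof -
      obtain K where K: "\<And>A :: real ^ 'd ^ 'd. norm (transpose A *v b) \<le> norm A * K"
        using bounded_linear.bounded[OF bounded_linear_transpose_mult] by blast
      show ?thesis
      proof (rule abs_continuous_on_lipschitz[OF ac, of _ K])
        fix s t
        have "Z b t - Z b s = transpose (q t - q s) *v b"
          unfolding Z_def by (rule linear_diff[OF bounded_linear.linear[OF bounded_linear_transpose_mult], symmetric])
        then show "norm (Z b t - Z b s) \<le> K * norm (q t - q s)" using K[of "q t - q s"] by (simp add: mult.commute)
      qed
    qed
    have ZV: "\<forall>t\<in>{0..\<tau>}. Z b t \<in> V t" for b
      unfolding Z_def using Isom0_plusD(5)[OF q VW(1)] by blast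
    have "AE t in lebesgue_on {0..\<tau>}. t \<in> {0..\<tau>} \<and> (\<forall>w\<in>W t. (velocity \<tau> q t *v Z b t) \<bullet> w = 0)" for b
      using mp[OF mp[OF spec[OF L, of "Z b"] acZ] ZV] deriv[OF acZ, of b]
    proof eventually_elim
      case (elim t)
      then have t: "t \<in> {0..\<tau>}" by simp
      with elim show ?case unfolding parallel[OF t] by simp
    qed
    \<comment> \<open>Here the null sets of the individual test fields are united, which is possible
      because b ranges over a finite basis.\<close>
    then have "AE t in lebesgue_on {0..\<tau>}. \<forall>b\<in>Basis. t \<in> {0..\<tau>} \<and> (\<forall>w\<in>W t. (velocity \<tau> q t *v Z b t) \<bullet> w = 0)"
      by (intro AE_finite_allI) auto
    then show ?R
    proof eventually_elim
      case (elim t)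
      then have t: "t \<in> {0..\<tau>}" using nonempty_Basis by blast
      show ?case
      proof (intro ballI)
        fix v w assume "v \<in> V t" "w \<in> W t"
        let ?y = "q t *v v"
        \<comment> \<open>Applying the transpose to the expansion of q v in the ambient basis
          exhibits v as a combination of the values \<open>Z b t\<close>.\<close>
        have "v = transpose (q t) *v ?y" using Isom0_plusD(6)[OF q[OF t] VW(1)[OF t] \<open>v \<in> V t\<close>] by simp
        also have "\<dots> = transpose (q t) *v (\<Sum>b\<in>Basis. (?y \<bullet> b) *\<^sub>R b)" by (simp only: euclidean_representation)
        also have "\<dots> = (\<Sum>b\<in>Basis. (?y \<bullet> b) *\<^sub>R Z b t)"
          unfolding Z_def by (simp only: linear_sum[OF matrix_vector_mul_linear] linear_scale[OF matrix_vector_mul_linear])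
        finally have "velocity \<tau> q t *v v = velocity \<tau> q t *v (\<Sum>b\<in>Basis. (?y \<bullet> b) *\<^sub>R Z b t)"
          by (rule arg_cong)
        also have "\<dots> = (\<Sum>b\<in>Basis. (?y \<bullet> b) *\<^sub>R (velocity \<tau> q t *v Z b t))"
          by (simp only: linear_sum[OF matrix_vector_mul_linear] linear_scale[OF matrix_vector_mul_linear])
        finally show "(velocity \<tau> q t *v v) \<bullet> w = 0" using elim \<open>w \<in> W t\<close> by (simp add: inner_sum_left)
      qed
    qed
  qed
qed

text \<open>L is injective on V, so its image is a subspace of W of full dimension.\<close>

lemma Isom0_plus_surj:
  assumes "L \<in> Isom0_plus V oV W oW" "subspace V" "subspace W" "dim V = dim W" "w \<in> W"
  obtains v where "v \<in> V" "w = L *v v"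
proof -
  have lin: "linear ((*v) L)" by simp
  have sub: "subspace ((*v) L ` V)" by (rule linear_subspace_image[OF lin assms(2)])
  have "inj_on ((*v) L) (span V)"
    unfolding span_eq_iff[THEN iffD2, OF assms(2)]
    by (rule inj_onI) (metis Isom0_plusD(6)[OF assms(1,2)])
  then have "dim ((*v) L ` V) = dim V" by (rule dim_image_eq[OF lin])
  then have "(*v) L ` V = W"
    using Isom0_plusD(1)[OF assms(1,2)] assms(3,4) sub by (intro subspace_dim_equal) auto
  then show thesis using assms(5) that by blast
qed

section \<open>The distribution in a trivialization\<close>

lemma has_derivative_vec_lambda:
  fixes f :: "'i::finite \<Rightarrow> 'a::real_normed_vector \<Rightarrow> 'b::euclidean_space"
  assumes "\<And>i. (f i has_derivative f' i) (at x within S)"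
  shows "((\<lambda>y. \<chi> i. f i y) has_derivative (\<lambda>v. \<chi> i. f' i v)) (at x within S)"
proof -
  have "((\<lambda>y. (\<chi> i. f i y) \<bullet> b) has_derivative (\<lambda>v. (\<chi> i. f' i v) \<bullet> b)) (at x within S)"
    if b: "b \<in> Basis" for b :: "'b ^ 'i"
  proof -
    obtain i u where "b = axis i u" using b unfolding Basis_vec_def by blast
    then show ?thesis
      using has_derivative_inner_left[OF assms[of i], of u] by (simp add: inner_axis)
  qed
  then show ?thesis by (subst has_derivative_componentwise_within) blast
qed

lemma locally_constant_has_derivative:
  assumes "openin (top_of_set M) U" "x \<in> U" "\<And>y. y \<in> U \<Longrightarrow> f y = c"
  shows "(f has_derivative (\<lambda>_. 0)) (at x within M)"
proof -
  obtain W where W: "open W" "U = M \<inter> W" using assms(1) by (auto simp: openin_open)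
  then have "x \<in> W" using assms(2) by blast
  then obtain d where d: "0 < d" "ball x d \<subseteq> W" using W(1) openE by blast
  show ?thesis
  proof (rule has_derivative_transform_within[OF has_derivative_const d(1)])
    show "x \<in> M" using assms(2) W by blast
    show "c = f y" if "y \<in> M" "dist y x < d" for y
    proof -
      have "y \<in> ball x d" using that(2) by (simp add: dist_commute)
      then show ?thesis using assms(3) W(2) d(2) that(1) by auto
    qed
  qed
qed

lemma orthonormal_frame_differential_skew:
  fixes e :: "'k \<Rightarrow> 'a::euclidean_space \<Rightarrow> 'a"
  assumes U: "openin (top_of_set M) U" "x \<in> U" and sm: "\<And>j. smooth_map_on U (e j)"
    and on: "\<And>y i j. y \<in> U \<Longrightarrow> e i y \<bullet> e j y = (if i = j then 1 else 0)"
    and v: "v \<in> tangent_space M x"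
  shows "differential M (e i) x v \<bullet> e j x + e i x \<bullet> differential M (e j) x v = 0"
proof -
  have "((\<lambda>y. e i y \<bullet> e j y) has_derivative
      (\<lambda>v. e i x \<bullet> differential M (e j) x v + differential M (e i) x v \<bullet> e j x)) (at x within M)"
    by (intro has_derivative_inner smooth_map_on_differential[OF sm U])
  moreover have "((\<lambda>y. e i y \<bullet> e j y) has_derivative (\<lambda>_. 0)) (at x within M)"
    by (rule locally_constant_has_derivative[OF U on])
  ultimately have "e i x \<bullet> differential M (e j) x v + differential M (e i) x v \<bullet> e j x = 0"
    by (rule tangent_derivative_unique[OF _ _ v])
  then show ?thesis by simp
qed

lemma differential_const_comb:
  fixes e :: "'k::finite \<Rightarrow> 'a::euclidean_space \<Rightarrow> 'a"
  assumes U: "openin (top_of_set M) U" "x \<in> U" and sm: "\<And>j. smooth_map_on U (e j)"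
    and v: "v \<in> tangent_space M x"
  shows "differential M (const_comb e A j) x v = (\<Sum>s\<in>UNIV. A $ s $ j *\<^sub>R differential M (e s) x v)"
  unfolding const_comb_def
  by (rule differential_eq[OF _ v], intro has_derivative_sum has_derivative_scaleR_right smooth_map_on_differential[OF sm U])

text \<open>The connections enter through the hypotheses that their frame coefficients are those of
  the ambient derivative. Thus one lemma covers the tangential block with the Levi-Civita
  connections and the normal block with the normal connections.\<close>

lemma V_part_iff:
  fixes e eh :: "'k::{finite,linorder} \<Rightarrow> real ^ 'd::finite \<Rightarrow> real ^ 'd" and q qd :: "real ^ 'd ^ 'd"
  assumes U: "openin (top_of_set M) U" "x \<in> U" "\<And>j. smooth_map_on U (e j)"
      "\<And>y i j. y \<in> U \<Longrightarrow> e i y \<bullet> e j y = (if i = j then 1 else 0)"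
    and Uh: "openin (top_of_set Mh) Uh" "xh \<in> Uh" "\<And>j. smooth_map_on Uh (eh j)"
      "\<And>y i j. y \<in> Uh \<Longrightarrow> eh i y \<bullet> eh j y = (if i = j then 1 else 0)"
    and X: "X \<in> tangent_space M x" and Xh: "Xh \<in> tangent_space Mh xh"
    and nab: "\<And>i j. nab (e j) x X \<bullet> e i x = differential M (e j) x X \<bullet> e i x"
    and nabh: "\<And>A i j. nabh (const_comb eh A j) xh Xh \<bullet> const_comb eh A i xh =
        differential Mh (const_comb eh A j) xh Xh \<bullet> const_comb eh A i xh"
    and qe: "\<And>j. q *v e j x \<in> span (range (\<lambda>i. eh i xh))" "\<And>u j. (q *v u) \<bullet> (q *v e j x) = u \<bullet> e j x"
  shows "(\<chi> i j. (qd *v e j x + q *v differential M (e j) x X) \<bullet> eh i xh + (q *v e j x) \<bullet> differential Mh (eh i) xh Xh) =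
      V_part nab nabh e eh x xh (\<chi> i j. (q *v e j x) \<bullet> eh i xh) X Xh \<longleftrightarrow>
    (\<forall>i j. (qd *v e j x) \<bullet> (q *v e i x) = 0)"
  unfolding V_part_def nab nabh
    differential_const_comb[OF Uh(1,2,3) Xh] unfolding const_comb_def
  by (rule frame_matrix_derivative_iff[of "\<lambda>j. e j x" "\<lambda>j. eh j xh" "\<lambda>j. differential M (e j) x X" "\<lambda>j. differential Mh (eh j) xh Xh"])
    (use U(2,4) Uh(2,4) qe orthonormal_frame_differential_skew[OF U X] orthonormal_frame_differential_skew[OF Uh Xh] in auto)

text \<open>The expression is bilinear, and q maps V onto W, so the vectors \<open>q *v e i\<close>
  span W.\<close>

lemma span_condition_iff:
  fixes q qd :: "real ^ 'd::finite ^ 'd"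
  assumes "ordered_basis V e" "q \<in> Isom0_plus V oV W oW" "subspace V" "subspace W" "dim V = dim W"
  shows "(\<forall>i j. (qd *v e j) \<bullet> (q *v e i) = 0) \<longleftrightarrow> (\<forall>v\<in>V. \<forall>w\<in>W. (qd *v v) \<bullet> w = 0)"
proof
  have eV: "e i \<in> V" for i using assms(1) span_base[of "e i" "range e"] by (auto simp: ordered_basis_def)
  show "\<forall>i j. (qd *v e j) \<bullet> (q *v e i) = 0" if "\<forall>v\<in>V. \<forall>w\<in>W. (qd *v v) \<bullet> w = 0"
    using that eV Isom0_plusD(1)[OF assms(2,3)] by blast
  assume *: "\<forall>i j. (qd *v e j) \<bullet> (q *v e i) = 0"
  have V: "V = span (range e)" using assms(1) by (simp add: ordered_basis_def)
  have lin1: "subspace {u. (qd *v v) \<bullet> (q *v u) = 0}" for v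
    by (auto simp: subspace_def matrix_vector_right_distrib matrix_vector_mult_scaleR inner_add_right)
  have lin2: "subspace {v. \<forall>u\<in>V. (qd *v v) \<bullet> (q *v u) = 0}"
    by (auto simp: subspace_def matrix_vector_right_distrib matrix_vector_mult_scaleR inner_add_left)
  have 1: "(qd *v e j) \<bullet> (q *v u) = 0" if "u \<in> V" for u j
    by (rule span_induct[OF that[unfolded V] lin1]) (use * in auto)
  have 2: "\<forall>u\<in>V. (qd *v v) \<bullet> (q *v u) = 0" if "v \<in> V" for v
    by (rule span_induct[OF that[unfolded V] lin2]) (use 1 in auto)
  show "\<forall>v\<in>V. \<forall>w\<in>W. (qd *v v) \<bullet> w = 0"
  proof (intro ballI)
    fix v w assume "v \<in> V" "w \<in> W"
    from assms(2-5) this(2) obtain u where "u \<in> V" "w = q *v u" by (rule Isom0_plus_surj)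
    then show "(qd *v v) \<bullet> w = 0" using 2[OF \<open>v \<in> V\<close>] by simp
  qed
qed

text \<open>\<open>L\<close> stands for the projection of a bundle point to its q or its p
  component, so that both matrix blocks of \<open>triv\<close> are instances of one product
  rule.\<close>

lemma frame_entry_has_derivative:
  fixes e eh :: "'k::finite \<Rightarrow> real ^ 'd::finite \<Rightarrow> real ^ 'd"
    and L :: "(real ^ 'd) \<times> (real ^ 'd) \<times> 'c::real_normed_vector \<Rightarrow> real ^ 'd ^ 'd"
  assumes L: "bounded_linear L" and S: "fst ` S \<subseteq> M" "(\<lambda>z. fst (snd z)) ` S \<subseteq> Mh"
    and e: "\<And>j. (e j has_derivative e' j) (at (fst z) within M)"
    and eh: "\<And>j. (eh j has_derivative eh' j) (at (fst (snd z)) within Mh)"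
  shows "((\<lambda>z. \<chi> i j. (L z *v e j (fst z)) \<bullet> eh i (fst (snd z))) has_derivative
     (\<lambda>w. \<chi> i j. (L w *v e j (fst z) + L z *v e' j (fst w)) \<bullet> eh i (fst (snd z)) +
        (L z *v e j (fst z)) \<bullet> eh' i (fst (snd w)))) (at z within S)"
proof (intro has_derivative_vec_lambda)
  fix i j
  have fst': "(fst has_derivative fst) (at z within S)"
    by (rule bounded_linear_imp_has_derivative[OF bounded_linear_fst])
  have snd': "((\<lambda>z. fst (snd z)) has_derivative (\<lambda>z. fst (snd z))) (at z within S)"
    by (rule bounded_linear_imp_has_derivative[OF bounded_linear_compose[OF bounded_linear_fst bounded_linear_snd]])
  have 1: "((\<lambda>z. e j (fst z)) has_derivative (\<lambda>w. e' j (fst w))) (at z within S)"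
    by (rule has_derivative_in_compose[OF fst' has_derivative_subset[OF e S(1)]])
  have 2: "((\<lambda>z. eh i (fst (snd z))) has_derivative (\<lambda>w. eh' i (fst (snd w)))) (at z within S)"
    by (rule has_derivative_in_compose[OF snd' has_derivative_subset[OF eh S(2)]])
  have 3: "((\<lambda>z. L z *v e j (fst z)) has_derivative (\<lambda>w. L z *v e' j (fst w) + L w *v e j (fst z))) (at z within S)"
    by (rule bounded_bilinear.FDERIV[OF bounded_bilinear_matrix_vector_mult bounded_linear_imp_has_derivative[OF L] 1])
  show "((\<lambda>z. (L z *v e j (fst z)) \<bullet> eh i (fst (snd z))) has_derivative
     (\<lambda>w. (L w *v e j (fst z) + L z *v e' j (fst w)) \<bullet> eh i (fst (snd z)) +
        (L z *v e j (fst z)) \<bullet> eh' i (fst (snd w)))) (at z within S)"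
    using has_derivative_inner[OF 3 2] by (simp add: add.commute)
qed

lemma QP_bundleD:
  assumes "(x, xh, q, p) \<in> QP_bundle M ori Mh orih"
  shows "x \<in> M" "xh \<in> Mh"
    "q \<in> Isom0_plus (tangent_space M x) (ori x) (tangent_space Mh xh) (orih xh)"
    "p \<in> Isom0_plus (normal_space M x) (normal_orientation M ori x)
           (normal_space Mh xh) (normal_orientation Mh orih xh)"
  using assms by (auto simp: QP_bundle_def Q_bundle_def P_bundle_def)

lemma adapted_framesD:
  assumes "adapted_frames M ori U e \<epsilon>"
  shows "openin (top_of_set M) U" "smooth_map_on U (e j)" "smooth_map_on U (\<epsilon> k)"
    "y \<in> U \<Longrightarrow> e i y \<bullet> e j y = (if i = j then 1 else 0)"
    "y \<in> U \<Longrightarrow> \<epsilon> l y \<bullet> \<epsilon> k y = (if l = k then 1 else 0)"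
    "y \<in> U \<Longrightarrow> e j y \<in> tangent_space M y" "y \<in> U \<Longrightarrow> \<epsilon> k y \<in> normal_space M y"
  using assms by (auto simp: adapted_frames_def pos_orthonormal_frame_def)

lemma adapted_frames_ordered_basis:
  fixes M :: "(('n::finite, 'm::finite) amb) set"
  assumes "adapted_frames M ori U e \<epsilon>" "orientation_on M ori" "x \<in> U"
  shows "ordered_basis (tangent_space M x) (\<lambda>j. e j x)" "ordered_basis (normal_space M x) (\<lambda>k. \<epsilon> k x)"
proof -
  note A = adapted_framesD[OF assms(1)]
  have x: "x \<in> M" using A(1) assms(3) openin_imp_subset by blast
  obtain u :: "'n \<Rightarrow> ('n, 'm) amb" where u: "ordered_basis (tangent_space M x) u"
    by (rule subspace_orthonormal_basis[OF tangent_space_oriented(1,2)[OF assms(2) x]]) (rule that)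
  show "ordered_basis (tangent_space M x) (\<lambda>j. e j x)"
    by (rule orthonormal_ordered_basis[OF A(4)[OF assms(3)] u A(6)[OF assms(3)]])
  obtain u' :: "'m \<Rightarrow> ('n, 'm) amb" where u': "ordered_basis (normal_space M x) u'"
    by (rule subspace_orthonormal_basis[OF tangent_space_oriented(3,4)[OF assms(2) x]]) (rule that)
  show "ordered_basis (normal_space M x) (\<lambda>k. \<epsilon> k x)"
    by (rule orthonormal_ordered_basis[OF A(5)[OF assms(3)] u' A(7)[OF assms(3)]])
qed

lemma tangent_field_on_const_comb:
  fixes M :: "(('n::finite, 'm::finite) amb) set" and A :: "real ^ 'n ^ 'n"
  assumes "adapted_frames M ori U e \<epsilon>" "orientation_on M ori"
  shows "tangent_field_on M U (const_comb e A j)"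
  unfolding tangent_field_on_def const_comb_def
proof (intro conjI ballI)
  note F = adapted_framesD[OF assms(1)]
  show "smooth_map_on U (\<lambda>y. \<Sum>s\<in>UNIV. A $ s $ j *\<^sub>R e s y)"
    by (intro smooth_map_on_sum smooth_map_on_scaleR_const F(2)) simp
  fix y assume y: "y \<in> U"
  then have "y \<in> M" using F(1) openin_imp_subset by blast
  then show "(\<Sum>s\<in>UNIV. A $ s $ j *\<^sub>R e s y) \<in> tangent_space M y"
    by (intro subspace_sum subspace_scale tangent_space_oriented(1)[OF assms(2)] F(6)[OF y])
qed

text \<open>\<open>levi_civita_inner\<close> speaks of fields, so the vector X is extended to the
  field with the same constant coefficients in the frame.\<close>

lemma levi_civita_const_comb:
  fixes M :: "(('n::finite, 'm::finite) amb) set" and A :: "real ^ 'n ^ 'n"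
  assumes "adapted_frames M ori U e \<epsilon>" "orientation_on M ori" "levi_civita M nab" "x \<in> U" "X \<in> tangent_space M x"
  shows "nab (const_comb e A j) x X \<bullet> const_comb e A i x = differential M (const_comb e A j) x X \<bullet> const_comb e A i x"
proof -
  note F = adapted_framesD[OF assms(1)]
  \<comment> \<open>Every column of \<open>B\<close> holds the coordinates of X; the arbitrary index
    \<open>undefined\<close> picks one of them below.\<close>
  define B :: "real ^ 'n ^ 'n" where "B = (\<chi> s j. X \<bullet> e s x)"
  have "X = (\<Sum>s\<in>UNIV. (X \<bullet> e s x) *\<^sub>R e s x)"
  proof (rule orthonormal_expansion)
    show "e i x \<bullet> e j x = (if i = j then 1 else 0)" for i j by (rule F(4)[OF assms(4)])
    show "X \<in> span (range (\<lambda>s. e s x))"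
      using adapted_frames_ordered_basis(1)[OF assms(1,2,4)] assms(5) by (simp add: ordered_basis_def)
  qed
  then have "const_comb e B undefined x = X" by (simp add: const_comb_def B_def)
  then show ?thesis
    using levi_civita_inner[OF assms(3) F(1) assms(4), of "const_comb e B undefined"
        "const_comb e A j" "const_comb e A i"]
      tangent_field_on_const_comb[OF assms(1,2)] by metis
qed

text \<open>Exhibits a frame field as a constant combination, so that the lemmas on
  \<open>const_comb\<close> also yield the coefficients on the side of M.\<close>

lemma const_comb_mat_1: "const_comb e (mat 1) j = e j"
  by (simp add: const_comb_def mat_def fun_eq_iff if_distrib[of "\<lambda>x. x *\<^sub>R _"] cong: if_cong)

lemma normal_connection_const_comb:
  fixes M :: "(('n::finite, 'm::finite) amb) set" and A :: "real ^ 'm ^ 'm"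
  assumes "adapted_frames M ori U e \<epsilon>" "orientation_on M ori" "x \<in> U"
  shows "normal_connection M (const_comb \<epsilon> A j) x X \<bullet> const_comb \<epsilon> A i x =
     differential M (const_comb \<epsilon> A j) x X \<bullet> const_comb \<epsilon> A i x"
proof -
  note F = adapted_framesD[OF assms(1)]
  have "x \<in> M" using F(1) assms(3) openin_imp_subset by blast
  note N = tangent_space_oriented(3)[OF assms(2) this]
  have "const_comb \<epsilon> A i x \<in> normal_space M x"
    unfolding const_comb_def by (intro subspace_sum subspace_scale N F(7)[OF assms(3)])
  then show ?thesis unfolding normal_connection_def by (rule orth_proj_inner[OF N])
qed

text \<open>The product rule gives one derivative of the trivialization within the bundle; on the
  tangent vector w it has to agree with the one selected by \<open>differential\<close>.\<close>

lemma differential_triv: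
  fixes M Mh :: "(('n::finite, 'm::finite) amb) set"
  assumes F: "adapted_frames M ori U e \<epsilon>" "x \<in> U" and Fh: "adapted_frames Mh orih Uh eh \<epsilon>h" "xh \<in> Uh"
    and w: "(X, Xh, qd, pd) \<in> tangent_space (QP_bundle M ori Mh orih) (x, xh, q, p)"
  shows "differential (QP_bundle M ori Mh orih) (triv e \<epsilon> eh \<epsilon>h) (x, xh, q, p) (X, Xh, qd, pd) =
    (X, Xh,
     \<chi> i j. (qd *v e j x + q *v differential M (e j) x X) \<bullet> eh i xh + (q *v e j x) \<bullet> differential Mh (eh i) xh Xh,
     \<chi> i j. (pd *v \<epsilon> j x + p *v differential M (\<epsilon> j) x X) \<bullet> \<epsilon>h i xh + (p *v \<epsilon> j x) \<bullet> differential Mh (\<epsilon>h i) xh Xh)"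
proof -
  let ?S = "QP_bundle M ori Mh orih" and ?z = "(x, xh, q, p)"
  define L1 L2 :: "('n, 'm) pt \<Rightarrow> ('n, 'm) mat" where "L1 = (\<lambda>z. fst (snd (snd z)))" and "L2 = (\<lambda>z. snd (snd (snd z)))"
  have L: "bounded_linear L1" "bounded_linear L2"
    unfolding L1_def L2_def
    by (intro bounded_linear_fst_comp bounded_linear_snd_comp bounded_linear_ident)+
  have S: "fst ` ?S \<subseteq> M" "(\<lambda>z. fst (snd z)) ` ?S \<subseteq> Mh"
    by (auto simp: QP_bundle_def Q_bundle_def)
  note D = adapted_framesD[OF F(1)] and Dh = adapted_framesD[OF Fh(1)]
  have d1: "(fst has_derivative fst) (at ?z within ?S)"
    by (rule bounded_linear_imp_has_derivative[OF bounded_linear_fst])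
  have d2: "((\<lambda>z. fst (snd z)) has_derivative (\<lambda>z. fst (snd z))) (at ?z within ?S)"
    by (rule bounded_linear_imp_has_derivative[OF bounded_linear_compose[OF bounded_linear_fst bounded_linear_snd]])
  have e: "(e j has_derivative differential M (e j) x) (at (fst ?z) within M)"
    "(\<epsilon> k has_derivative differential M (\<epsilon> k) x) (at (fst ?z) within M)" for j k
    using smooth_map_on_differential[OF D(2,1) F(2)] smooth_map_on_differential[OF D(3,1) F(2)] by simp_all
  have eh: "(eh j has_derivative differential Mh (eh j) xh) (at (fst (snd ?z)) within Mh)"
    "(\<epsilon>h k has_derivative differential Mh (\<epsilon>h k) xh) (at (fst (snd ?z)) within Mh)" for j k
    using smooth_map_on_differential[OF Dh(2,1) Fh(2)] smooth_map_on_differential[OF Dh(3,1) Fh(2)] by simp_all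
  have tr: "triv e \<epsilon> eh \<epsilon>h = (\<lambda>z. (fst z, fst (snd z),
      \<chi> i j. (L1 z *v e j (fst z)) \<bullet> eh i (fst (snd z)), \<chi> i j. (L2 z *v \<epsilon> j (fst z)) \<bullet> \<epsilon>h i (fst (snd z))))"
    by (simp add: triv_def fun_eq_iff L1_def L2_def)
  show ?thesis
    unfolding tr
    using differential_eq[OF has_derivative_Pair[OF d1 has_derivative_Pair[OF d2 has_derivative_Pair[OF
      frame_entry_has_derivative[OF L(1) S e(1) eh(1)] frame_entry_has_derivative[OF L(2) S e(2) eh(2)]]]] w]
    by (simp add: L1_def L2_def)
qed

text \<open>No frame occurs on the right-hand side, so membership in \<open>E_local\<close> has the
  same meaning in all adapted frames.\<close>

lemma E_local_iff:
  fixes M Mh :: "(('n::{finite,linorder}, 'm::{finite,linorder}) amb) set"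
  assumes M: "orientation_on M ori" "levi_civita M nab" and Mh: "orientation_on Mh orih" "levi_civita Mh nabh"
    and F: "adapted_frames M ori U e \<epsilon>" "x \<in> U" and Fh: "adapted_frames Mh orih Uh eh \<epsilon>h" "xh \<in> Uh"
    and z: "(x, xh, q, p) \<in> QP_bundle M ori Mh orih"
    and w: "(X, Xh, qd, pd) \<in> tangent_space (QP_bundle M ori Mh orih) (x, xh, q, p)"
    and X: "X \<in> tangent_space M x" and Xh: "Xh \<in> tangent_space Mh xh"
  shows "differential (QP_bundle M ori Mh orih) (triv e \<epsilon> eh \<epsilon>h) (x, xh, q, p) (X, Xh, qd, pd)
        \<in> E_local M nab Mh nabh e \<epsilon> eh \<epsilon>h (x, xh, q, p) \<longleftrightarrow>
     Xh = q *v X \<and> (\<forall>v\<in>tangent_space M x. \<forall>w\<in>tangent_space Mh xh. (qd *v v) \<bullet> w = 0) \<and>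
     (\<forall>v\<in>normal_space M x. \<forall>w\<in>normal_space Mh xh. (pd *v v) \<bullet> w = 0)"
proof -
  note D = adapted_framesD[OF F(1)] and Dh = adapted_framesD[OF Fh(1)]
  note b = QP_bundleD[OF z]
  note T = tangent_space_oriented[OF M(1) b(1)] and Th = tangent_space_oriented[OF Mh(1) b(2)]
  note bas = adapted_frames_ordered_basis[OF F(1) M(1) F(2)]
  note bash = adapted_frames_ordered_basis[OF Fh(1) Mh(1) Fh(2)]
  let ?A = "\<chi> i j. (q *v e j x) \<bullet> eh i xh" and ?B = "\<chi> i j. (p *v \<epsilon> j x) \<bullet> \<epsilon>h i xh"
  have 1: "(\<chi> i j. (qd *v e j x + q *v differential M (e j) x X) \<bullet> eh i xh + (q *v e j x) \<bullet> differential Mh (eh i) xh Xh) =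
      V_part nab nabh e eh x xh ?A X Xh \<longleftrightarrow> (\<forall>i j. (qd *v e j x) \<bullet> (q *v e i x) = 0)"
  proof (rule V_part_iff[OF D(1) F(2) D(2) D(4) Dh(1) Fh(2) Dh(2) Dh(4) X Xh])
    show "nab (e j) x X \<bullet> e i x = differential M (e j) x X \<bullet> e i x" for i j
      using levi_civita_const_comb[OF F(1) M F(2) X, of "mat 1" j i] by (simp add: const_comb_mat_1)
    show "nabh (const_comb eh A j) xh Xh \<bullet> const_comb eh A i xh =
        differential Mh (const_comb eh A j) xh Xh \<bullet> const_comb eh A i xh" for A i j
      by (rule levi_civita_const_comb[OF Fh(1) Mh Fh(2) Xh])
    show "q *v e j x \<in> span (range (\<lambda>i. eh i xh))" for j
      using Isom0_plusD(3)[OF b(3) T(1)] bash(1) by (simp add: ordered_basis_def)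
    show "(q *v u) \<bullet> (q *v e j x) = u \<bullet> e j x" for u j
      by (rule Isom0_plusD(4)[OF b(3) T(1) D(6)[OF F(2)]])
  qed
  have 2: "(\<chi> i j. (pd *v \<epsilon> j x + p *v differential M (\<epsilon> j) x X) \<bullet> \<epsilon>h i xh + (p *v \<epsilon> j x) \<bullet> differential Mh (\<epsilon>h i) xh Xh) =
      V_part (normal_connection M) (normal_connection Mh) \<epsilon> \<epsilon>h x xh ?B X Xh \<longleftrightarrow>
      (\<forall>i j. (pd *v \<epsilon> j x) \<bullet> (p *v \<epsilon> i x) = 0)"
  proof (rule V_part_iff[OF D(1) F(2) D(3) D(5) Dh(1) Fh(2) Dh(3) Dh(5) X Xh])
    show "normal_connection M (\<epsilon> j) x X \<bullet> \<epsilon> i x = differential M (\<epsilon> j) x X \<bullet> \<epsilon> i x" for i j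
      using normal_connection_const_comb[OF F(1) M(1) F(2), of "mat 1" j X i] by (simp add: const_comb_mat_1)
    show "normal_connection Mh (const_comb \<epsilon>h A j) xh Xh \<bullet> const_comb \<epsilon>h A i xh =
        differential Mh (const_comb \<epsilon>h A j) xh Xh \<bullet> const_comb \<epsilon>h A i xh" for A i j
      by (rule normal_connection_const_comb[OF Fh(1) Mh(1) Fh(2)])
    show "p *v \<epsilon> j x \<in> span (range (\<lambda>i. \<epsilon>h i xh))" for j
      using Isom0_plusD(3)[OF b(4) T(3)] bash(2) by (simp add: ordered_basis_def)
    show "(p *v u) \<bullet> (p *v \<epsilon> j x) = u \<bullet> \<epsilon> j x" for u j
      by (rule Isom0_plusD(4)[OF b(4) T(3) D(7)[OF F(2)]])
  qed
  have E: "(X, Xh, dA, dB) \<in> E_local M nab Mh nabh e \<epsilon> eh \<epsilon>h (x, xh, q, p) \<longleftrightarrow>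
      Xh = q *v X \<and> dA = V_part nab nabh e eh x xh ?A X Xh \<and>
      dB = V_part (normal_connection M) (normal_connection Mh) \<epsilon> \<epsilon>h x xh ?B X Xh" for dA dB
    using X by (auto simp: E_local_def triv_def)
  show ?thesis
    unfolding differential_triv[OF F Fh w] E 1 2
      span_condition_iff[OF bas(1) b(3) T(1) Th(1) T(2)[folded Th(2)]]
      span_condition_iff[OF bas(2) b(4) T(3) Th(3) T(4)[folded Th(4)]] ..
qed

text \<open>The velocity of a curve in the bundle is tangent to the bundle, and its first two
  components are tangent to M and Mh. So the tangency clause of \<open>E_distr\<close> holds
  automatically and \<open>E_local_iff\<close> applies.\<close>

lemma curve_velocity_mem_E_distr_iff:
  fixes M Mh :: "(('n::{finite,linorder}, 'm::{finite,linorder}) amb) set"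
  assumes M: "smooth_submanifold M" "orientation_on M ori" "levi_civita M nab"
    and Mh: "smooth_submanifold Mh" "orientation_on Mh orih" "levi_civita Mh nabh"
    and QP: "\<And>s. s \<in> {0..\<tau>} \<Longrightarrow> (x s, xh s, q s, p s) \<in> QP_bundle M ori Mh orih"
    and t: "t \<in> {0<..<\<tau>}"
    and der: "((\<lambda>s. (x s, xh s, q s, p s)) has_vector_derivative (X, Xh, qd, pd)) (at t)"
  shows "(X, Xh, qd, pd) \<in> E_distr M ori nab Mh orih nabh (x t, xh t, q t, p t) \<longleftrightarrow>
     Xh = q t *v X \<and> (\<forall>v\<in>tangent_space M (x t). \<forall>w\<in>tangent_space Mh (xh t). (qd *v v) \<bullet> w = 0) \<and>
     (\<forall>v\<in>normal_space M (x t). \<forall>w\<in>normal_space Mh (xh t). (pd *v v) \<bullet> w = 0)" (is "_ \<longleftrightarrow> ?R")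
proof -
  have tQP: "(x t, xh t, q t, p t) \<in> QP_bundle M ori Mh orih" using QP t by simp
  note b = QP_bundleD[OF QP]
  have w: "(X, Xh, qd, pd) \<in> tangent_space (QP_bundle M ori Mh orih) (x t, xh t, q t, p t)"
    using QP by (intro tangent_spaceI[OF t _ der]) auto
  have "(x has_vector_derivative X) (at t)"
    using bounded_linear.has_vector_derivative[OF bounded_linear_fst der] by simp
  then have X: "X \<in> tangent_space M (x t)" by (intro tangent_spaceI[OF t]) (use b(1) in auto)
  have "(xh has_vector_derivative Xh) (at t)"
    using bounded_linear.has_vector_derivative[OF bounded_linear_compose[OF bounded_linear_fst bounded_linear_snd] der]
    by simp
  then have Xh: "Xh \<in> tangent_space Mh (xh t)" by (intro tangent_spaceI[OF t]) (use b(2) in auto)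
  obtain U e \<epsilon> where F: "adapted_frames M ori U e \<epsilon>" "x t \<in> U"
    by (rule adapted_frames_exist[OF M(1,2) QP_bundleD(1)[OF tQP]]) (rule that)
  obtain Uh eh \<epsilon>h where Fh: "adapted_frames Mh orih Uh eh \<epsilon>h" "xh t \<in> Uh"
    by (rule adapted_frames_exist[OF Mh(1,2) QP_bundleD(2)[OF tQP]]) (rule that)
  \<comment> \<open>The frames are left open: one direction uses those contained in the membership
    in \<open>E_distr\<close>, the other those obtained above.\<close>
  note iff = E_local_iff[OF M(2,3) Mh(2,3) _ _ _ _ tQP w X Xh]
  show ?thesis
  proof
    assume "(X, Xh, qd, pd) \<in> E_distr M ori nab Mh orih nabh (x t, xh t, q t, p t)"
    then obtain U e \<epsilon> Uh eh \<epsilon>h where F: "adapted_frames M ori U e \<epsilon>" "x t \<in> U"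
      and Fh: "adapted_frames Mh orih Uh eh \<epsilon>h" "xh t \<in> Uh"
      and E: "differential (QP_bundle M ori Mh orih) (triv e \<epsilon> eh \<epsilon>h) (x t, xh t, q t, p t) (X, Xh, qd, pd)
          \<in> E_local M nab Mh nabh e \<epsilon> eh \<epsilon>h (x t, xh t, q t, p t)"
      unfolding E_distr_def by auto
    from E show ?R unfolding iff[OF F Fh] .
  next
    assume R: ?R
    have "differential (QP_bundle M ori Mh orih) (triv e \<epsilon> eh \<epsilon>h) (x t, xh t, q t, p t) (X, Xh, qd, pd)
          \<in> E_local M nab Mh nabh e \<epsilon> eh \<epsilon>h (x t, xh t, q t, p t)"
      unfolding iff[OF F Fh] using R .
    then show "(X, Xh, qd, pd) \<in> E_distr M ori nab Mh orih nabh (x t, xh t, q t, p t)"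
      unfolding E_distr_def using w F Fh by blast
  qed
qed

theorem proposition2:
  fixes M Mh :: "(real ^ ('n::{finite,linorder} + 'm::{finite,linorder})) set"
    and ori orih :: "real ^ ('n + 'm) \<Rightarrow> ('n \<Rightarrow> real ^ ('n + 'm)) set"
    and nab nabh :: "(real ^ ('n + 'm) \<Rightarrow> real ^ ('n + 'm)) \<Rightarrow>
                       real ^ ('n + 'm) \<Rightarrow> real ^ ('n + 'm) \<Rightarrow> real ^ ('n + 'm)"
    and x xh :: "real \<Rightarrow> real ^ ('n + 'm)"
    and q p :: "real \<Rightarrow> real ^ ('n + 'm) ^ ('n + 'm)"
    and \<tau> :: real
  assumes "smooth_submanifold M" "connected M" "orientation_on M ori" "levi_civita M nab"
    and "smooth_submanifold Mh" "connected Mh" "orientation_on Mh orih" "levi_civita Mh nabh"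
    and "0 < \<tau>"
    and "\<forall>t\<in>{0..\<tau>}. (x t, xh t, q t, p t) \<in> QP_bundle M ori Mh orih"
  shows "rolling M ori Mh orih \<tau> x xh q p \<longleftrightarrow>
         horizontal (E_distr M ori nab Mh orih nabh) \<tau> (\<lambda>t. (x t, xh t, q t, p t))"
proof (cases "abs_continuous_on {0..\<tau>} (\<lambda>t. (x t, xh t, q t, p t))")
  case False
  \<comment> \<open>Absolute continuity of the whole curve is a clause of both notions, so both
    sides are false.\<close>
  then show ?thesis by (simp add: rolling_def horizontal_def)
next
  case True
  have QP: "\<And>t. t \<in> {0..\<tau>} \<Longrightarrow> (x t, xh t, q t, p t) \<in> QP_bundle M ori Mh orih" using assms(10) by blast
  note b = QP_bundleD[OF QP]
  note T = tangent_space_oriented[OF assms(3) b(1)] and Th = tangent_space_oriented[OF assms(7) b(2)]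
  have acq: "abs_continuous_on {0..\<tau>} q" and acp: "abs_continuous_on {0..\<tau>} p"
  proof -
    have "norm c \<le> norm (a, b, c, d)" "norm d \<le> norm (a, b, c, d)"
      for a b :: "real ^ ('n + 'm)" and c d :: "real ^ ('n + 'm) ^ ('n + 'm)"
      by (rule order_trans[OF _ order_trans[OF norm_snd_le[of "(c, d)" b] norm_snd_le[of "(b, c, d)" a]]];
          rule norm_fst_le norm_snd_le)+
    then have "norm (q t - q s) \<le> 1 * norm ((x t, xh t, q t, p t) - (x s, xh s, q s, p s))"
      "norm (p t - p s) \<le> 1 * norm ((x t, xh t, q t, p t) - (x s, xh s, q s, p s))" for s t
      by simp_all
    then show "abs_continuous_on {0..\<tau>} q" "abs_continuous_on {0..\<tau>} p"
      using abs_continuous_on_lipschitz[OF True] by blast+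
  qed
  let ?q = "\<lambda>t. \<forall>v\<in>tangent_space M (x t). \<forall>w\<in>tangent_space Mh (xh t). (velocity \<tau> q t *v v) \<bullet> w = 0"
  let ?p = "\<lambda>t. \<forall>v\<in>normal_space M (x t). \<forall>w\<in>normal_space Mh (xh t). (velocity \<tau> p t *v v) \<bullet> w = 0"
  have iff_q: "(\<forall>Z. abs_continuous_on {0..\<tau>} Z \<longrightarrow> (\<forall>t\<in>{0..\<tau>}. Z t \<in> tangent_space M (x t)) \<longrightarrow>
        (AE t in lebesgue_on {0..\<tau>}. q t *v orth_proj (tangent_space M (x t)) (velocity \<tau> Z t) =
           orth_proj (tangent_space Mh (xh t)) (velocity \<tau> (\<lambda>s. q s *v Z s) t))) \<longleftrightarrow>
      (AE t in lebesgue_on {0..\<tau>}. ?q t)"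
    by (rule parallel_fields_iff[OF acq, where oV = "\<lambda>t. ori (x t)" and oW = "\<lambda>t. orih (xh t)"])
      (rule T(1) Th(1) b(3), assumption)+
  have iff_p: "(\<forall>Z. abs_continuous_on {0..\<tau>} Z \<longrightarrow> (\<forall>t\<in>{0..\<tau>}. Z t \<in> normal_space M (x t)) \<longrightarrow>
        (AE t in lebesgue_on {0..\<tau>}. p t *v orth_proj (normal_space M (x t)) (velocity \<tau> Z t) =
           orth_proj (normal_space Mh (xh t)) (velocity \<tau> (\<lambda>s. p s *v Z s) t))) \<longleftrightarrow>
      (AE t in lebesgue_on {0..\<tau>}. ?p t)"
    by (rule parallel_fields_iff[OF acp, where oV = "\<lambda>t. normal_orientation M ori (x t)"
          and oW = "\<lambda>t. normal_orientation Mh orih (xh t)"])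
      (rule T(3) Th(3) b(4), assumption)+
  have "rolling M ori Mh orih \<tau> x xh q p \<longleftrightarrow>
      (AE t in lebesgue_on {0..\<tau>}. velocity \<tau> xh t = q t *v velocity \<tau> x t) \<and>
      (AE t in lebesgue_on {0..\<tau>}. ?q t) \<and> (AE t in lebesgue_on {0..\<tau>}. ?p t)"
    unfolding rolling_def D_dt_def Dperp_dt_def iff_q iff_p using True assms(10) by simp
  also have "\<dots> \<longleftrightarrow> (AE t in lebesgue_on {0..\<tau>}. velocity \<tau> xh t = q t *v velocity \<tau> x t \<and> ?q t \<and> ?p t)"
    by (simp only: AE_conj_iff)
  also have "\<dots> \<longleftrightarrow> (AE t in lebesgue_on {0..\<tau>}. velocity \<tau> (\<lambda>t. (x t, xh t, q t, p t)) t
      \<in> E_distr M ori nab Mh orih nabh (x t, xh t, q t, p t))"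
  \<comment> \<open>The two conditions agree at every interior instant at which the curve is
    differentiable, hence almost everywhere.\<close>
  proof (rule eventually_subst)
    show "AE t in lebesgue_on {0..\<tau>}. (velocity \<tau> xh t = q t *v velocity \<tau> x t \<and> ?q t \<and> ?p t) =
        (velocity \<tau> (\<lambda>t. (x t, xh t, q t, p t)) t \<in> E_distr M ori nab Mh orih nabh (x t, xh t, q t, p t))"
      using abs_continuous_on_AE_derivative[OF True]
    proof eventually_elim
      case (elim t)
      then have t: "t \<in> {0<..<\<tau>}" by blast
      obtain X Xh qd pd where v: "velocity \<tau> (\<lambda>t. (x t, xh t, q t, p t)) t = (X, Xh, qd, pd)"
        by (rule prod_cases4) (rule that)
      have der: "((\<lambda>t. (x t, xh t, q t, p t)) has_vector_derivative (X, Xh, qd, pd)) (at t)"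
        using elim v by simp
      note der2 = bounded_linear.has_vector_derivative[OF bounded_linear_snd der, simplified]
      note der3 = bounded_linear.has_vector_derivative[OF bounded_linear_snd der2, simplified]
      have "velocity \<tau> x t = X" "velocity \<tau> xh t = Xh" "velocity \<tau> q t = qd" "velocity \<tau> p t = pd"
        using bounded_linear.has_vector_derivative[OF bounded_linear_fst der]
          bounded_linear.has_vector_derivative[OF bounded_linear_fst der2]
          bounded_linear.has_vector_derivative[OF bounded_linear_fst der3]
          bounded_linear.has_vector_derivative[OF bounded_linear_snd der3]
        by (auto intro!: velocity_eq[OF t])
      then show ?case
        unfolding v using curve_velocity_mem_E_distr_iff[OF assms(1,3,4,5,7,8) QP t der] by simp
    qed
  qed
  also have "\<dots> \<longleftrightarrow> horizontal (E_distr M ori nab Mh orih nabh) \<tau> (\<lambda>t. (x t, xh t, q t, p t))"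
    using True by (simp add: horizontal_def)
  finally show ?thesis .
qed

end
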